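(* Let $\Lambda$ be a finite, strongly connected $k$-graph with adjacency matrices $A_1,\dots,A_k$ such that $A=A_1\cdots A_k$ is irreducible. Let $\delta\in(0,1)$ be such that $w_\delta(\lambda)=\operatorname{diam}[\lambda]$ for all $\lambda\in F\mathcal{B}_\Lambda$, where the diameter is taken with respect to $d_\delta$. Then the measure $\mu_\delta$ on $X_{\mathcal{B}_\Lambda}\cong\Lambda^\infty$ induced by the Dixmier trace agrees with the measure $M$: for any $\lambda\in F\mathcal{B}_\Lambda$ with $|\lambda|=qk+t$, $q,t\in\mathbb{N}$, $0\le t\le k-1$, $$\mu_\delta([\lambda])=(\rho_1\cdots\rho_t)^{-(q+1)}(\rho_{t+1}\cdots\rho_k)^{-q}x^\Lambda_{s(\lambda)}=M([\lambda]).$$ In particular, $\mu_\delta$ is a probability measure which is independent of $\delta$.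
   Context: $\mathbb{N}=\{0,1,2,\dots\}$. A $k$-graph is a countable small category $\Lambda$ with a functor $d:\Lambda\to\mathbb{N}^k$ ($\mathbb{N}^k$ viewed as a one-object category) satisfying the factorization property: if $d(\lambda)=m+n$, there are unique $\mu,\nu\in\Lambda$ with $d(\mu)=m$, $d(\nu)=n$ and $\lambda=\mu\nu$. $r,s$ denote range and source of morphisms; $\Lambda^n=d^{-1}(n)$; $\Lambda^0$ is the set of vertices. $\Lambda$ is finite if every $\Lambda^n$ is finite, and strongly connected if for all $v,w\in\Lambda^0$ there is a morphism with range $v$ and source $w$. $A_i(v,w)=\#\{\lambda\in\Lambda^{e_i}: r(\lambda)=v,s(\lambda)=w\}$, and $\rho_i$ is the spectral radius of $A_i$. The Perron–Frobenius eigenvector $x^\Lambda\in(0,\infty)^{\Lambda^0}$ is the unique positive vector with $\sum_v x^\Lambda_v=1$ and $A_ix^\Lambda=\rho_ix^\Lambda$ for all $i$. The stationary $k$-Bratteli diagram $\mathcal{B}_\Lambda$ has vertex set $\bigsqcup_{n\ge0}\mathcal{V}_n$, each $\mathcal{V}_n$ a copy of $\Lambda^0$, and edge set $\bigsqcup_{n\ge1}\mathcal{E}_n$; edges in $\mathcal{E}_n$ have source in $\mathcal{V}_n$ and range in $\mathcal{V}_{n-1}$, and if $n\equiv i\pmod k$ with $1\le i\le k$, there are $A_i(p,q)$ edges with range $p\in\mathcal{V}_{n-1}$ and source $q\in\mathcal{V}_n$. $X_{\mathcal{B}_\Lambda}$ is the set of infinite paths $(x_n)_{n\ge1}$, $x_n\in\mathcal{E}_n$,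 $s(x_n)=r(x_{n+1})$ (it is identified with the infinite path space $\Lambda^\infty$ of $\Lambda$); $F\mathcal{B}_\Lambda$ is the set of finite paths with range in $\mathcal{V}_0$ (length-$0$ paths being vertices of $\mathcal{V}_0$); $|\eta|$ is length; $[\lambda]$ is the set of infinite paths with initial segment $\lambda$, and these cylinder sets generate the topology. $F_\gamma\mathcal{B}_\Lambda$ is the set of $\lambda\in F\mathcal{B}_\Lambda$ having $\gamma$ as initial segment. For $|\eta|=qk+t$ with $q,t\in\mathbb{N}$, $0\le t\le k-1$, $w_\delta(\eta)=\left(\rho_1^{q+1}\cdots\rho_t^{q+1}\rho_{t+1}^q\cdots\rho_k^q\right)^{-1/\delta}x^\Lambda_{s(\eta)}$. The metric $d_\delta$ on $X_{\mathcal{B}_\Lambda}$ is: $d_\delta(x,x)=0$; $d_\delta(x,y)=1$ if $x,y$ have no common initial segment in $F\mathcal{B}_\Lambda$; otherwise $d_\delta(x,y)=w_\delta(x\wedge y)$, $x\wedge y$ being the longest common initial segment. $\operatorname{diam}[\lambda]=\sup\{d_\delta(x,y):x,y\in[\lambda]\}$. $\mu_\delta$ is the finite Borel measure on $X_{\mathcal{B}_\Lambda}$ determined by $\mu_\delta([\gamma])=\lim_{s\searrow\delta}\frac{\sum_{\lambda\in F_\gamma\mathcal{B}_\Lambda}w_\delta(\lambda)^s}{\zeta_\delta(s)}$, $\zeta_\delta(s)=\sum_{\lambda\in F\mathcal{B}_\Lambda}w_\delta(\lambda)^s$. $M$ is the Borel probability measure of an Huef–Laca–Raeburn–Sims on $\Lambda^\infty$,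 $M([\lambda])=\rho_1^{-d(\lambda)_1}\cdots\rho_k^{-d(\lambda)_k}x^\Lambda_{s(\lambda)}$ for $\lambda\in\Lambda$; transported to $X_{\mathcal{B}_\Lambda}$ it is given on cylinder sets by the middle expression displayed in the claim. *)

theory Defs
  imports
    "HOL-Probability.Probability"
    "HOL-Library.Sublist"
    "Jordan_Normal_Form.Spectral_Radius"
begin

section \<open>Higher-rank graphs\<close>

text \<open>
  The monoid of \<open>k\<close>-tuples of natural numbers is the set of functions \<^typ>\<open>nat \<Rightarrow> nat\<close>
  that vanish outside the index set \<open>{1..k}\<close>.
\<close>

definition degs :: "nat \<Rightarrow> (nat \<Rightarrow> nat) set" where
  "degs k = {n. \<forall>i. i \<notin> {1..k} \<longrightarrow> n i = 0}"

definition unit_deg :: "nat \<Rightarrow> nat \<Rightarrow> nat" where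
  "unit_deg i = (\<lambda>j. if j = i then 1 else 0)"

text \<open>
  A small category is presented by its morphisms only, objects being identified with their
  identity morphisms: \<open>rng f\<close> and \<open>src f\<close> are the identities at the range and at the source
  of \<open>f\<close>, and \<open>cmp f g\<close>, the composite \<open>fg\<close>, is meaningful when \<open>src f = rng g\<close>.
\<close>

record 'm graded_category =
  mor :: "'m set"
  rng :: "'m \<Rightarrow> 'm"
  src :: "'m \<Rightarrow> 'm"
  cmp :: "'m \<Rightarrow> 'm \<Rightarrow> 'm"
  deg :: "'m \<Rightarrow> nat \<Rightarrow> nat"

locale k_graph =
  fixes k :: nat and \<Lambda> :: "'m graded_category"
  assumes countable_mor: "countable (mor \<Lambda>)"
    and rng_in: "f \<in> mor \<Lambda> \<Longrightarrow> rng \<Lambda> f \<in> mor \<Lambda>"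
    and src_in: "f \<in> mor \<Lambda> \<Longrightarrow> src \<Lambda> f \<in> mor \<Lambda>"
    and rng_rng: "f \<in> mor \<Lambda> \<Longrightarrow> rng \<Lambda> (rng \<Lambda> f) = rng \<Lambda> f"
    and src_rng: "f \<in> mor \<Lambda> \<Longrightarrow> src \<Lambda> (rng \<Lambda> f) = rng \<Lambda> f"
    and rng_src: "f \<in> mor \<Lambda> \<Longrightarrow> rng \<Lambda> (src \<Lambda> f) = src \<Lambda> f"
    and src_src: "f \<in> mor \<Lambda> \<Longrightarrow> src \<Lambda> (src \<Lambda> f) = src \<Lambda> f"
    and cmp_in: "\<lbrakk>f \<in> mor \<Lambda>; g \<in> mor \<Lambda>; src \<Lambda> f = rng \<Lambda> g\<rbrakk> \<Longrightarrow> cmp \<Lambda> f g \<in> mor \<Lambda>"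
    and rng_cmp: "\<lbrakk>f \<in> mor \<Lambda>; g \<in> mor \<Lambda>; src \<Lambda> f = rng \<Lambda> g\<rbrakk> \<Longrightarrow> rng \<Lambda> (cmp \<Lambda> f g) = rng \<Lambda> f"
    and src_cmp: "\<lbrakk>f \<in> mor \<Lambda>; g \<in> mor \<Lambda>; src \<Lambda> f = rng \<Lambda> g\<rbrakk> \<Longrightarrow> src \<Lambda> (cmp \<Lambda> f g) = src \<Lambda> g"
    and cmp_rng: "f \<in> mor \<Lambda> \<Longrightarrow> cmp \<Lambda> (rng \<Lambda> f) f = f"
    and cmp_src: "f \<in> mor \<Lambda> \<Longrightarrow> cmp \<Lambda> f (src \<Lambda> f) = f"
    and cmp_assoc: "\<lbrakk>f \<in> mor \<Lambda>; g \<in> mor \<Lambda>; h \<in> mor \<Lambda>; src \<Lambda> f = rng \<Lambda> g; src \<Lambda> g = rng \<Lambda> h\<rbrakk>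
      \<Longrightarrow> cmp \<Lambda> (cmp \<Lambda> f g) h = cmp \<Lambda> f (cmp \<Lambda> g h)"
    and deg_in: "f \<in> mor \<Lambda> \<Longrightarrow> deg \<Lambda> f \<in> degs k"
    and deg_identity: "f \<in> mor \<Lambda> \<Longrightarrow> deg \<Lambda> (rng \<Lambda> f) = (\<lambda>_. 0)"
    and deg_cmp: "\<lbrakk>f \<in> mor \<Lambda>; g \<in> mor \<Lambda>; src \<Lambda> f = rng \<Lambda> g\<rbrakk>
      \<Longrightarrow> deg \<Lambda> (cmp \<Lambda> f g) = (\<lambda>i. deg \<Lambda> f i + deg \<Lambda> g i)"
    and factorization: "\<lbrakk>f \<in> mor \<Lambda>; m \<in> degs k; n \<in> degs k; deg \<Lambda> f = (\<lambda>i. m i + n i)\<rbrakk>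
      \<Longrightarrow> \<exists>!p. fst p \<in> mor \<Lambda> \<and> snd p \<in> mor \<Lambda> \<and> src \<Lambda> (fst p) = rng \<Lambda> (snd p)
            \<and> deg \<Lambda> (fst p) = m \<and> deg \<Lambda> (snd p) = n \<and> cmp \<Lambda> (fst p) (snd p) = f"

definition mor_of_deg :: "'m graded_category \<Rightarrow> (nat \<Rightarrow> nat) \<Rightarrow> 'm set" where
  "mor_of_deg \<Lambda> n = {f \<in> mor \<Lambda>. deg \<Lambda> f = n}"

abbreviation verts :: "'m graded_category \<Rightarrow> 'm set" where
  "verts \<Lambda> \<equiv> mor_of_deg \<Lambda> (\<lambda>_. 0)"

definition finite_graph :: "nat \<Rightarrow> 'm graded_category \<Rightarrow> bool" where
  "finite_graph k \<Lambda> \<longleftrightarrow> (\<forall>n\<in>degs k. finite (mor_of_deg \<Lambda> n))"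

definition strongly_connected_graph :: "'m graded_category \<Rightarrow> bool" where
  "strongly_connected_graph \<Lambda> \<longleftrightarrow>
     (\<forall>v\<in>verts \<Lambda>. \<forall>w\<in>verts \<Lambda>. \<exists>f\<in>mor \<Lambda>. rng \<Lambda> f = v \<and> src \<Lambda> f = w)"

section \<open>Adjacency matrices and the Perron--Frobenius eigenvector\<close>

definition adj :: "'m graded_category \<Rightarrow> nat \<Rightarrow> 'm \<Rightarrow> 'm \<Rightarrow> nat" where
  "adj \<Lambda> i v w = card {f \<in> mor_of_deg \<Lambda> (unit_deg i). rng \<Lambda> f = v \<and> src \<Lambda> f = w}"

text \<open>
  For a finite vertex set \<^term>\<open>from_nat_into (verts \<Lambda>)\<close> is a bijection from
  \<open>{..<card (verts \<Lambda>)}\<close> onto it; it is used to list the rows and columns of all adjacency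
  matrices. Neither the spectral radius nor irreducibility depends on the enumeration.
\<close>

definition adj_mat :: "'m graded_category \<Rightarrow> nat \<Rightarrow> nat mat" where
  "adj_mat \<Lambda> i = Matrix.mat (card (verts \<Lambda>)) (card (verts \<Lambda>))
     (\<lambda>(a, b). adj \<Lambda> i (from_nat_into (verts \<Lambda>) a) (from_nat_into (verts \<Lambda>) b))"

definition adj_mat_prod :: "nat \<Rightarrow> 'm graded_category \<Rightarrow> nat mat" where
  "adj_mat_prod k \<Lambda> = foldr (\<lambda>i B. adj_mat \<Lambda> i * B) [1..<Suc k] (1\<^sub>m (card (verts \<Lambda>)))"

definition irreducible_mat :: "nat mat \<Rightarrow> bool" where
  "irreducible_mat B \<longleftrightarrow> square_mat B \<and>
     (\<forall>a<dim_row B. \<forall>b<dim_row B. \<exists>p>0. (B ^\<^sub>m p) $$ (a, b) > 0)"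

definition rho :: "'m graded_category \<Rightarrow> nat \<Rightarrow> real" where
  "rho \<Lambda> i = spectral_radius (map_mat of_nat (adj_mat \<Lambda> i))"

definition perron_vec :: "nat \<Rightarrow> 'm graded_category \<Rightarrow> 'm \<Rightarrow> real" where
  "perron_vec k \<Lambda> = (THE x. x \<in> extensional (verts \<Lambda>) \<and> (\<forall>v\<in>verts \<Lambda>. 0 < x v)
     \<and> (\<Sum>v\<in>verts \<Lambda>. x v) = 1
     \<and> (\<forall>i\<in>{1..k}. \<forall>v\<in>verts \<Lambda>. (\<Sum>w\<in>verts \<Lambda>. real (adj \<Lambda> i v w) * x w) = rho \<Lambda> i * x v))"

section \<open>The stationary Bratteli diagram\<close>

text \<open>
  The diagram is realized by disjoint copies of the vertices and of the morphisms of degree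
  \<^term>\<open>unit_deg i\<close>: a vertex (edge) of level \<open>n\<close> is a pair \<open>(n, v)\<close>
  (\<open>(n, f)\<close>, \<open>n \<ge> 1\<close>). The lemma \<open>card_bedges\<close> below is the required count of edges.
\<close>

definition bverts :: "'m graded_category \<Rightarrow> nat \<Rightarrow> (nat \<times> 'm) set" where
  "bverts \<Lambda> n = {n} \<times> verts \<Lambda>"

text \<open>The unique \<open>i\<close> with \<open>1 \<le> i \<le> k\<close> that is congruent to \<open>n\<close> modulo \<open>k\<close>, for \<open>n \<ge> 1\<close>.\<close>

definition colour :: "nat \<Rightarrow> nat \<Rightarrow> nat" where
  "colour k n = (n - 1) mod k + 1"

definition bedges :: "nat \<Rightarrow> 'm graded_category \<Rightarrow> nat \<Rightarrow> (nat \<times> 'm) set" where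
  "bedges k \<Lambda> n = {n} \<times> mor_of_deg \<Lambda> (unit_deg (colour k n))"

definition brng :: "'m graded_category \<Rightarrow> nat \<times> 'm \<Rightarrow> nat \<times> 'm" where
  "brng \<Lambda> e = (fst e - 1, rng \<Lambda> (snd e))"

definition bsrc :: "'m graded_category \<Rightarrow> nat \<times> 'm \<Rightarrow> nat \<times> 'm" where
  "bsrc \<Lambda> e = (fst e, src \<Lambda> (snd e))"

lemma card_bedges:
  assumes "n \<ge> 1"
  shows "card {e \<in> bedges k \<Lambda> n. brng \<Lambda> e = (n - 1, p) \<and> bsrc \<Lambda> e = (n, q)}
       = adj \<Lambda> (colour k n) p q"
proof -
  have "{e \<in> bedges k \<Lambda> n. brng \<Lambda> e = (n - 1, p) \<and> bsrc \<Lambda> e = (n, q)}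
      = Pair n ` {f \<in> mor_of_deg \<Lambda> (unit_deg (colour k n)). rng \<Lambda> f = p \<and> src \<Lambda> f = q}"
    by (auto simp: bedges_def brng_def bsrc_def)
  then show ?thesis
    by (simp add: adj_def card_image inj_on_def)
qed

text \<open>Infinite paths are indexed by \<open>n \<ge> 1\<close>, hence extensional on \<open>{1..}\<close>.\<close>

definition bpaths :: "nat \<Rightarrow> 'm graded_category \<Rightarrow> (nat \<Rightarrow> nat \<times> 'm) set" where
  "bpaths k \<Lambda> = {x \<in> (\<Pi>\<^sub>E n\<in>{1..}. bedges k \<Lambda> n). \<forall>n\<ge>1. bsrc \<Lambda> (x n) = brng \<Lambda> (x (Suc n))}"

text \<open>
  A finite path is a pair \<open>(v, es)\<close> of its range \<open>v\<close> and its list of edges \<open>es\<close>; the paths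
  of length \<open>0\<close> are the pairs \<open>(v, [])\<close>. As \<open>es ! j\<close> is the \<open>j+1\<close>-st edge, it lies in level \<open>j+1\<close>.
\<close>

type_synonym 'm fpath = "(nat \<times> 'm) \<times> (nat \<times> 'm) list"

definition fpaths :: "nat \<Rightarrow> 'm graded_category \<Rightarrow> 'm fpath set" where
  "fpaths k \<Lambda> = {(v, es). v \<in> bverts \<Lambda> 0
     \<and> (\<forall>j<length es. es ! j \<in> bedges k \<Lambda> (Suc j))
     \<and> (es \<noteq> [] \<longrightarrow> brng \<Lambda> (es ! 0) = v)
     \<and> (\<forall>j. Suc j < length es \<longrightarrow> bsrc \<Lambda> (es ! j) = brng \<Lambda> (es ! Suc j))}"

definition flen :: "'m fpath \<Rightarrow> nat" where
  "flen \<eta> = length (snd \<eta>)"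

definition fsrc :: "'m graded_category \<Rightarrow> 'm fpath \<Rightarrow> nat \<times> 'm" where
  "fsrc \<Lambda> \<eta> = (if snd \<eta> = [] then fst \<eta> else bsrc \<Lambda> (last (snd \<eta>)))"

definition fpaths_ext :: "nat \<Rightarrow> 'm graded_category \<Rightarrow> 'm fpath \<Rightarrow> 'm fpath set" where
  "fpaths_ext k \<Lambda> \<gamma> = {\<eta> \<in> fpaths k \<Lambda>. fst \<eta> = fst \<gamma> \<and> prefix (snd \<gamma>) (snd \<eta>)}"

definition init_seg :: "'m graded_category \<Rightarrow> (nat \<Rightarrow> nat \<times> 'm) \<Rightarrow> nat \<Rightarrow> 'm fpath" where
  "init_seg \<Lambda> x n = (brng \<Lambda> (x 1), map x [1..<Suc n])"

definition bcyl :: "nat \<Rightarrow> 'm graded_category \<Rightarrow> 'm fpath \<Rightarrow> (nat \<Rightarrow> nat \<times> 'm) set" where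
  "bcyl k \<Lambda> \<eta> = {x \<in> bpaths k \<Lambda>. init_seg \<Lambda> x (flen \<eta>) = \<eta>}"

definition bpath_borel :: "nat \<Rightarrow> 'm graded_category \<Rightarrow> (nat \<Rightarrow> nat \<times> 'm) measure" where
  "bpath_borel k \<Lambda> = sigma (bpaths k \<Lambda>)
     {U. openin (topology_generated_by (bcyl k \<Lambda> ` fpaths k \<Lambda>)) U}"

section \<open>Weights, ultrametric and the measure of the Dixmier trace\<close>

definition weight :: "nat \<Rightarrow> 'm graded_category \<Rightarrow> real \<Rightarrow> 'm fpath \<Rightarrow> real" where
  "weight k \<Lambda> \<delta> \<eta> = (let q = flen \<eta> div k; t = flen \<eta> mod k in
     ((\<Prod>i=1..t. rho \<Lambda> i ^ (q + 1)) * (\<Prod>i=t+1..k. rho \<Lambda> i ^ q)) powr (- 1 / \<delta>)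
       * perron_vec k \<Lambda> (snd (fsrc \<Lambda> \<eta>)))"

definition common_seg :: "'m graded_category \<Rightarrow> (nat \<Rightarrow> nat \<times> 'm) \<Rightarrow> (nat \<Rightarrow> nat \<times> 'm) \<Rightarrow> 'm fpath" where
  "common_seg \<Lambda> x y = init_seg \<Lambda> x (GREATEST n. init_seg \<Lambda> x n = init_seg \<Lambda> y n)"

definition bdist :: "nat \<Rightarrow> 'm graded_category \<Rightarrow> real \<Rightarrow> (nat \<Rightarrow> nat \<times> 'm) \<Rightarrow> (nat \<Rightarrow> nat \<times> 'm) \<Rightarrow> real" where
  "bdist k \<Lambda> \<delta> x y = (if x = y then 0
     else if \<nexists>\<eta>. \<eta> \<in> fpaths k \<Lambda> \<and> x \<in> bcyl k \<Lambda> \<eta> \<and> y \<in> bcyl k \<Lambda> \<eta> then 1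
     else weight k \<Lambda> \<delta> (common_seg \<Lambda> x y))"

definition bdiam :: "nat \<Rightarrow> 'm graded_category \<Rightarrow> real \<Rightarrow> 'm fpath \<Rightarrow> real" where
  "bdiam k \<Lambda> \<delta> \<eta> = Sup {bdist k \<Lambda> \<delta> x y |x y. x \<in> bcyl k \<Lambda> \<eta> \<and> y \<in> bcyl k \<Lambda> \<eta>}"

definition zeta :: "nat \<Rightarrow> 'm graded_category \<Rightarrow> real \<Rightarrow> real \<Rightarrow> real" where
  "zeta k \<Lambda> \<delta> s = (\<Sum>\<^sub>\<infinity>\<eta>\<in>fpaths k \<Lambda>. weight k \<Lambda> \<delta> \<eta> powr s)"

definition dixmier_measure :: "nat \<Rightarrow> 'm graded_category \<Rightarrow> real \<Rightarrow> (nat \<Rightarrow> nat \<times> 'm) measure" where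
  "dixmier_measure k \<Lambda> \<delta> = (THE \<mu>. sets \<mu> = sets (bpath_borel k \<Lambda>) \<and> finite_measure \<mu>
     \<and> (\<forall>\<gamma>\<in>fpaths k \<Lambda>.
          ((\<lambda>s. (\<Sum>\<^sub>\<infinity>\<eta>\<in>fpaths_ext k \<Lambda> \<gamma>. weight k \<Lambda> \<delta> \<eta> powr s) / zeta k \<Lambda> \<delta> s)
             \<longlongrightarrow> measure \<mu> (bcyl k \<Lambda> \<gamma>)) (at_right \<delta>)))"

section \<open>The infinite path space of the graph and its canonical measure\<close>

text \<open>
  Infinite paths in \<open>\<Lambda>\<close> are the degree-preserving functors into \<open>\<Lambda>\<close> from the \<open>k\<close>-graph
  whose morphisms are the pairs \<open>(m, n)\<close> of degrees with \<open>m \<le> n\<close> pointwise, with range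
  \<open>m = (m, m)\<close>, source \<open>n = (n, n)\<close> and degree \<open>n - m\<close>.
\<close>

definition Omega_graph :: "nat \<Rightarrow> ((nat \<Rightarrow> nat) \<times> (nat \<Rightarrow> nat)) graded_category" where
  "Omega_graph k =
     \<lparr> mor = {(m, n). m \<in> degs k \<and> n \<in> degs k \<and> m \<le> n},
       rng = (\<lambda>(m, n). (m, m)),
       src = (\<lambda>(m, n). (n, n)),
       cmp = (\<lambda>(m, n) (n', p). (m, p)),
       deg = (\<lambda>(m, n) i. n i - m i) \<rparr>"

definition graph_morphisms :: "'a graded_category \<Rightarrow> 'm graded_category \<Rightarrow> ('a \<Rightarrow> 'm) set" where
  "graph_morphisms \<Gamma> \<Lambda> = {\<phi> \<in> mor \<Gamma> \<rightarrow>\<^sub>E mor \<Lambda>.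
     (\<forall>f\<in>mor \<Gamma>. rng \<Lambda> (\<phi> f) = \<phi> (rng \<Gamma> f) \<and> src \<Lambda> (\<phi> f) = \<phi> (src \<Gamma> f) \<and> deg \<Lambda> (\<phi> f) = deg \<Gamma> f)
     \<and> (\<forall>f\<in>mor \<Gamma>. \<forall>g\<in>mor \<Gamma>. src \<Gamma> f = rng \<Gamma> g \<longrightarrow> \<phi> (cmp \<Gamma> f g) = cmp \<Lambda> (\<phi> f) (\<phi> g))}"

type_synonym 'm gpath = "(nat \<Rightarrow> nat) \<times> (nat \<Rightarrow> nat) \<Rightarrow> 'm"

definition gpaths :: "nat \<Rightarrow> 'm graded_category \<Rightarrow> 'm gpath set" where
  "gpaths k \<Lambda> = graph_morphisms (Omega_graph k) \<Lambda>"

definition gcyl :: "nat \<Rightarrow> 'm graded_category \<Rightarrow> 'm \<Rightarrow> 'm gpath set" where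
  "gcyl k \<Lambda> f = {z \<in> gpaths k \<Lambda>. z ((\<lambda>_. 0), deg \<Lambda> f) = f}"

definition gpath_borel :: "nat \<Rightarrow> 'm graded_category \<Rightarrow> 'm gpath measure" where
  "gpath_borel k \<Lambda> = sigma (gpaths k \<Lambda>)
     {U. openin (topology_generated_by (gcyl k \<Lambda> ` mor \<Lambda>)) U}"

definition perron_measure :: "nat \<Rightarrow> 'm graded_category \<Rightarrow> 'm gpath measure" where
  "perron_measure k \<Lambda> = (THE M. sets M = sets (gpath_borel k \<Lambda>) \<and> prob_space M
     \<and> (\<forall>f\<in>mor \<Lambda>. measure M (gcyl k \<Lambda> f)
          = (\<Prod>i=1..k. rho \<Lambda> i powi (- int (deg \<Lambda> f i))) * perron_vec k \<Lambda> (src \<Lambda> f)))"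

text \<open>
  The identification of the two path spaces. A path of length \<open>n\<close> in the Bratteli diagram
  composes to a morphism of degree \<open>len_deg k n\<close>, and the \<open>n\<close>-th edge of the path that
  corresponds to \<open>z\<close> is the segment of \<open>z\<close> between two consecutive such degrees.
\<close>

definition len_deg :: "nat \<Rightarrow> nat \<Rightarrow> nat \<Rightarrow> nat" where
  "len_deg k n = (\<lambda>i. card {j \<in> {1..n}. colour k j = i})"

definition to_bpath :: "nat \<Rightarrow> 'm gpath \<Rightarrow> nat \<Rightarrow> nat \<times> 'm" where
  "to_bpath k z = (\<lambda>n\<in>{1..}. (n, z (len_deg k (n - 1), len_deg k n)))"

definition perron_measure_on_bpaths :: "nat \<Rightarrow> 'm graded_category \<Rightarrow> (nat \<Rightarrow> nat \<times> 'm) measure" where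
  "perron_measure_on_bpaths k \<Lambda> = distr (perron_measure k \<Lambda>) (bpath_borel k \<Lambda>) (to_bpath k)"

end

theory Submission
  imports Defs
begin

text \<open>
  Write \<open>T\<^sub>i\<close> for the adjacency matrix of colour \<open>i\<close>, \<open>x\<close> for the Perron--Frobenius vector and
  \<open>R = \<rho>\<^sub>1 \<cdots> \<rho>\<^sub>k\<close>. The weighted sums \<open>N\<^sub>v(s)\<close> of \<open>w\<^sub>\<delta>(\<eta>)\<^sup>s\<close> over the paths \<open>\<eta>\<close> with range \<open>v\<close> satisfy
  \<open>N(s) = b(s) + R powr (- s / \<delta>) T\<^sub>1 \<cdots> T\<^sub>k N(s)\<close> with \<open>b(s)\<close> bounded near \<open>\<delta>\<close>, because the diagram is
  stationary with period \<open>k\<close>. The diameter hypothesis forces \<open>R > 1\<close>, so that \<open>\<zeta>(s) = \<Sum>\<^sub>v N\<^sub>v(s)\<close> is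
  finite for \<open>s > \<delta>\<close> and tends to infinity as \<open>s\<close> decreases to \<open>\<delta>\<close>. Hence every limit point of
  \<open>N(s) / \<zeta>(s)\<close> is a nonnegative eigenvector of \<open>T\<^sub>1 \<cdots> T\<^sub>k\<close> with eigenvalue \<open>R\<close> and coordinate sum 1,
  which irreducibility identifies with \<open>x\<close>; this gives the measures of the cylinders of vertices, and
  those of longer paths follow by splitting off one edge at a time. On the side of the graph, the
  factorization property makes the infinite paths of the graph and of the diagram correspond
  bijectively, and the two systems of cylinder sets generate the same measurable sets.
\<close>

section \<open>Nonnegative irreducible matrices\<close>

lemma sets_sigma_topology_generated_by:
  assumes "countable S" and S: "S \<subseteq> Pow \<Omega>"
  shows "sets (sigma \<Omega> {U. openin (topology_generated_by S) U}) = sigma_sets \<Omega> S"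
proof -
  have sub: "{U. openin (topology_generated_by S) U} \<subseteq> Pow \<Omega>"
    using openin_subset[of "topology_generated_by S"] S by fastforce
  have ctbl: "countable {F. finite F \<and> F \<subseteq> S}"
    using countable_Collect_finite_subset[OF assms(1)] by simp
  have "sigma_sets \<Omega> {U. openin (topology_generated_by S) U} = sigma_sets \<Omega> S"
  proof (rule sigma_sets_eqI)
    fix U assume "U \<in> {U. openin (topology_generated_by S) U}"
    then have "generate_topology_on S U"
      by (simp add: openin_topology_generated_by_iff)
    then obtain \<U> where U: "\<And>T. T \<in> \<U> \<Longrightarrow> \<exists>F. finite' F \<and> F \<subseteq> S \<and> \<Inter>F = T" "U = \<Union>\<U>"
      unfolding generate_topology_on_eq union_of_def intersection_of_def by auto
    have "\<U> \<subseteq> Inter ` {F. finite F \<and> F \<subseteq> S}"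
      using U(1) by fastforce
    then have "countable \<U>"
      by (rule countable_subset) (intro countable_image ctbl)
    moreover have "T \<in> sigma_sets \<Omega> S" if T: "T \<in> \<U>" for T
    proof -
      obtain F where F: "finite F" "F \<noteq> {}" "F \<subseteq> S" "T = \<Inter>F"
        using U(1)[OF T] by auto
      interpret sigma_algebra \<Omega> "sigma_sets \<Omega> S"
        using S by (rule sigma_algebra_sigma_sets)
      have "(\<Inter>A\<in>F. A) \<in> sigma_sets \<Omega> S"
        using F by (intro finite_INT) auto
      then show ?thesis
        using F by simp
    qed
    ultimately show "U \<in> sigma_sets \<Omega> S"
      unfolding U(2) by (intro sigma_sets_UNION) auto
  next
    fix U assume "U \<in> S"
    then show "U \<in> sigma_sets \<Omega> {U. openin (topology_generated_by S) U}"
      by (auto simp: openin_topology_generated_by_iff intro: generate_topology_on.Basis)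
  qed
  then show ?thesis
    using sub by simp
qed

lemma bounded_family_convergent_subseq:
  fixes f :: "nat \<Rightarrow> 'a \<Rightarrow> real"
  assumes "finite V" and "\<And>n v. v \<in> V \<Longrightarrow> f n v \<in> {a..b}"
  shows "\<exists>r l. strict_mono r \<and> (\<forall>v\<in>V. (\<lambda>n. f (r n) v) \<longlonglongrightarrow> l v)"
  using assms
proof (induction V)
  case empty
  then show ?case
    by (auto intro: strict_mono_id)
next
  case (insert u V)
  then obtain r l where r: "strict_mono (r :: nat \<Rightarrow> nat)" "\<forall>v\<in>V. (\<lambda>n. f (r n) v) \<longlonglongrightarrow> l v"
    by auto
  have "\<forall>n. f (r n) u \<in> {a..b}"
    using insert.prems by auto
  then obtain c r' where r': "strict_mono (r' :: nat \<Rightarrow> nat)" "((\<lambda>n. f (r n) u) \<circ> r') \<longlonglongrightarrow> c"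
    using compact_Icc[of a b] unfolding compact_def by (elim allE[of _ "\<lambda>n. f (r n) u"]) blast
  show ?case
  proof (intro exI conjI ballI)
    show "strict_mono (r \<circ> r')"
      using r r' by (simp add: strict_mono_o)
    fix v assume v: "v \<in> insert u V"
    show "(\<lambda>n. f ((r \<circ> r') n) v) \<longlonglongrightarrow> (l(u := c)) v"
    proof (cases "v = u")
      case False
      then have "((\<lambda>n. f (r n) v) \<circ> r') \<longlonglongrightarrow> l v"
        using v r r' by (intro LIMSEQ_subseq_LIMSEQ) auto
      with False show ?thesis
        by (simp add: o_def)
    qed (use r' in \<open>simp add: o_def\<close>)
  qed
qed

lemma summable_quasi_geometric:
  fixes f :: "nat \<Rightarrow> real"
  assumes f: "\<And>n. 0 \<le> f n" and q: "\<And>n. f (n + k) = q * f n" "q < 1"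
  shows "summable f"
proof (rule summableI_nonneg_bounded)
  fix N
  have "(\<Sum>n<N. f n) \<le> (\<Sum>n<N+k. f n)"
    using f by (intro sum_mono2) auto
  also have "\<dots> = (\<Sum>n<k. f n) + (\<Sum>n<N. f (n + k))"
    by (induction N) auto
  also have "(\<Sum>n<N. f (n + k)) = q * (\<Sum>n<N. f n)"
    by (simp add: q sum_distrib_left)
  finally have "(1 - q) * (\<Sum>n<N. f n) \<le> (\<Sum>n<k. f n)"
    by (simp add: algebra_simps)
  then show "(\<Sum>n<N. f n) \<le> (\<Sum>n<k. f n) / (1 - q)"
    using q by (simp add: field_simps)
qed (use f in simp)

definition mat_apply :: "'a set \<Rightarrow> ('a \<Rightarrow> 'a \<Rightarrow> real) \<Rightarrow> ('a \<Rightarrow> real) \<Rightarrow> 'a \<Rightarrow> real" where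
  "mat_apply V C y v = (\<Sum>w\<in>V. C v w * y w)"

locale nonneg_irreducible =
  fixes V :: "'a set" and C :: "'a \<Rightarrow> 'a \<Rightarrow> real"
  assumes fin: "finite V" and ne: "V \<noteq> {}"
    and nonneg: "\<And>v w. v \<in> V \<Longrightarrow> w \<in> V \<Longrightarrow> 0 \<le> C v w"
    and irred: "\<And>v w. v \<in> V \<Longrightarrow> w \<in> V \<Longrightarrow> (v, w) \<in> {(v, w). v \<in> V \<and> w \<in> V \<and> 0 < C v w}\<^sup>+"
begin

abbreviation "T \<equiv> mat_apply V C"

lemma T_ge_entry:
  assumes "\<And>w. w \<in> V \<Longrightarrow> 0 \<le> y w" "v \<in> V" "w \<in> V"
  shows "C v w * y w \<le> T y v"
  unfolding mat_apply_def using assms nonneg fin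
  by (intro member_le_sum[of w V "\<lambda>w. C v w * y w"]) auto

lemma T_nonneg: "(\<And>w. w \<in> V \<Longrightarrow> 0 \<le> y w) \<Longrightarrow> v \<in> V \<Longrightarrow> 0 \<le> T y v"
  unfolding mat_apply_def using nonneg by (intro sum_nonneg) auto

lemma closed_under_predecessors:
  assumes "S \<subseteq> V" "S \<noteq> {}" and closed: "\<And>v w. v \<in> V \<Longrightarrow> w \<in> S \<Longrightarrow> 0 < C v w \<Longrightarrow> v \<in> S"
  shows "S = V"
proof -
  have "v \<in> S" if "v \<in> V" for v
  proof -
    obtain w where w: "w \<in> S"
      using assms by auto
    then have "(v, w) \<in> {(v, w). v \<in> V \<and> w \<in> V \<and> 0 < C v w}\<^sup>+"
      using irred assms(1) that by auto
    then show ?thesis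
      using w by (induction rule: converse_trancl_induct) (use closed in auto)
  qed
  then show ?thesis
    using assms by auto
qed

lemma nonneg_eigenvector_pos:
  assumes y: "\<And>v. v \<in> V \<Longrightarrow> 0 \<le> y v" and eig: "\<And>v. v \<in> V \<Longrightarrow> T y v = c * y v"
    and w: "w \<in> V" "0 < y w" and "v \<in> V"
  shows "0 < y v"
proof -
  have "{v \<in> V. 0 < y v} = V"
  proof (rule closed_under_predecessors)
    fix u w assume u: "u \<in> V" and w: "w \<in> {v \<in> V. 0 < y v}" and pos: "0 < C u w"
    then have "0 < C u w * y w"
      by simp
    also have "\<dots> \<le> c * y u"
      using T_ge_entry[of y u w] y eig u w by simp
    finally show "u \<in> {v \<in> V. 0 < y v}"
      using y[OF u] u by (cases "y u = 0") auto
  qed (use w in auto)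
  then show ?thesis
    using assms by auto
qed

lemma nonneg_eigenvector_unique:
  assumes x: "\<And>v. v \<in> V \<Longrightarrow> 0 < x v" "\<And>v. v \<in> V \<Longrightarrow> T x v = R * x v"
    and y: "\<And>v. v \<in> V \<Longrightarrow> 0 \<le> y v" "\<And>v. v \<in> V \<Longrightarrow> T y v = R * y v"
  shows "\<exists>c. \<forall>v\<in>V. y v = c * x v"
proof -
  define c where "c = Min ((\<lambda>v. y v / x v) ` V)"
  define z where "z v = y v - c * x v" for v
  have "c \<le> y v / x v" if "v \<in> V" for v
    unfolding c_def using that fin by auto
  then have z: "0 \<le> z v" if "v \<in> V" for v
    using that x(1) by (auto simp: z_def field_simps)
  have "c \<in> (\<lambda>v. y v / x v) ` V"
    unfolding c_def using fin ne by (intro Min_in) auto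
  then obtain u where u: "u \<in> V" "z u = 0"
    using x(1) by (fastforce simp: z_def)
  have Tz: "T z v = T y v - c * T x v" for v
    by (simp add: mat_apply_def z_def sum_subtractf sum_distrib_left algebra_simps)
  have "T z v = R * z v" if "v \<in> V" for v
    unfolding Tz using that x(2) y(2) by (simp add: z_def algebra_simps)
  then have "z v = 0" if "v \<in> V" for v
    using nonneg_eigenvector_pos[of z R v u] z u that by (metis less_irrefl order_le_less)
  then show ?thesis
    by (auto simp: z_def intro!: exI[of _ c])
qed

text \<open>
  Collatz--Wielandt: among the vectors attaining the largest \<open>R\<close> with \<open>R x \<le> T x\<close>, one with as
  many strict inequalities as possible is an eigenvector; otherwise \<open>x + T x\<close> has more of them,
  by irreducibility, and if all are strict \<open>R\<close> is not maximal.
\<close>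

lemma pos_eigenvector_exists: "\<exists>R x. \<forall>v\<in>V. 0 < x v \<and> T x v = R * x v"
proof -
  define Q where "Q r x \<longleftrightarrow> (\<forall>v\<in>V. 0 \<le> x v) \<and> sum x V = 1 \<and> (\<forall>v\<in>V. r * x v \<le> T x v)" for r x
  define K where "K = (\<Sum>v\<in>V. \<Sum>w\<in>V. C v w)"
  have le1: "x v \<le> 1" if "Q r x" "v \<in> V" for r x v
    using that fin member_le_sum[of v V x] by (auto simp: Q_def)
  have leK: "r \<le> K" if "Q r x" for r x
  proof -
    have "r = (\<Sum>v\<in>V. r * x v)"
      using that by (simp add: Q_def flip: sum_distrib_left)
    also have "\<dots> \<le> (\<Sum>v\<in>V. T x v)"
      using that by (intro sum_mono) (auto simp: Q_def)
    also have "\<dots> \<le> K"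
      unfolding K_def mat_apply_def
      using le1[OF that] nonneg that by (intro sum_mono mult_left_le) (auto simp: Q_def)
    finally show ?thesis .
  qed
  have bdd: "bdd_above {r. \<exists>x. Q r x}"
    by (rule bdd_aboveI[of _ K]) (use leK in auto)
  obtain u where u: "u \<in> V"
    using ne by auto
  have "Q 0 (\<lambda>v. if v = u then 1 else 0)"
    unfolding Q_def using u fin by (auto intro!: T_nonneg)
  then have nonempty: "{r. \<exists>x. Q r x} \<noteq> {}"
    by auto
  define R where "R = Sup {r. \<exists>x. Q r x}"
  have upper: "r \<le> R" if "Q r x" for r x
    unfolding R_def using that bdd by (intro cSup_upper) auto
  have "\<exists>x. Q R x"
  proof -
    have "\<exists>r x. Q r x \<and> R - 1 / Suc n < r" for n
      using less_cSup_iff[OF nonempty bdd, of "R - 1 / Suc n"] unfolding R_def by auto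
    then obtain r x where rx: "\<And>n. Q (r n) (x n)" "\<And>n. R - 1 / Suc n < r n"
      by metis
    have "x n v \<in> {0..1}" if "v \<in> V" for n v
      using le1[OF rx(1)] rx(1) that by (auto simp: Q_def)
    then obtain \<phi> l where \<phi>: "strict_mono (\<phi> :: nat \<Rightarrow> nat)"
      and l: "\<And>v. v \<in> V \<Longrightarrow> (\<lambda>n. x (\<phi> n) v) \<longlonglongrightarrow> l v"
      using bounded_family_convergent_subseq[OF fin, of x 0 1] by metis
    have "(\<lambda>n. R - 1 / Suc n) \<longlonglongrightarrow> R - 0"
      by (intro tendsto_intros LIMSEQ_Suc[OF lim_1_over_n])
    moreover have "r n \<le> R" "R - 1 / Suc n \<le> r n" for n
      using upper[OF rx(1)] rx(2)[of n] by auto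
    ultimately have "r \<longlonglongrightarrow> R"
      by (intro tendsto_sandwich[of "\<lambda>n. R - 1 / Suc n" r _ "\<lambda>_. R"]) auto
    then have r: "(\<lambda>n. r (\<phi> n)) \<longlonglongrightarrow> R"
      using \<phi> LIMSEQ_subseq_LIMSEQ by (fastforce simp: o_def)
    have "0 \<le> l v" if "v \<in> V" for v
      using l[OF that] rx(1) that by (intro LIMSEQ_le_const) (auto simp: Q_def)
    moreover have "sum l V = 1"
      using tendsto_sum[of V "\<lambda>v n. x (\<phi> n) v" l sequentially] l rx(1)
      by (auto simp: Q_def LIMSEQ_const_iff)
    moreover have "R * l v \<le> T l v" if v: "v \<in> V" for v
    proof (rule LIMSEQ_le)
      show "(\<lambda>n. r (\<phi> n) * x (\<phi> n) v) \<longlonglongrightarrow> R * l v"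
        using r l v by (intro tendsto_intros) auto
      show "(\<lambda>n. T (x (\<phi> n)) v) \<longlonglongrightarrow> T l v"
        unfolding mat_apply_def using l by (intro tendsto_intros) auto
      show "\<exists>N. \<forall>n\<ge>N. r (\<phi> n) * x (\<phi> n) v \<le> T (x (\<phi> n)) v"
        using rx(1) v by (auto simp: Q_def)
    qed
    ultimately show ?thesis
      by (auto simp: Q_def)
  qed
  define S where "S x = {v \<in> V. R * x v < T x v}" for x
  have "card (S x) \<le> card V" for x
    unfolding S_def using fin by (intro card_mono) auto
  then obtain x where x: "Q R x" and max: "\<And>x'. Q R x' \<Longrightarrow> card (S x') \<le> card (S x)"
    using \<open>\<exists>x. Q R x\<close> ex_has_greatest_nat[of "Q R" _ "\<lambda>x. card (S x)" "Suc (card V)"]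
    by (metis less_Suc_eq_le)
  have Tx: "R * x v \<le> T x v" "0 \<le> x v" "0 \<le> T x v" if "v \<in> V" for v
    using x that by (auto simp: Q_def intro!: T_nonneg)
  have "S x = {}"
  proof (rule ccontr)
    assume "S x \<noteq> {}"
    define c where "c = 1 + sum (T x) V"
    have c: "0 < c"
      unfolding c_def using Tx by (intro add_pos_nonneg sum_nonneg) auto
    define x' where "x' v = (x v + T x v) / c" for v
    have Tx': "T x' v - R * x' v = ((T x v - R * x v) + (\<Sum>w\<in>V. C v w * (T x w - R * x w))) / c" for v
    proof -
      have "T x' v = (T x v + T (T x) v) / c"
        by (simp add: mat_apply_def[of V C x'] mat_apply_def[of V C "T x"] mat_apply_def[of V C x v]
            x'_def sum.distrib sum_divide_distrib algebra_simps add_divide_distrib)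
      moreover have "(\<Sum>w\<in>V. C v w * (T x w - R * x w)) = T (T x) v - R * T x v"
        by (simp add: mat_apply_def[of V C "T x"] mat_apply_def[of V C x v] sum_subtractf
            sum_distrib_left algebra_simps)
      ultimately show ?thesis
        using c by (simp add: x'_def field_simps)
    qed
    have gap: "0 \<le> (\<Sum>w\<in>V. C v w * (T x w - R * x w))" if "v \<in> V" for v
      using Tx nonneg that by (intro sum_nonneg mult_nonneg_nonneg) auto
    have "Q R x'"
      unfolding Q_def
    proof (intro conjI ballI)
      show "sum x' V = 1"
        using x c by (simp add: x'_def Q_def c_def sum.distrib flip: sum_divide_distrib)
      fix v assume v: "v \<in> V"
      show "0 \<le> x' v"
        using Tx v c by (simp add: x'_def)
      have "0 \<le> T x' v - R * x' v"
        unfolding Tx' using Tx[OF v] gap[OF v] c by simp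
      then show "R * x' v \<le> T x' v"
        by simp
    qed
    then have "card (S x') \<le> card (S x)"
      by (rule max)
    moreover have sub: "S x \<subseteq> S x'"
    proof
      fix v assume v: "v \<in> S x"
      then have "0 < T x' v - R * x' v"
        unfolding Tx' using gap[of v] c by (intro divide_pos_pos add_pos_nonneg) (auto simp: S_def)
      then show "v \<in> S x'"
        using v by (simp add: S_def)
    qed
    ultimately have eq: "S x' = S x"
      using fin by (intro card_seteq[symmetric]) (auto simp: S_def)
    have "S x = V"
    proof (rule closed_under_predecessors)
      fix v w assume v: "v \<in> V" and w: "w \<in> S x" and pos: "0 < C v w"
      have "0 < C v w * (T x w - R * x w)"
        using w pos by (simp add: S_def)
      also have "\<dots> \<le> (\<Sum>w\<in>V. C v w * (T x w - R * x w))"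
        using Tx nonneg v w fin
        by (intro member_le_sum[of w V "\<lambda>w. C v w * (T x w - R * x w)"]) (auto simp: S_def)
      finally have "0 < T x' v - R * x' v"
        unfolding Tx' using Tx[OF v] c by (intro divide_pos_pos add_nonneg_pos) auto
      then show "v \<in> S x"
        using v unfolding eq[symmetric] by (simp add: S_def)
    qed (use \<open>S x \<noteq> {}\<close> in \<open>auto simp: S_def\<close>)
    define \<epsilon> where "\<epsilon> = Min ((\<lambda>v. T x v - R * x v) ` V)"
    have "\<epsilon> \<in> (\<lambda>v. T x v - R * x v) ` V"
      unfolding \<epsilon>_def using fin ne by (intro Min_in) auto
    then have "0 < \<epsilon>"
      using \<open>S x = V\<close> by (auto simp: S_def)
    have "(R + \<epsilon>) * x v \<le> T x v" if v: "v \<in> V" for v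
    proof -
      have "(R + \<epsilon>) * x v \<le> R * x v + \<epsilon>"
        using le1[OF x v] \<open>0 < \<epsilon>\<close> by (simp add: distrib_right)
      also have "\<epsilon> \<le> T x v - R * x v"
        unfolding \<epsilon>_def using fin v by auto
      finally show ?thesis
        by simp
    qed
    then have "Q (R + \<epsilon>) x"
      using x by (simp add: Q_def)
    then show False
      using upper \<open>0 < \<epsilon>\<close> by fastforce
  qed
  then have eig: "T x v = R * x v" if "v \<in> V" for v
    using that Tx(1)[OF that] by (auto simp: S_def)
  have "\<exists>w\<in>V. 0 < x w"
  proof (rule ccontr)
    assume "\<not> ?thesis"
    then have "sum x V \<le> 0"
      by (intro sum_nonpos) auto
    then show False
      using x by (simp add: Q_def)
  qed
  then have "0 < x v" if "v \<in> V" for v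
    using nonneg_eigenvector_pos[of x R _ v] Tx eig that by blast
  then show ?thesis
    using eig by blast
qed

end

lemma spectral_radius_pos_eigenvector:
  fixes N :: "nat mat" and x :: "nat \<Rightarrow> real"
  assumes N: "N \<in> carrier_mat n n" and n: "0 < n" and x: "\<And>i. i < n \<Longrightarrow> 0 < x i"
    and eig: "\<And>i. i < n \<Longrightarrow> (\<Sum>j<n. real (N $$ (i, j)) * x j) = c * x i"
  shows "spectral_radius (map_mat of_nat N) = c"
proof -
  define M :: "complex mat" where "M = map_mat of_nat N"
  have M: "M \<in> carrier_mat n n"
    using N by (simp add: M_def)
  have Mv: "(M *\<^sub>v z) $ i = (\<Sum>j<n. of_nat (N $$ (i, j)) * z $ j)" if "z \<in> carrier_vec n" "i < n" for z i
    using that N by (auto simp: M_def scalar_prod_def lessThan_atLeast0 intro!: sum.cong)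
  have "0 \<le> c * x 0"
    unfolding eig[OF n, symmetric] using x by (intro sum_nonneg mult_nonneg_nonneg) (auto intro: less_imp_le)
  then have c: "0 \<le> c"
    using x[OF n] by (simp add: zero_le_mult_iff)
  have "eigenvalue M (of_real c)"
  proof -
    let ?z = "Matrix.vec n (\<lambda>i. of_real (x i)) :: complex Matrix.vec"
    have "M *\<^sub>v ?z = of_real c \<cdot>\<^sub>v ?z"
    proof (rule eq_vecI)
      fix i assume "i < dim_vec (complex_of_real c \<cdot>\<^sub>v ?z)"
      then have i: "i < n"
        by simp
      have "(M *\<^sub>v ?z) $ i = of_real (\<Sum>j<n. real (N $$ (i, j)) * x j)"
        using i by (subst Mv) (auto intro!: sum.cong)
      then show "(M *\<^sub>v ?z) $ i = (complex_of_real c \<cdot>\<^sub>v ?z) $ i"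
        using i eig by simp
    qed (use M in simp)
    moreover have "?z \<noteq> 0\<^sub>v n"
    proof
      assume "?z = 0\<^sub>v n"
      then have "?z $ 0 = 0"
        using n by simp
      then show False
        using n x[OF n] by simp
    qed
    ultimately show ?thesis
      using M by (auto simp: eigenvalue_def eigenvector_def intro!: exI[of _ ?z])
  qed
  moreover have "cmod l \<le> c" if l: "eigenvalue M l" for l
  proof -
    obtain z where z: "z \<in> carrier_vec n" "z \<noteq> 0\<^sub>v n" "M *\<^sub>v z = l \<cdot>\<^sub>v z"
      using l M unfolding eigenvalue_def eigenvector_def by auto
    define m where "m = Max ((\<lambda>i. cmod (z $ i) / x i) ` {..<n})"
    have le: "cmod (z $ i) \<le> m * x i" if "i < n" for i
    proof -
      have "cmod (z $ i) / x i \<le> m"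
        unfolding m_def using that by auto
      then show ?thesis
        using x[OF that] by (simp add: field_simps)
    qed
    have "m \<in> (\<lambda>i. cmod (z $ i) / x i) ` {..<n}"
      unfolding m_def using n by (intro Min_in Max_in) auto
    then obtain i where i: "i < n" "m = cmod (z $ i) / x i"
      by auto
    then have zi: "cmod (z $ i) = m * x i"
      using x[of i] by simp
    obtain j where "j < n" "z $ j \<noteq> 0"
      using z by (metis carrier_vecD eq_vecI index_zero_vec(1) index_zero_vec(2))
    then have "0 < m * x j"
      using le[of j] zero_less_norm_iff[of "z $ j"] by linarith
    then have m: "0 < m"
      using x[OF \<open>j < n\<close>] by (simp add: zero_less_mult_iff)
    have "cmod l * (m * x i) = cmod ((M *\<^sub>v z) $ i)"
      using i(1) z zi by (simp add: norm_mult)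
    also have "\<dots> \<le> (\<Sum>j<n. real (N $$ (i, j)) * cmod (z $ j))"
      using i(1) z by (subst Mv) (auto intro!: sum_norm_le simp: norm_mult)
    also have "\<dots> \<le> (\<Sum>j<n. real (N $$ (i, j)) * (m * x j))"
      using le by (intro sum_mono mult_left_mono) auto
    also have "\<dots> = m * (\<Sum>j<n. real (N $$ (i, j)) * x j)"
      by (simp add: sum_distrib_left algebra_simps)
    also have "\<dots> = c * (m * x i)"
      using i(1) eig by simp
    finally show ?thesis
      using m x[OF i(1)] by (simp add: mult_le_cancel_right)
  qed
  ultimately show ?thesis
    unfolding M_def[symmetric] spectral_radius_def spectrum_def
    using card_finite_spectrum(1)[OF M] c
    by (intro Max_eqI) (auto simp: spectrum_def intro!: image_eqI[of _ _ "of_real c"])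
qed

section \<open>Factorization in higher-rank graphs\<close>

context k_graph
begin

lemma cmp_cancel:
  assumes "f \<in> mor \<Lambda>" "g \<in> mor \<Lambda>" "src \<Lambda> f = rng \<Lambda> g"
    and "f' \<in> mor \<Lambda>" "g' \<in> mor \<Lambda>" "src \<Lambda> f' = rng \<Lambda> g'"
    and "deg \<Lambda> f = deg \<Lambda> f'" and eq: "cmp \<Lambda> f g = cmp \<Lambda> f' g'"
  shows "f = f'" "g = g'"
proof -
  have "(\<lambda>i. deg \<Lambda> f i + deg \<Lambda> g i) = (\<lambda>i. deg \<Lambda> f' i + deg \<Lambda> g' i)"
    using deg_cmp[OF assms(1-3)] deg_cmp[OF assms(4-6)] eq by simp
  then have "deg \<Lambda> g i = deg \<Lambda> g' i" for i
    using assms(7) by (auto dest: fun_cong[of _ _ i])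
  then have "deg \<Lambda> g = deg \<Lambda> g'"
    by auto
  have ex1: "\<exists>!p. fst p \<in> mor \<Lambda> \<and> snd p \<in> mor \<Lambda> \<and> src \<Lambda> (fst p) = rng \<Lambda> (snd p)
      \<and> deg \<Lambda> (fst p) = deg \<Lambda> f \<and> deg \<Lambda> (snd p) = deg \<Lambda> g \<and> cmp \<Lambda> (fst p) (snd p) = cmp \<Lambda> f g"
    using assms by (intro factorization cmp_in deg_in deg_cmp) auto
  have "(f, g) = (f', g')"
    using ex1 by (elim ex1E) (use assms \<open>deg \<Lambda> g = deg \<Lambda> g'\<close> in \<open>auto 4 4\<close>)
  then show "f = f'" "g = g'"
    by auto
qed

definition initial_part :: "'m \<Rightarrow> (nat \<Rightarrow> nat) \<Rightarrow> 'm" where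
  "initial_part f m = (THE g. g \<in> mor \<Lambda> \<and> deg \<Lambda> g = m
     \<and> (\<exists>h\<in>mor \<Lambda>. src \<Lambda> g = rng \<Lambda> h \<and> cmp \<Lambda> g h = f))"

definition final_part :: "'m \<Rightarrow> (nat \<Rightarrow> nat) \<Rightarrow> 'm" where
  "final_part f m = (THE h. h \<in> mor \<Lambda>
     \<and> (\<exists>g\<in>mor \<Lambda>. deg \<Lambda> g = m \<and> src \<Lambda> g = rng \<Lambda> h \<and> cmp \<Lambda> g h = f))"

lemma parts_cmp:
  assumes "g \<in> mor \<Lambda>" "h \<in> mor \<Lambda>" "src \<Lambda> g = rng \<Lambda> h"
  shows "initial_part (cmp \<Lambda> g h) (deg \<Lambda> g) = g" "final_part (cmp \<Lambda> g h) (deg \<Lambda> g) = h"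
  unfolding initial_part_def final_part_def
  using assms cmp_cancel[of _ _ g h] by (blast intro!: the_equality)+

lemma parts:
  assumes f: "f \<in> mor \<Lambda>" and m: "m \<in> degs k" "m \<le> deg \<Lambda> f"
  shows "initial_part f m \<in> mor \<Lambda>" "final_part f m \<in> mor \<Lambda>"
    "src \<Lambda> (initial_part f m) = rng \<Lambda> (final_part f m)"
    "deg \<Lambda> (initial_part f m) = m" "deg \<Lambda> (final_part f m) = (\<lambda>i. deg \<Lambda> f i - m i)"
    "cmp \<Lambda> (initial_part f m) (final_part f m) = f"
proof -
  have "(\<lambda>i. deg \<Lambda> f i - m i) \<in> degs k" "deg \<Lambda> f = (\<lambda>i. m i + (deg \<Lambda> f i - m i))"
    using deg_in[OF f] m by (auto simp: degs_def le_fun_def)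
  then obtain g h where gh: "g \<in> mor \<Lambda>" "h \<in> mor \<Lambda>" "src \<Lambda> g = rng \<Lambda> h" "deg \<Lambda> g = m"
    "deg \<Lambda> h = (\<lambda>i. deg \<Lambda> f i - m i)" "cmp \<Lambda> g h = f"
    using ex1_implies_ex[OF factorization[OF f m(1)]] by fastforce
  then have eq: "initial_part f m = g" "final_part f m = h"
    using parts_cmp[of g h] by auto
  show "initial_part f m \<in> mor \<Lambda>" "final_part f m \<in> mor \<Lambda>"
    "src \<Lambda> (initial_part f m) = rng \<Lambda> (final_part f m)"
    "deg \<Lambda> (initial_part f m) = m" "deg \<Lambda> (final_part f m) = (\<lambda>i. deg \<Lambda> f i - m i)"
    "cmp \<Lambda> (initial_part f m) (final_part f m) = f"
    using gh unfolding eq by auto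
qed

lemma rng_in_verts: "f \<in> mor \<Lambda> \<Longrightarrow> rng \<Lambda> f \<in> verts \<Lambda>"
  and src_in_verts: "f \<in> mor \<Lambda> \<Longrightarrow> src \<Lambda> f \<in> verts \<Lambda>"
  using deg_identity[of "src \<Lambda> f"] by (auto simp: mor_of_deg_def rng_in src_in rng_src deg_identity)

lemma rng_vert: "v \<in> verts \<Lambda> \<Longrightarrow> rng \<Lambda> v = v"
  using cmp_cancel(1)[of "rng \<Lambda> v" v v "src \<Lambda> v"]
  by (auto simp: mor_of_deg_def rng_in src_in rng_src src_rng cmp_rng cmp_src deg_identity)

lemma src_vert: "v \<in> verts \<Lambda> \<Longrightarrow> src \<Lambda> v = v"
  using src_rng[of v] rng_vert[of v] by (simp add: mor_of_deg_def)

lemma unit_deg_in_degs: "i \<in> {1..k} \<Longrightarrow> unit_deg i \<in> degs k"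
  by (auto simp: degs_def unit_deg_def)

end

text \<open>
  The action of the adjacency matrix of colour \<open>i\<close> on functions on the vertices, in the form in
  which it arises from extending a path by one edge.
\<close>

definition edge_op :: "'m graded_category \<Rightarrow> nat \<Rightarrow> ('m \<Rightarrow> real) \<Rightarrow> 'm \<Rightarrow> real" where
  "edge_op \<Lambda> i y v = (\<Sum>f\<in>{f \<in> mor_of_deg \<Lambda> (unit_deg i). rng \<Lambda> f = v}. y (src \<Lambda> f))"

lemma edge_op_scale: "edge_op \<Lambda> i (\<lambda>v. c * y v) v = c * edge_op \<Lambda> i y v"
  by (simp add: edge_op_def sum_distrib_left)

locale finite_k_graph = k_graph +
  assumes k_pos: "1 \<le> k" and fin: "finite_graph k \<Lambda>"
begin

lemma finite_mor_of_deg: "n \<in> degs k \<Longrightarrow> finite (mor_of_deg \<Lambda> n)"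
  using fin by (auto simp: finite_graph_def)

lemma finite_verts: "finite (verts \<Lambda>)"
  by (intro finite_mor_of_deg) (auto simp: degs_def)

lemma edge_op_cong: "(\<And>w. w \<in> verts \<Lambda> \<Longrightarrow> y w = z w) \<Longrightarrow> edge_op \<Lambda> i y v = edge_op \<Lambda> i z v"
  unfolding edge_op_def by (intro sum.cong) (auto simp: mor_of_deg_def[of _ "unit_deg i"] src_in_verts)

lemma edge_op_mono:
  "(\<And>w. w \<in> verts \<Lambda> \<Longrightarrow> y w \<le> z w) \<Longrightarrow> edge_op \<Lambda> i y v \<le> edge_op \<Lambda> i z v"
  unfolding edge_op_def by (intro sum_mono) (auto simp: mor_of_deg_def[of _ "unit_deg i"] src_in_verts)

lemma edge_op_adj:
  assumes "i \<in> {1..k}"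
  shows "edge_op \<Lambda> i y v = (\<Sum>w\<in>verts \<Lambda>. real (adj \<Lambda> i v w) * y w)"
proof -
  define E where "E = {f \<in> mor_of_deg \<Lambda> (unit_deg i). rng \<Lambda> f = v}"
  have E: "finite E"
    using finite_mor_of_deg[OF unit_deg_in_degs[OF assms]] by (simp add: E_def)
  have "(\<Sum>f\<in>E. y (src \<Lambda> f)) = (\<Sum>w\<in>verts \<Lambda>. \<Sum>f\<in>{f \<in> E. src \<Lambda> f = w}. y (src \<Lambda> f))"
    using E finite_verts by (intro sum.group[symmetric]) (auto simp: E_def mor_of_deg_def[of _ "unit_deg i"] src_in_verts)
  also have "\<dots> = (\<Sum>w\<in>verts \<Lambda>. real (adj \<Lambda> i v w) * y w)"
    unfolding adj_def by (intro sum.cong refl) (simp add: E_def conj_assoc)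
  finally show ?thesis
    by (simp add: edge_op_def E_def)
qed

lemma bij_betw_cmp:
  assumes m: "m \<in> degs k" and n: "n \<in> degs k"
  shows "bij_betw (\<lambda>(f, g). cmp \<Lambda> f g)
    (SIGMA f:{f \<in> mor_of_deg \<Lambda> m. rng \<Lambda> f = v}. {g \<in> mor_of_deg \<Lambda> n. rng \<Lambda> g = src \<Lambda> f})
    {h \<in> mor_of_deg \<Lambda> (\<lambda>i. m i + n i). rng \<Lambda> h = v}"
    (is "bij_betw ?c ?A ?B")
proof (rule bij_betwI')
  fix p p' assume "p \<in> ?A" "p' \<in> ?A"
  moreover obtain f g f' g' where "p = (f, g)" "p' = (f', g')"
    by (cases p, cases p') auto
  ultimately show "(?c p = ?c p') = (p = p')"
    using cmp_cancel[of f g f' g'] by (simp add: mor_of_deg_def) blast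
next
  fix p assume "p \<in> ?A"
  then show "?c p \<in> ?B"
    by (auto simp: mor_of_deg_def cmp_in rng_cmp deg_cmp)
next
  fix h assume h: "h \<in> ?B"
  then have hm: "h \<in> mor \<Lambda>" "m \<le> deg \<Lambda> h"
    by (auto simp: mor_of_deg_def le_fun_def)
  note p = parts[OF hm(1) m hm(2)]
  have "rng \<Lambda> (initial_part h m) = v"
    using rng_cmp[OF p(1-3)] p(6) h by auto
  then have "(initial_part h m, final_part h m) \<in> ?A" "h = ?c (initial_part h m, final_part h m)"
    using p h by (auto simp: mor_of_deg_def)
  then show "\<exists>p\<in>?A. h = ?c p"
    by blast
qed

lemma sum_mor_of_deg_add:
  fixes F :: "_ \<Rightarrow> real"
  assumes "m \<in> degs k" "n \<in> degs k"
  shows "(\<Sum>h\<in>{h \<in> mor_of_deg \<Lambda> (\<lambda>i. m i + n i). rng \<Lambda> h = v}. F (src \<Lambda> h))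
    = (\<Sum>f\<in>{f \<in> mor_of_deg \<Lambda> m. rng \<Lambda> f = v}. \<Sum>g\<in>{g \<in> mor_of_deg \<Lambda> n. rng \<Lambda> g = src \<Lambda> f}. F (src \<Lambda> g))"
proof -
  have "(\<Sum>h\<in>{h \<in> mor_of_deg \<Lambda> (\<lambda>i. m i + n i). rng \<Lambda> h = v}. F (src \<Lambda> h))
    = (\<Sum>p\<in>(SIGMA f:{f \<in> mor_of_deg \<Lambda> m. rng \<Lambda> f = v}. {g \<in> mor_of_deg \<Lambda> n. rng \<Lambda> g = src \<Lambda> f}).
        F (src \<Lambda> (case p of (f, g) \<Rightarrow> cmp \<Lambda> f g)))"
    by (rule sum.reindex_bij_betw[OF bij_betw_cmp[OF assms], symmetric])
  also have "\<dots> = (\<Sum>(f, g)\<in>(SIGMA f:{f \<in> mor_of_deg \<Lambda> m. rng \<Lambda> f = v}. {g \<in> mor_of_deg \<Lambda> n. rng \<Lambda> g = src \<Lambda> f}). F (src \<Lambda> g))"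
    by (intro sum.cong refl) (auto simp: mor_of_deg_def src_cmp)
  also have "\<dots> = (\<Sum>f\<in>{f \<in> mor_of_deg \<Lambda> m. rng \<Lambda> f = v}. \<Sum>g\<in>{g \<in> mor_of_deg \<Lambda> n. rng \<Lambda> g = src \<Lambda> f}. F (src \<Lambda> g))"
    using assms finite_mor_of_deg by (intro sum.Sigma[symmetric]) auto
  finally show ?thesis .
qed

lemma edge_op_commute:
  assumes "i \<in> {1..k}" "j \<in> {1..k}"
  shows "edge_op \<Lambda> i (edge_op \<Lambda> j y) v = edge_op \<Lambda> j (edge_op \<Lambda> i y) v"
  using sum_mor_of_deg_add[of "unit_deg i" "unit_deg j" y v]
    sum_mor_of_deg_add[of "unit_deg j" "unit_deg i" y v] assms
  by (simp add: edge_op_def unit_deg_in_degs add.commute)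

end

section \<open>The Perron--Frobenius vector\<close>

context finite_k_graph
begin

abbreviation edge_ops :: "nat list \<Rightarrow> ('a \<Rightarrow> real) \<Rightarrow> 'a \<Rightarrow> real" where
  "edge_ops is \<equiv> foldr (edge_op \<Lambda>) is"

lemma edge_ops_cong:
  assumes "\<And>w. w \<in> verts \<Lambda> \<Longrightarrow> y w = z w" "v \<in> verts \<Lambda>"
  shows "edge_ops is y v = edge_ops is z v"
  using assms(2)
proof (induction "is" arbitrary: v)
  case (Cons i "is")
  then show ?case
    by (simp, intro edge_op_cong) auto
qed (use assms in auto)

lemma edge_ops_scale: "edge_ops is (\<lambda>v. c * y v) = (\<lambda>v. c * edge_ops is y v)"
  by (induction "is") (auto simp: edge_op_scale)

lemma edge_op_edge_ops_commute:
  assumes "set is \<subseteq> {1..k}" "i \<in> {1..k}"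
  shows "edge_op \<Lambda> i (edge_ops is y) v = edge_ops is (edge_op \<Lambda> i y) v"
  using assms(1)
proof (induction "is" arbitrary: v)
  case (Cons j "is")
  then have "edge_op \<Lambda> i (edge_ops (j # is) y) v = edge_op \<Lambda> j (edge_op \<Lambda> i (edge_ops is y)) v"
    using assms(2) by (simp add: edge_op_commute)
  also have "\<dots> = edge_op \<Lambda> j (edge_ops is (edge_op \<Lambda> i y)) v"
    using Cons by (intro edge_op_cong) auto
  finally show ?case
    by simp
qed auto

lemma edge_ops_eigenvector:
  assumes "\<And>i v. i \<in> set is \<Longrightarrow> v \<in> verts \<Lambda> \<Longrightarrow> edge_op \<Lambda> i x v = c i * x v" "v \<in> verts \<Lambda>"
  shows "edge_ops is x v = (\<Prod>i\<leftarrow>is. c i) * x v"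
  using assms
proof (induction "is" arbitrary: v)
  case (Cons j "is")
  have "edge_ops (j # is) x v = edge_op \<Lambda> j (\<lambda>v. (\<Prod>i\<leftarrow>is. c i) * x v) v"
    using Cons by (simp, intro edge_op_cong) auto
  also have "\<dots> = (\<Prod>i\<leftarrow>is. c i) * (c j * x v)"
    using Cons.prems by (simp add: edge_op_scale)
  finally show ?case
    by simp
qed auto

abbreviation "vertex \<equiv> from_nat_into (verts \<Lambda>)"
abbreviation "index \<equiv> to_nat_on (verts \<Lambda>)"

lemma bij_betw_vertex: "bij_betw vertex {..<card (verts \<Lambda>)} (verts \<Lambda>)"
  using finite_verts by (rule bij_betw_from_nat_into_finite)

lemma vertex_index: "v \<in> verts \<Lambda> \<Longrightarrow> vertex (index v) = v"
  using countable_finite[OF finite_verts] by (rule from_nat_into_to_nat_on)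

lemma index_less: "v \<in> verts \<Lambda> \<Longrightarrow> index v < card (verts \<Lambda>)"
  using bij_betwE[OF to_nat_on_finite[OF finite_verts]] by auto

lemma index_vertex: "a < card (verts \<Lambda>) \<Longrightarrow> index (vertex a) = a"
  using inj_onD[OF bij_betw_imp_inj_on[OF bij_betw_vertex], of "index (vertex a)" a]
    bij_betwE[OF bij_betw_vertex] by (simp add: vertex_index index_less)

lemma sum_vertex: "(\<Sum>b<card (verts \<Lambda>). F (vertex b)) = (\<Sum>w\<in>verts \<Lambda>. F w)"
  by (rule sum.reindex_bij_betw[OF bij_betw_vertex])

lemma adj_mat_apply:
  assumes "i \<in> {1..k}" "a < card (verts \<Lambda>)"
  shows "(\<Sum>b<card (verts \<Lambda>). real (adj_mat \<Lambda> i $$ (a, b)) * y (vertex b)) = edge_op \<Lambda> i y (vertex a)"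
proof -
  have "(\<Sum>b<card (verts \<Lambda>). real (adj_mat \<Lambda> i $$ (a, b)) * y (vertex b))
      = (\<Sum>b<card (verts \<Lambda>). real (adj \<Lambda> i (vertex a) (vertex b)) * y (vertex b))"
    using assms by (intro sum.cong) (auto simp: adj_mat_def)
  also have "\<dots> = edge_op \<Lambda> i y (vertex a)"
    using assms by (subst sum_vertex) (simp add: edge_op_adj)
  finally show ?thesis .
qed

lemma adj_mat_product_apply:
  fixes "is" :: "nat list"
  defines "B \<equiv> foldr (\<lambda>i B. adj_mat \<Lambda> i * B) is (1\<^sub>m (card (verts \<Lambda>)))"
  assumes "set is \<subseteq> {1..k}"
  shows "B \<in> carrier_mat (card (verts \<Lambda>)) (card (verts \<Lambda>))"
    and "a < card (verts \<Lambda>) \<Longrightarrow>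
      (\<Sum>b<card (verts \<Lambda>). real (B $$ (a, b)) * y (vertex b)) = edge_ops is y (vertex a)"
  using assms(2) unfolding B_def
proof (induction "is" arbitrary: a)
  case Nil
  {
    case 1
    then show ?case
      by simp
  next
    case 2
    then show ?case
      by (simp add: if_distrib[of real] if_distrib[of "\<lambda>x. x * _"] cong: if_cong)
  }
next
  case (Cons i "is")
  define B where "B = foldr (\<lambda>i B. adj_mat \<Lambda> i * B) is (1\<^sub>m (card (verts \<Lambda>)))"
  let ?n = "card (verts \<Lambda>)"
  have A: "adj_mat \<Lambda> i \<in> carrier_mat ?n ?n"
    by (simp add: adj_mat_def)
  {
    case 1
    then show ?case
      using Cons.IH(1) A by auto
  next
    case 2
    have B: "B \<in> carrier_mat ?n ?n"
      and IH: "\<And>c. c < ?n \<Longrightarrow> (\<Sum>b<?n. real (B $$ (c, b)) * y (vertex b)) = edge_ops is y (vertex c)"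
      using Cons.IH 2 by (auto simp: B_def)
    have "(\<Sum>b<?n. real ((adj_mat \<Lambda> i * B) $$ (a, b)) * y (vertex b))
        = (\<Sum>b<?n. \<Sum>c<?n. real (adj_mat \<Lambda> i $$ (a, c)) * real (B $$ (c, b)) * y (vertex b))"
      using A B 2 by (intro sum.cong refl)
        (auto simp: scalar_prod_def sum_distrib_right lessThan_atLeast0 intro!: sum.cong)
    also have "\<dots> = (\<Sum>c<?n. \<Sum>b<?n. real (adj_mat \<Lambda> i $$ (a, c)) * real (B $$ (c, b)) * y (vertex b))"
      by (rule sum.swap)
    also have "\<dots> = (\<Sum>c<?n. real (adj_mat \<Lambda> i $$ (a, c)) * edge_ops is y (vertex c))"
      by (intro sum.cong refl) (simp add: IH[symmetric] sum_distrib_left mult.assoc)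
    also have "\<dots> = edge_op \<Lambda> i (edge_ops is y) (vertex a)"
      using 2 by (intro adj_mat_apply) auto
    finally show ?case
      by (simp add: B_def)
  }
qed

end

locale irreducible_k_graph = finite_k_graph +
  assumes verts_ne: "verts \<Lambda> \<noteq> {}"
    and irr: "irreducible_mat (adj_mat_prod k \<Lambda>)"
begin

definition adj_prod :: "'a \<Rightarrow> 'a \<Rightarrow> real" where
  "adj_prod v w = real (adj_mat_prod k \<Lambda> $$ (index v, index w))"

lemma adj_prod_apply:
  assumes "v \<in> verts \<Lambda>"
  shows "mat_apply (verts \<Lambda>) adj_prod y v = edge_ops [1..<Suc k] y v"
proof -
  let ?n = "card (verts \<Lambda>)"
  have "mat_apply (verts \<Lambda>) adj_prod y v
      = (\<Sum>b<?n. real (adj_mat_prod k \<Lambda> $$ (index v, index (vertex b))) * y (vertex b))"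
    unfolding mat_apply_def adj_prod_def by (rule sum_vertex[symmetric])
  also have "\<dots> = (\<Sum>b<?n. real (adj_mat_prod k \<Lambda> $$ (index v, b)) * y (vertex b))"
    by (intro sum.cong) (auto simp: index_vertex)
  also have "\<dots> = edge_ops [1..<Suc k] y (vertex (index v))"
    unfolding adj_mat_prod_def using assms
    by (intro adj_mat_product_apply(2)) (auto simp: index_less)
  finally show ?thesis
    using assms by (simp add: vertex_index)
qed

lemma adj_mat_prod_carrier: "adj_mat_prod k \<Lambda> \<in> carrier_mat (card (verts \<Lambda>)) (card (verts \<Lambda>))"
  unfolding adj_mat_prod_def by (intro adj_mat_product_apply(1)) auto

lemma power_Suc_entry_pos:
  assumes "a < card (verts \<Lambda>)" "b < card (verts \<Lambda>)" "0 < (adj_mat_prod k \<Lambda> ^\<^sub>m Suc p) $$ (a, b)"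
  obtains c where "c < card (verts \<Lambda>)" "0 < (adj_mat_prod k \<Lambda> ^\<^sub>m p) $$ (a, c)"
    "0 < adj_mat_prod k \<Lambda> $$ (c, b)"
proof -
  let ?n = "card (verts \<Lambda>)"
  note B = adj_mat_prod_carrier
  have "(adj_mat_prod k \<Lambda> ^\<^sub>m p) \<in> carrier_mat ?n ?n"
    using B by (rule pow_carrier_mat)
  then have "(adj_mat_prod k \<Lambda> ^\<^sub>m Suc p) $$ (a, b)
      = (\<Sum>c<?n. (adj_mat_prod k \<Lambda> ^\<^sub>m p) $$ (a, c) * adj_mat_prod k \<Lambda> $$ (c, b))"
    using B assms(1,2) by (simp add: scalar_prod_def lessThan_atLeast0)
  then have "(\<Sum>c<?n. (adj_mat_prod k \<Lambda> ^\<^sub>m p) $$ (a, c) * adj_mat_prod k \<Lambda> $$ (c, b)) \<noteq> 0"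
    using assms(3) by (metis less_irrefl)
  then obtain c where "c \<in> {..<?n}" "(adj_mat_prod k \<Lambda> ^\<^sub>m p) $$ (a, c) * adj_mat_prod k \<Lambda> $$ (c, b) \<noteq> 0"
    by (rule sum.not_neutral_contains_not_neutral)
  then show ?thesis
    using that[of c] by simp
qed

lemma power_entry_imp_path:
  assumes "a < card (verts \<Lambda>)" "b < card (verts \<Lambda>)" "0 < (adj_mat_prod k \<Lambda> ^\<^sub>m p) $$ (a, b)"
  shows "(vertex a, vertex b) \<in> {(v, w). v \<in> verts \<Lambda> \<and> w \<in> verts \<Lambda> \<and> 0 < adj_prod v w}\<^sup>*"
  using assms(2,3)
proof (induction p arbitrary: b)
  case 0
  then show ?case
    using assms(1) adj_mat_prod_carrier by (auto split: if_splits)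
next
  case (Suc p)
  obtain c where c: "c < card (verts \<Lambda>)" "0 < (adj_mat_prod k \<Lambda> ^\<^sub>m p) $$ (a, c)"
    "0 < adj_mat_prod k \<Lambda> $$ (c, b)"
    using power_Suc_entry_pos[OF assms(1) Suc.prems] by blast
  then have "0 < adj_prod (vertex c) (vertex b)"
    using Suc.prems by (simp add: adj_prod_def index_vertex)
  then show ?case
    using Suc.IH[OF c(1,2)] c(1) Suc.prems bij_betwE[OF bij_betw_vertex]
    by (auto intro: rtrancl_into_rtrancl)
qed

sublocale PF: nonneg_irreducible "verts \<Lambda>" adj_prod
proof
  fix v w assume v: "v \<in> verts \<Lambda>" and w: "w \<in> verts \<Lambda>"
  obtain p where "0 < p" and p: "0 < (adj_mat_prod k \<Lambda> ^\<^sub>m p) $$ (index v, index w)"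
    using irr adj_mat_prod_carrier index_less[OF v] index_less[OF w]
    by (auto simp: irreducible_mat_def)
  then obtain p' where p': "p = Suc p'"
    by (cases p) auto
  obtain c where c: "c < card (verts \<Lambda>)" "0 < (adj_mat_prod k \<Lambda> ^\<^sub>m p') $$ (index v, c)"
    "0 < adj_mat_prod k \<Lambda> $$ (c, index w)"
    using power_Suc_entry_pos[OF index_less[OF v] index_less[OF w]] p unfolding p' by blast
  then have "0 < adj_prod (vertex c) w"
    by (simp add: adj_prod_def index_vertex)
  moreover have "vertex c \<in> verts \<Lambda>"
    using c(1) bij_betwE[OF bij_betw_vertex] by auto
  moreover have "(vertex (index v), vertex c) \<in> {(v, w). v \<in> verts \<Lambda> \<and> w \<in> verts \<Lambda> \<and> 0 < adj_prod v w}\<^sup>*"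
    using c v by (intro power_entry_imp_path) (auto simp: index_less)
  ultimately show "(v, w) \<in> {(v, w). v \<in> verts \<Lambda> \<and> w \<in> verts \<Lambda> \<and> 0 < adj_prod v w}\<^sup>+"
    using v w by (intro rtrancl_into_trancl1[of v "vertex c"]) (auto simp: vertex_index)
qed (use finite_verts verts_ne in \<open>auto simp: adj_prod_def\<close>)

lemma rho_eqI:
  assumes "i \<in> {1..k}" "\<And>v. v \<in> verts \<Lambda> \<Longrightarrow> 0 < x v"
    and "\<And>v. v \<in> verts \<Lambda> \<Longrightarrow> edge_op \<Lambda> i x v = c * x v"
  shows "rho \<Lambda> i = c"
  unfolding rho_def
proof (rule spectral_radius_pos_eigenvector)
  show "adj_mat \<Lambda> i \<in> carrier_mat (card (verts \<Lambda>)) (card (verts \<Lambda>))"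
    by (simp add: adj_mat_def)
  show "0 < card (verts \<Lambda>)"
    using finite_verts verts_ne by (simp add: card_gt_0_iff)
  fix a assume a: "a < card (verts \<Lambda>)"
  then have "vertex a \<in> verts \<Lambda>"
    using bij_betwE[OF bij_betw_vertex] by auto
  then show "0 < x (vertex a)"
    "(\<Sum>b<card (verts \<Lambda>). real (adj_mat \<Lambda> i $$ (a, b)) * x (vertex b)) = c * x (vertex a)"
    using assms a adj_mat_apply[of i a x] by auto
qed

lemma common_eigenvector_exists:
  "\<exists>x. (\<forall>v\<in>verts \<Lambda>. 0 < x v) \<and> (\<forall>i\<in>{1..k}. \<forall>v\<in>verts \<Lambda>. edge_op \<Lambda> i x v = rho \<Lambda> i * x v)"
proof -
  obtain R x where x: "\<And>v. v \<in> verts \<Lambda> \<Longrightarrow> 0 < x v"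
    "\<And>v. v \<in> verts \<Lambda> \<Longrightarrow> mat_apply (verts \<Lambda>) adj_prod x v = R * x v"
    using PF.pos_eigenvector_exists by blast
  have "edge_op \<Lambda> i x v = rho \<Lambda> i * x v" if i: "i \<in> {1..k}" and v: "v \<in> verts \<Lambda>" for i v
  proof -
    have "mat_apply (verts \<Lambda>) adj_prod (edge_op \<Lambda> i x) v = R * edge_op \<Lambda> i x v" if "v \<in> verts \<Lambda>" for v
    proof -
      have "mat_apply (verts \<Lambda>) adj_prod (edge_op \<Lambda> i x) v = edge_op \<Lambda> i (edge_ops [1..<Suc k] x) v"
        unfolding adj_prod_apply[OF that] using i by (intro edge_op_edge_ops_commute[symmetric]) auto
      also have "\<dots> = edge_op \<Lambda> i (\<lambda>v. R * x v) v"
        using x(2) adj_prod_apply by (intro edge_op_cong) auto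
      finally show ?thesis
        by (simp add: edge_op_scale)
    qed
    moreover have "0 \<le> edge_op \<Lambda> i x v" for v
      using edge_op_mono[of "\<lambda>_. 0" x i v] x(1) by (auto simp: edge_op_def less_imp_le)
    ultimately obtain c where "\<And>v. v \<in> verts \<Lambda> \<Longrightarrow> edge_op \<Lambda> i x v = c * x v"
      using PF.nonneg_eigenvector_unique[of x R "edge_op \<Lambda> i x"] x by blast
    then show ?thesis
      using rho_eqI[OF i, of x c] x(1) v by simp
  qed
  with x(1) show ?thesis
    by blast
qed

lemma adj_prod_eigenvector:
  assumes "\<And>i v. i \<in> {1..k} \<Longrightarrow> v \<in> verts \<Lambda> \<Longrightarrow> edge_op \<Lambda> i x v = rho \<Lambda> i * x v" "v \<in> verts \<Lambda>"
  shows "mat_apply (verts \<Lambda>) adj_prod x v = (\<Prod>i=1..k. rho \<Lambda> i) * x v"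
proof -
  have "(\<Prod>i\<leftarrow>[1..<Suc k]. rho \<Lambda> i) = (\<Prod>i=1..k. rho \<Lambda> i)"
    using prod.distinct_set_conv_list[of "[1..<Suc k]" "rho \<Lambda>"]
    by (simp add: atLeastLessThanSuc_atLeastAtMost del: upt_Suc)
  then show ?thesis
    using edge_ops_eigenvector[of "[1..<Suc k]" x "rho \<Lambda>" v] assms
    by (simp add: adj_prod_apply del: upt_Suc)
qed

lemma perron_vec_characterization:
  defines "P \<equiv> \<lambda>x. x \<in> extensional (verts \<Lambda>) \<and> (\<forall>v\<in>verts \<Lambda>. 0 < x v)
     \<and> (\<Sum>v\<in>verts \<Lambda>. x v) = 1
     \<and> (\<forall>i\<in>{1..k}. \<forall>v\<in>verts \<Lambda>. (\<Sum>w\<in>verts \<Lambda>. real (adj \<Lambda> i v w) * x w) = rho \<Lambda> i * x v)"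
  shows "P (perron_vec k \<Lambda>)"
proof -
  obtain x where x: "\<And>v. v \<in> verts \<Lambda> \<Longrightarrow> 0 < x v"
    "\<And>i v. i \<in> {1..k} \<Longrightarrow> v \<in> verts \<Lambda> \<Longrightarrow> edge_op \<Lambda> i x v = rho \<Lambda> i * x v"
    using common_eigenvector_exists by blast
  define s where "s = sum x (verts \<Lambda>)"
  have s: "0 < s"
    unfolding s_def using x(1) finite_verts verts_ne by (intro sum_pos) auto
  have "P (\<lambda>v\<in>verts \<Lambda>. x v / s)"
    unfolding P_def
  proof (intro conjI ballI)
    show "(\<Sum>v\<in>verts \<Lambda>. (\<lambda>v\<in>verts \<Lambda>. x v / s) v) = 1"
      using s by (simp add: s_def flip: sum_divide_distrib)
    fix i v assume "i \<in> {1..k}" "v \<in> verts \<Lambda>"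
    then show "(\<Sum>w\<in>verts \<Lambda>. real (adj \<Lambda> i v w) * (\<lambda>v\<in>verts \<Lambda>. x v / s) w) = rho \<Lambda> i * (\<lambda>v\<in>verts \<Lambda>. x v / s) v"
      using x(2)[of i v] by (simp add: edge_op_adj flip: sum_divide_distrib)
  qed (use x(1) s in auto)
  moreover have "y = z" if y: "P y" and z: "P z" for y z
  proof (rule extensionalityI)
    have eig: "mat_apply (verts \<Lambda>) adj_prod y v = (\<Prod>i=1..k. rho \<Lambda> i) * y v" if "P y" "v \<in> verts \<Lambda>" for y v
      using that by (intro adj_prod_eigenvector) (auto simp: P_def edge_op_adj)
    then obtain c where c: "\<And>v. v \<in> verts \<Lambda> \<Longrightarrow> y v = c * z v"
      using PF.nonneg_eigenvector_unique[of z "\<Prod>i=1..k. rho \<Lambda> i" y] y z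
      by (auto simp: P_def less_imp_le)
    have "c = (\<Sum>v\<in>verts \<Lambda>. c * z v)"
      using z by (simp add: P_def flip: sum_distrib_left)
    also have "\<dots> = 1"
      using y c by (simp add: P_def)
    finally show "y v = z v" if "v \<in> verts \<Lambda>" for v
      using c that by simp
  qed (use y z in \<open>auto simp: P_def\<close>)
  ultimately show ?thesis
    unfolding perron_vec_def P_def[symmetric] by (metis theI)
qed

abbreviation "perron \<equiv> perron_vec k \<Lambda>"

lemma perron_pos: "v \<in> verts \<Lambda> \<Longrightarrow> 0 < perron v"
  and sum_perron: "(\<Sum>v\<in>verts \<Lambda>. perron v) = 1"
  using perron_vec_characterization by auto

lemma edge_op_perron: "i \<in> {1..k} \<Longrightarrow> v \<in> verts \<Lambda> \<Longrightarrow> edge_op \<Lambda> i perron v = rho \<Lambda> i * perron v"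
  using perron_vec_characterization by (simp add: edge_op_adj)

lemma perron_le_1: "v \<in> verts \<Lambda> \<Longrightarrow> perron v \<le> 1"
  using member_le_sum[of v "verts \<Lambda>" perron] finite_verts perron_pos sum_perron
  by (auto simp: less_imp_le)

lemma rho_pos:
  assumes i: "i \<in> {1..k}"
  shows "0 < rho \<Lambda> i"
proof -
  obtain v where v: "v \<in> verts \<Lambda>"
    using verts_ne by auto
  have "0 \<le> edge_op \<Lambda> i perron v"
    using edge_op_mono[of "\<lambda>_. 0" perron i v] perron_pos by (auto simp: edge_op_def less_imp_le)
  then have "0 \<le> rho \<Lambda> i"
    using edge_op_perron[OF i v] perron_pos[OF v] by (simp add: zero_le_mult_iff)
  moreover have "rho \<Lambda> i \<noteq> 0"
  proof
    assume "rho \<Lambda> i = 0"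
    then have "(\<Prod>i=1..k. rho \<Lambda> i) = 0"
      using i by auto
    then have T0: "mat_apply (verts \<Lambda>) adj_prod perron w = 0" if "w \<in> verts \<Lambda>" for w
      using adj_prod_eigenvector[of perron w] edge_op_perron that by simp
    have "(v, v) \<in> {(v, w). v \<in> verts \<Lambda> \<and> w \<in> verts \<Lambda> \<and> 0 < adj_prod v w}\<^sup>+"
      using PF.irred v by blast
    then obtain w where w: "w \<in> verts \<Lambda>" "0 < adj_prod v w"
      by (auto dest: tranclD)
    then have "0 < adj_prod v w * perron w"
      using perron_pos by simp
    also have "\<dots> \<le> 0"
      using PF.T_ge_entry[of perron v w] perron_pos v w T0[OF v] by (simp add: less_imp_le)
    finally show False
      by simp
  qed
  ultimately show ?thesis
    by simp
qed

lemma perron_unique: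
  assumes "\<And>v. v \<in> verts \<Lambda> \<Longrightarrow> 0 \<le> y v"
    and "\<And>v. v \<in> verts \<Lambda> \<Longrightarrow> edge_ops [1..<Suc k] y v = (\<Prod>i=1..k. rho \<Lambda> i) * y v"
    and "(\<Sum>v\<in>verts \<Lambda>. y v) = 1" and v: "v \<in> verts \<Lambda>"
  shows "y v = perron v"
proof -
  have "\<exists>c. \<forall>v\<in>verts \<Lambda>. y v = c * perron v"
    using assms perron_pos adj_prod_eigenvector[of perron] edge_op_perron
    by (intro PF.nonneg_eigenvector_unique) (auto simp: adj_prod_apply simp del: upt_Suc)
  then obtain c where c: "\<And>v. v \<in> verts \<Lambda> \<Longrightarrow> y v = c * perron v"
    by blast
  then have "1 = c * (\<Sum>v\<in>verts \<Lambda>. perron v)"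
    using assms(3) by (simp add: sum_distrib_left)
  then show ?thesis
    using c[OF v] sum_perron by simp
qed

end

section \<open>Paths in the Bratteli diagram\<close>

lemma fpaths_snoc:
  "(v, es @ [e]) \<in> fpaths k \<Lambda> \<longleftrightarrow> (v, es) \<in> fpaths k \<Lambda>
    \<and> e \<in> bedges k \<Lambda> (Suc (length es)) \<and> brng \<Lambda> e = fsrc \<Lambda> (v, es)"
proof (cases es rule: rev_cases)
  case (snoc es' e')
  have "(\<forall>j. Suc j < length (es @ [e]) \<longrightarrow> bsrc \<Lambda> ((es @ [e]) ! j) = brng \<Lambda> ((es @ [e]) ! Suc j))
    \<longleftrightarrow> (\<forall>j. Suc j < length es \<longrightarrow> bsrc \<Lambda> (es ! j) = brng \<Lambda> (es ! Suc j)) \<and> bsrc \<Lambda> e' = brng \<Lambda> e"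
    by (auto simp: snoc nth_append less_Suc_eq split: if_splits)
  moreover have "(\<forall>j<length (es @ [e]). (es @ [e]) ! j \<in> bedges k \<Lambda> (Suc j))
    \<longleftrightarrow> (\<forall>j<length es. es ! j \<in> bedges k \<Lambda> (Suc j)) \<and> e \<in> bedges k \<Lambda> (Suc (length es))"
    by (auto simp: nth_append less_Suc_eq)
  moreover have "(es @ [e]) ! 0 = es ! 0"
    by (simp add: snoc nth_append)
  ultimately show ?thesis
    by (auto simp: fpaths_def fsrc_def snoc)
qed (auto simp: fpaths_def fsrc_def)

lemma fpaths_Nil: "(v, []) \<in> fpaths k \<Lambda> \<longleftrightarrow> v \<in> bverts \<Lambda> 0"
  by (auto simp: fpaths_def)

lemma flen_Nil [simp]: "flen (v, []) = 0" and flen_snoc [simp]: "flen (v, es @ [e]) = Suc (flen (v, es))"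
  by (simp_all add: flen_def)

lemma fsrc_Nil [simp]: "fsrc \<Lambda> (v, []) = v" and fsrc_snoc [simp]: "fsrc \<Lambda> (v, es @ [e]) = bsrc \<Lambda> e"
  by (simp_all add: fsrc_def)

lemma fst_fsrc: "\<eta> \<in> fpaths k \<Lambda> \<Longrightarrow> fst (fsrc \<Lambda> \<eta>) = flen \<eta>"
  by (cases \<eta>; cases "snd \<eta>" rule: rev_cases)
    (auto simp: fpaths_snoc fpaths_Nil bverts_def bedges_def bsrc_def flen_def)

lemma init_seg_Suc:
  "init_seg \<Lambda> x (Suc n) = (fst (init_seg \<Lambda> x n), snd (init_seg \<Lambda> x n) @ [x (Suc n)])"
  by (simp add: init_seg_def)

lemma flen_init_seg [simp]: "flen (init_seg \<Lambda> x n) = n"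
  by (simp add: init_seg_def flen_def)

lemma init_seg_eq_antimono:
  assumes "init_seg \<Lambda> x n = init_seg \<Lambda> y n" "m \<le> n"
  shows "init_seg \<Lambda> x m = init_seg \<Lambda> y m"
  using assms(2,1) by (induction rule: dec_induct) (auto simp: init_seg_Suc prod_eq_iff)

lemma bpaths_edge: "x \<in> bpaths k \<Lambda> \<Longrightarrow> x (Suc n) \<in> bedges k \<Lambda> (Suc n)"
  by (simp add: bpaths_def PiE_iff)

lemma bpaths_composable: "x \<in> bpaths k \<Lambda> \<Longrightarrow> bsrc \<Lambda> (x (Suc n)) = brng \<Lambda> (x (Suc (Suc n)))"
  by (simp add: bpaths_def)

context k_graph
begin

lemma fsrc_in_verts:
  assumes "\<eta> \<in> fpaths k \<Lambda>"
  shows "snd (fsrc \<Lambda> \<eta>) \<in> verts \<Lambda>"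
  using assms by (cases \<eta>; cases "snd \<eta>" rule: rev_cases)
    (auto simp: fpaths_snoc fpaths_Nil bverts_def bedges_def bsrc_def mor_of_deg_def[of _ "unit_deg _"] src_in_verts)

lemma init_seg_in_fpaths:
  assumes "x \<in> bpaths k \<Lambda>"
  shows "init_seg \<Lambda> x n \<in> fpaths k \<Lambda>"
proof (induction n)
  case 0
  have "snd (x 1) \<in> mor \<Lambda>" "fst (x 1) = 1"
    using bpaths_edge[OF assms, of 0] by (auto simp: bedges_def mor_of_deg_def)
  then show ?case
    by (simp add: init_seg_def fpaths_Nil bverts_def brng_def rng_in_verts)
next
  case (Suc n)
  have "fsrc \<Lambda> (init_seg \<Lambda> x n) = brng \<Lambda> (x (Suc n))"
  proof (cases n)
    case (Suc m)
    then show ?thesis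
      using bpaths_composable[OF assms, of m] by (simp add: init_seg_Suc)
  qed (simp add: init_seg_def)
  moreover have "x (Suc n) \<in> bedges k \<Lambda> (Suc n)"
    using assms by (rule bpaths_edge)
  moreover have "length (snd (init_seg \<Lambda> x n)) = n"
    by (simp add: init_seg_def)
  ultimately show ?case
    using Suc by (simp add: init_seg_Suc fpaths_snoc)
qed

lemma bcyl_subset: "bcyl k \<Lambda> \<eta> \<subseteq> bpaths k \<Lambda>"
  by (auto simp: bcyl_def)

lemma mem_bcyl_init_seg: "x \<in> bpaths k \<Lambda> \<Longrightarrow> x \<in> bcyl k \<Lambda> (init_seg \<Lambda> x n)"
  by (simp add: bcyl_def)

lemma bcyl_Int_cases:
  "bcyl k \<Lambda> \<eta> \<inter> bcyl k \<Lambda> \<theta> \<in> {{}, bcyl k \<Lambda> \<eta>, bcyl k \<Lambda> \<theta>}"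
proof -
  have *: "bcyl k \<Lambda> \<theta> \<subseteq> bcyl k \<Lambda> \<eta>"
    if le: "flen \<eta> \<le> flen \<theta>" and ne: "bcyl k \<Lambda> \<eta> \<inter> bcyl k \<Lambda> \<theta> \<noteq> {}" for \<eta> \<theta>
  proof
    fix y assume y: "y \<in> bcyl k \<Lambda> \<theta>"
    obtain x where "init_seg \<Lambda> x (flen \<eta>) = \<eta>" "init_seg \<Lambda> x (flen \<theta>) = \<theta>"
      using ne by (auto simp: bcyl_def)
    then show "y \<in> bcyl k \<Lambda> \<eta>"
      using y init_seg_eq_antimono[of \<Lambda> y "flen \<theta>" x, OF _ le] by (simp add: bcyl_def)
  qed
  show ?thesis
    using *[of \<eta> \<theta>] *[of \<theta> \<eta>] by (cases "flen \<eta> \<le> flen \<theta>") (auto simp: inf_commute)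
qed

lemma UN_bcyl_verts: "(\<Union>v\<in>verts \<Lambda>. bcyl k \<Lambda> ((0, v), [])) = bpaths k \<Lambda>"
proof -
  have "\<exists>v\<in>verts \<Lambda>. x \<in> bcyl k \<Lambda> ((0, v), [])" if "x \<in> bpaths k \<Lambda>" for x
    using init_seg_in_fpaths[OF that, of 0] mem_bcyl_init_seg[OF that, of 0]
    by (auto simp: init_seg_def fpaths_Nil bverts_def)
  then show ?thesis
    using bcyl_subset by blast
qed

lemma vertex_path_in_fpaths: "v \<in> verts \<Lambda> \<Longrightarrow> ((0, v), []) \<in> fpaths k \<Lambda>"
  by (simp add: fpaths_Nil bverts_def)

end

definition fpaths_ext_by :: "nat \<Rightarrow> 'm graded_category \<Rightarrow> 'm fpath \<Rightarrow> nat \<Rightarrow> 'm fpath set" where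
  "fpaths_ext_by k \<Lambda> \<gamma> m = {\<eta> \<in> fpaths_ext k \<Lambda> \<gamma>. flen \<eta> = flen \<gamma> + m}"

lemma fpaths_ext_by_0: "\<gamma> \<in> fpaths k \<Lambda> \<Longrightarrow> fpaths_ext_by k \<Lambda> \<gamma> 0 = {\<gamma>}"
  by (auto simp: fpaths_ext_by_def fpaths_ext_def flen_def prod_eq_iff prefix_def)

lemma bij_betw_fpaths_ext_by_Suc:
  fixes m :: nat
  assumes "\<gamma> \<in> fpaths k \<Lambda>"
  defines "c \<equiv> colour k (Suc (flen \<gamma> + m))"
  shows "bij_betw (\<lambda>(\<eta>, f). (fst \<eta>, snd \<eta> @ [(Suc (flen \<gamma> + m), f)]))
    (SIGMA \<eta>:fpaths_ext_by k \<Lambda> \<gamma> m. {f \<in> mor_of_deg \<Lambda> (unit_deg c). rng \<Lambda> f = snd (fsrc \<Lambda> \<eta>)})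
    (fpaths_ext_by k \<Lambda> \<gamma> (Suc m))" (is "bij_betw ?h ?A ?B")
proof (rule bij_betwI')
  fix p p' assume "p \<in> ?A" "p' \<in> ?A"
  then show "(?h p = ?h p') = (p = p')"
    by (auto simp: prod_eq_iff)
next
  fix p assume "p \<in> ?A"
  then obtain \<eta> f where p: "p = (\<eta>, f)" and \<eta>: "\<eta> \<in> fpaths_ext_by k \<Lambda> \<gamma> m"
    and f: "f \<in> mor_of_deg \<Lambda> (unit_deg c)" "rng \<Lambda> f = snd (fsrc \<Lambda> \<eta>)"
    by auto
  have "fst (fsrc \<Lambda> \<eta>) = flen \<gamma> + m"
    using fst_fsrc[of \<eta> k \<Lambda>] \<eta> by (auto simp: fpaths_ext_by_def fpaths_ext_def)
  then have "brng \<Lambda> (Suc (flen \<gamma> + m), f) = fsrc \<Lambda> \<eta>"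
    using f by (simp add: brng_def prod_eq_iff)
  then show "?h p \<in> ?B"
    using \<eta> f unfolding p fpaths_ext_by_def fpaths_ext_def
    by (cases \<eta>) (auto simp: fpaths_snoc bedges_def c_def flen_def)
next
  fix \<theta> assume \<theta>: "\<theta> \<in> ?B"
  then obtain us where "snd \<theta> = snd \<gamma> @ us" "length us = Suc m"
    by (auto simp: fpaths_ext_by_def fpaths_ext_def prefix_def flen_def)
  then obtain us' n f where us: "snd \<theta> = snd \<gamma> @ us' @ [(n, f)]" "length us' = m"
    by (cases us rule: rev_cases) auto
  define \<eta> where "\<eta> = (fst \<theta>, snd \<gamma> @ us')"
  have \<theta>': "\<theta> = (fst \<eta>, snd \<eta> @ [(n, f)])"
    using us by (simp add: \<eta>_def prod_eq_iff)
  have len: "length (snd \<eta>) = flen \<gamma> + m"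
    using us by (simp add: \<eta>_def flen_def)
  have "(fst \<eta>, snd \<eta> @ [(n, f)]) \<in> fpaths k \<Lambda>"
    unfolding \<theta>'[symmetric] using \<theta> by (simp add: fpaths_ext_by_def fpaths_ext_def)
  then have *: "\<eta> \<in> fpaths k \<Lambda>" "(n, f) \<in> bedges k \<Lambda> (Suc (flen \<gamma> + m))" "brng \<Lambda> (n, f) = fsrc \<Lambda> \<eta>"
    unfolding fpaths_snoc by (simp_all add: len)
  then have "\<eta> \<in> fpaths_ext_by k \<Lambda> \<gamma> m"
    using \<theta> len by (auto simp: fpaths_ext_by_def fpaths_ext_def flen_def \<eta>_def)
  then have "(\<eta>, f) \<in> ?A" "\<theta> = ?h (\<eta>, f)"
    using * \<theta>' by (auto simp: bedges_def c_def brng_def dest!: arg_cong[of _ _ snd])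
  then show "\<exists>p\<in>?A. \<theta> = ?h p"
    by blast
qed

lemma fpaths_ext_eq_UN: "fpaths_ext k \<Lambda> \<gamma> = (\<Union>m. fpaths_ext_by k \<Lambda> \<gamma> m)"
  by (auto simp: fpaths_ext_by_def fpaths_ext_def flen_def prefix_def)

lemma (in k_graph) fpaths_eq_UN: "fpaths k \<Lambda> = (\<Union>v\<in>verts \<Lambda>. fpaths_ext k \<Lambda> ((0, v), []))"
  by (auto simp: fpaths_ext_def) (auto simp: fpaths_def bverts_def)

lemma colour_in: "1 \<le> k \<Longrightarrow> colour k n \<in> {1..k}"
  by (auto simp: colour_def intro: Suc_leI)

lemma colour_Suc_add: "colour k (Suc (n + k)) = colour k (Suc n)"
  by (simp add: colour_def)

context finite_k_graph
begin

lemma finite_out_edges: "finite {f \<in> mor_of_deg \<Lambda> (unit_deg (colour k n)). rng \<Lambda> f = v}"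
  using finite_mor_of_deg[OF unit_deg_in_degs[OF colour_in[OF k_pos]]] by simp

lemma finite_fpaths_ext_by:
  assumes "\<gamma> \<in> fpaths k \<Lambda>"
  shows "finite (fpaths_ext_by k \<Lambda> \<gamma> m)"
proof (induction m)
  case (Suc m)
  then show ?case
    using bij_betw_finite[OF bij_betw_fpaths_ext_by_Suc[OF assms, of m]] finite_out_edges by auto
qed (use assms in \<open>simp add: fpaths_ext_by_0\<close>)

lemma countable_fpaths: "countable (fpaths k \<Lambda>)"
  unfolding fpaths_eq_UN fpaths_ext_eq_UN
  by (intro countable_UN countable_finite[OF finite_verts] countableI_type
      countable_finite[OF finite_fpaths_ext_by] vertex_path_in_fpaths)

definition level_op :: "nat \<Rightarrow> nat \<Rightarrow> ('a \<Rightarrow> real) \<Rightarrow> 'a \<Rightarrow> real" where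
  "level_op n m = edge_ops (map (colour k) [Suc n..<Suc (n + m)])"

lemma level_op_0 [simp]: "level_op n 0 y = y"
  by (simp add: level_op_def)

lemma level_op_Suc: "level_op n (Suc m) y = edge_op \<Lambda> (colour k (Suc n)) (level_op (Suc n) m y)"
  by (simp add: level_op_def upt_conv_Cons del: upt_Suc)

lemma level_op_Suc_right: "level_op n (Suc m) y = level_op n m (edge_op \<Lambda> (colour k (Suc (n + m))) y)"
  by (simp add: level_op_def)

lemma level_op_mono:
  "(\<And>w. w \<in> verts \<Lambda> \<Longrightarrow> y w \<le> z w) \<Longrightarrow> v \<in> verts \<Lambda> \<Longrightarrow> level_op n m y v \<le> level_op n m z v"
  by (induction m arbitrary: n v) (auto simp: level_op_Suc intro!: edge_op_mono)

lemma level_op_scale: "level_op n m (\<lambda>v. c * y v) = (\<lambda>v. c * level_op n m y v)"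
  by (simp add: level_op_def edge_ops_scale)

lemma level_op_add_period: "level_op (n + k) m = level_op n m"
proof (induction m arbitrary: n)
  case (Suc m)
  show ?case
    using Suc[of "Suc n"] by (intro ext) (simp add: level_op_Suc colour_Suc_add)
qed (intro ext, simp)

lemma sum_fpaths_ext_by:
  assumes "\<gamma> \<in> fpaths k \<Lambda>"
  shows "(\<Sum>\<eta>\<in>fpaths_ext_by k \<Lambda> \<gamma> m. y (snd (fsrc \<Lambda> \<eta>))) = level_op (flen \<gamma>) m y (snd (fsrc \<Lambda> \<gamma>))"
proof (induction m arbitrary: y)
  case (Suc m)
  let ?c = "colour k (Suc (flen \<gamma> + m))"
  let ?E = "\<lambda>\<eta>. {f \<in> mor_of_deg \<Lambda> (unit_deg ?c). rng \<Lambda> f = snd (fsrc \<Lambda> \<eta>)}"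
  let ?h = "\<lambda>(\<eta>, f). (fst \<eta>, snd \<eta> @ [(Suc (flen \<gamma> + m), f)])"
  have "(\<Sum>\<eta>\<in>fpaths_ext_by k \<Lambda> \<gamma> (Suc m). y (snd (fsrc \<Lambda> \<eta>)))
      = (\<Sum>p\<in>Sigma (fpaths_ext_by k \<Lambda> \<gamma> m) ?E. y (snd (fsrc \<Lambda> (?h p))))"
    by (rule sum.reindex_bij_betw[OF bij_betw_fpaths_ext_by_Suc[OF assms], symmetric])
  also have "\<dots> = (\<Sum>(\<eta>, f)\<in>Sigma (fpaths_ext_by k \<Lambda> \<gamma> m) ?E. y (src \<Lambda> f))"
    by (intro sum.cong) (auto simp: bsrc_def)
  also have "\<dots> = (\<Sum>\<eta>\<in>fpaths_ext_by k \<Lambda> \<gamma> m. edge_op \<Lambda> ?c y (snd (fsrc \<Lambda> \<eta>)))"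
    unfolding edge_op_def using finite_fpaths_ext_by[OF assms] finite_out_edges
    by (intro sum.Sigma[symmetric]) auto
  finally show ?case
    by (simp add: Suc level_op_Suc_right)
qed (use assms in \<open>simp add: fpaths_ext_by_0\<close>)

lemma sets_bpath_borel: "sets (bpath_borel k \<Lambda>) = sigma_sets (bpaths k \<Lambda>) (bcyl k \<Lambda> ` fpaths k \<Lambda>)"
  unfolding bpath_borel_def using countable_fpaths
  by (intro sets_sigma_topology_generated_by) (auto simp: bcyl_def)

lemma space_bpath_borel: "space (bpath_borel k \<Lambda>) = bpaths k \<Lambda>"
proof -
  have "{U. openin (topology_generated_by (bcyl k \<Lambda> ` fpaths k \<Lambda>)) U} \<subseteq> Pow (bpaths k \<Lambda>)"
    using openin_subset[of "topology_generated_by (bcyl k \<Lambda> ` fpaths k \<Lambda>)"] bcyl_subset by fastforce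
  then show ?thesis
    by (simp add: bpath_borel_def)
qed

lemma bcyl_in_sets: "\<eta> \<in> fpaths k \<Lambda> \<Longrightarrow> bcyl k \<Lambda> \<eta> \<in> sets (bpath_borel k \<Lambda>)"
  by (auto simp: sets_bpath_borel)

lemma measure_eqI_bcyl:
  assumes "finite_measure M" "finite_measure N"
    and sets: "sets M = sets (bpath_borel k \<Lambda>)" "sets N = sets (bpath_borel k \<Lambda>)"
    and eq: "\<And>\<eta>. \<eta> \<in> fpaths k \<Lambda> \<Longrightarrow> measure M (bcyl k \<Lambda> \<eta>) = measure N (bcyl k \<Lambda> \<eta>)"
  shows "M = N"
proof -
  interpret M: finite_measure M by fact
  interpret N: finite_measure N by fact
  let ?C = "bcyl k \<Lambda> ` fpaths k \<Lambda>"
  have gen: "sets (bpath_borel k \<Lambda>) = sigma_sets (bpaths k \<Lambda>) (insert {} ?C)"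
    unfolding sets_bpath_borel by (intro sigma_sets_eqI) (auto intro: sigma_sets.Empty)
  show ?thesis
  proof (rule measure_eqI_generator_eq_countable)
    show "Int_stable (insert {} ?C)"
      using bcyl_Int_cases by (fastforce simp: Int_stable_def)
    show "insert {} ?C \<subseteq> Pow (bpaths k \<Lambda>)"
      using bcyl_subset by blast
    show "emeasure M X = emeasure N X" if "X \<in> insert {} ?C" for X
      using that eq by (auto simp: M.emeasure_eq_measure N.emeasure_eq_measure)
    let ?A = "(\<lambda>v. bcyl k \<Lambda> ((0, v), [])) ` verts \<Lambda>"
    show "?A \<subseteq> insert {} ?C" "countable ?A"
      using vertex_path_in_fpaths finite_verts by (auto intro: countable_finite)
    show "\<Union> ?A = bpaths k \<Lambda>"
      by (rule UN_bcyl_verts)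
  qed (use sets gen in auto)
qed

end

section \<open>The path measure\<close>

lemma map_upt_1_eq_iff: "map f [1..<Suc (length xs)] = xs \<longleftrightarrow> (\<forall>j<length xs. f (Suc j) = xs ! j)"
  unfolding list_eq_iff_nth_eq by (simp del: upt_Suc)

context irreducible_k_graph
begin

definition level_rho :: "nat \<Rightarrow> real" where
  "level_rho n = (\<Prod>j<n. rho \<Lambda> (colour k (Suc j)))"

lemma level_rho_0 [simp]: "level_rho 0 = 1"
  and level_rho_Suc: "level_rho (Suc n) = level_rho n * rho \<Lambda> (colour k (Suc n))"
  by (simp_all add: level_rho_def)

lemma level_rho_pos: "0 < level_rho n"
  unfolding level_rho_def by (intro prod_pos rho_pos ballI colour_in k_pos)

lemma level_rho_eq:
  assumes "n = q * k + t" "t < k"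
  shows "level_rho n = (\<Prod>i=1..t. rho \<Lambda> i ^ (q + 1)) * (\<Prod>i=t+1..k. rho \<Lambda> i ^ q)"
  using assms
proof (induction n arbitrary: q t)
  case (Suc n)
  show ?case
  proof (cases t)
    case 0
    then obtain q' where q: "q = Suc q'"
      using Suc.prems by (cases q) auto
    obtain k' where k': "k = Suc k'"
      using k_pos by (cases k) auto
    have n: "n = q' * k + k'"
      using Suc.prems 0 q k' by simp
    have "(k' + q' * k) mod k = k'"
      by (subst mod_mult_self1) (simp add: k')
    then have "colour k (Suc n) = k"
      using n k' by (simp add: colour_def add.commute)
    then have "level_rho (Suc n) = (\<Prod>i=1..k'. rho \<Lambda> i ^ (q' + 1)) * (\<Prod>i=k'+1..k. rho \<Lambda> i ^ q') * rho \<Lambda> k"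
      using Suc.IH[OF n] by (simp add: level_rho_Suc k'[symmetric] del: prod.cl_ivl_Suc) (simp add: k')
    also have "\<dots> = (\<Prod>i=1..t. rho \<Lambda> i ^ (q + 1)) * (\<Prod>i=t+1..k. rho \<Lambda> i ^ q)"
      by (simp add: q 0 k' prod.distrib)
    finally show ?thesis .
  next
    case (Suc t')
    have n: "n = q * k + t'" "t' < k"
      using Suc Suc.prems by auto
    have "colour k (Suc n) = t"
      using n by (simp add: colour_def Suc)
    moreover have "(\<Prod>i=t'+1..k. rho \<Lambda> i ^ q) = rho \<Lambda> t ^ q * (\<Prod>i=t+1..k. rho \<Lambda> i ^ q)"
      using n Suc by (simp add: prod.atLeast_Suc_atMost)
    ultimately show ?thesis
      using Suc.IH[OF n] Suc by (simp add: level_rho_Suc)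
  qed
qed auto

lemma level_rho_div_mod:
  "level_rho n = (\<Prod>i=1..n mod k. rho \<Lambda> i ^ (n div k + 1)) * (\<Prod>i=n mod k+1..k. rho \<Lambda> i ^ (n div k))"
  using k_pos by (intro level_rho_eq) auto

definition total_rho :: real where
  "total_rho = (\<Prod>i=1..k. rho \<Lambda> i)"

lemma level_rho_add_period: "level_rho (n + k) = total_rho * level_rho n"
proof (induction n)
  case 0
  show ?case
    using level_rho_eq[of k 1 0] k_pos by (simp add: total_rho_def)
next
  case (Suc n)
  then show ?case
    by (simp add: level_rho_Suc colour_Suc_add)
qed

lemma level_rho_period: "level_rho (q * k) = total_rho ^ q"
  by (induction q) (simp_all add: level_rho_add_period add.commute[of k])

lemma total_rho_pos: "0 < total_rho"
  using level_rho_pos[of k] level_rho_period[of 1] by simp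

lemma level_op_perron:
  "v \<in> verts \<Lambda> \<Longrightarrow> level_op n m perron v = level_rho (n + m) / level_rho n * perron v"
proof (induction m arbitrary: v)
  case 0
  then show ?case
    using level_rho_pos[of n] by simp
next
  case (Suc m)
  let ?c = "colour k (Suc (n + m))"
  have "level_op n (Suc m) perron v = level_op n m (edge_op \<Lambda> ?c perron) v"
    by (simp add: level_op_Suc_right)
  also have "\<dots> = level_op n m (\<lambda>v. rho \<Lambda> ?c * perron v) v"
    unfolding level_op_def using Suc.prems by (intro edge_ops_cong edge_op_perron colour_in k_pos)
  finally show ?case
    using Suc by (simp add: level_op_scale level_rho_Suc)
qed

lemma weight_eq:
  "weight k \<Lambda> \<delta> \<eta> = level_rho (flen \<eta>) powr (- 1 / \<delta>) * perron (snd (fsrc \<Lambda> \<eta>))"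
  by (simp add: weight_def Let_def level_rho_div_mod)

text \<open>
  The path measure is the law of the path that starts at a vertex drawn with the distribution
  \<open>perron\<close> and leaves every vertex \<open>v\<close> of level \<open>n\<close> by an edge \<open>choice (n + 1, v)\<close>, where all these
  choices are independent. The starting vertex is the choice at an index of level \<open>0\<close>.
\<close>

definition choice_set :: "nat \<times> 'a \<Rightarrow> 'a set" where
  "choice_set i = (case i of (0, _) \<Rightarrow> verts \<Lambda>
     | (Suc n, v) \<Rightarrow> if v \<in> verts \<Lambda>
         then {f \<in> mor_of_deg \<Lambda> (unit_deg (colour k (Suc n))). rng \<Lambda> f = v} else {undefined})"

definition choice_prob :: "nat \<times> 'a \<Rightarrow> 'a \<Rightarrow> real" where
  "choice_prob i a = (case i of (0, _) \<Rightarrow> perron a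
     | (Suc n, v) \<Rightarrow> if v \<in> verts \<Lambda>
         then perron (src \<Lambda> a) / (rho \<Lambda> (colour k (Suc n)) * perron v) else 1)"

definition choice_space :: "nat \<times> 'a \<Rightarrow> 'a measure" where
  "choice_space i = point_measure (choice_set i) (\<lambda>a. ennreal (choice_prob i a))"

lemma finite_choice_set: "finite (choice_set i)"
  using finite_verts finite_out_edges by (auto simp: choice_set_def split: prod.split nat.split)

lemma choice_prob_nonneg:
  assumes "a \<in> choice_set i"
  shows "0 \<le> choice_prob i a"
proof (cases i)
  case (Pair n v)
  show ?thesis
  proof (cases n)
    case 0
    then show ?thesis
      using assms Pair perron_pos by (auto simp: choice_set_def choice_prob_def less_imp_le)
  next
    case (Suc n')
    then show ?thesis
      using assms Pair perron_pos rho_pos[OF colour_in[OF k_pos, of n]]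
      by (auto simp: choice_set_def choice_prob_def mor_of_deg_def[of _ "unit_deg _"] src_in_verts less_imp_le
          intro!: divide_nonneg_nonneg mult_nonneg_nonneg split: if_splits)
  qed
qed

lemma sum_choice_prob: "(\<Sum>a\<in>choice_set i. choice_prob i a) = 1"
proof (cases i)
  case (Pair n v)
  show ?thesis
  proof (cases n)
    case 0
    then show ?thesis
      using Pair sum_perron by (simp add: choice_set_def choice_prob_def)
  next
    case (Suc n')
    let ?c = "colour k (Suc n')"
    show ?thesis
    proof (cases "v \<in> verts \<Lambda>")
      case True
      then have "(\<Sum>a\<in>choice_set i. choice_prob i a) = edge_op \<Lambda> ?c perron v / (rho \<Lambda> ?c * perron v)"
        using Pair Suc by (simp add: choice_set_def choice_prob_def edge_op_def sum_divide_distrib)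
      then show ?thesis
        using True edge_op_perron[OF colour_in[OF k_pos] True, of "Suc n'"] perron_pos[OF True]
          rho_pos[OF colour_in[OF k_pos], of "Suc n'"] by simp
    qed (use Pair Suc in \<open>simp add: choice_set_def choice_prob_def\<close>)
  qed
qed

lemma emeasure_choice_space:
  "X \<subseteq> choice_set i \<Longrightarrow> emeasure (choice_space i) X = ennreal (\<Sum>a\<in>X. choice_prob i a)"
  unfolding choice_space_def using finite_choice_set[of i] choice_prob_nonneg[of _ i]
  by (subst emeasure_point_measure_finite) (auto intro!: sum_ennreal)

lemma space_choice_space: "space (choice_space i) = choice_set i"
  and sets_choice_space: "sets (choice_space i) = Pow (choice_set i)"
  by (simp_all add: choice_space_def space_point_measure sets_point_measure)

lemma prob_space_choice_space: "prob_space (choice_space i)"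
  by (intro prob_spaceI) (simp add: space_choice_space emeasure_choice_space sum_choice_prob)

definition choices :: "(nat \<times> 'a \<Rightarrow> 'a) measure" where
  "choices = PiM UNIV choice_space"

lemma space_choices: "space choices = {\<omega>. \<forall>i. \<omega> i \<in> choice_set i}"
  by (auto simp: choices_def space_PiM space_choice_space PiE_iff)

primrec visited :: "(nat \<times> 'a \<Rightarrow> 'a) \<Rightarrow> nat \<Rightarrow> 'a" where
  "visited \<omega> 0 = \<omega> (0, undefined)"
| "visited \<omega> (Suc n) = src \<Lambda> (\<omega> (Suc n, visited \<omega> n))"

definition chosen_path :: "(nat \<times> 'a \<Rightarrow> 'a) \<Rightarrow> nat \<Rightarrow> nat \<times> 'a" where
  "chosen_path \<omega> = (\<lambda>n\<in>{1..}. (n, \<omega> (n, visited \<omega> (n - 1))))"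

lemma chosen_path_Suc: "chosen_path \<omega> (Suc n) = (Suc n, \<omega> (Suc n, visited \<omega> n))"
  by (simp add: chosen_path_def)

lemma visited_in_verts: "\<omega> \<in> space choices \<Longrightarrow> visited \<omega> n \<in> verts \<Lambda>"
proof (induction n)
  case 0
  then have "\<omega> (0, undefined) \<in> choice_set (0, undefined)"
    unfolding space_choices by blast
  then show ?case
    by (simp add: choice_set_def)
next
  case (Suc n)
  then have "\<omega> (Suc n, visited \<omega> n) \<in> choice_set (Suc n, visited \<omega> n)"
    unfolding space_choices by blast
  with Suc show ?case
    by (auto simp: choice_set_def mor_of_deg_def[of _ "unit_deg _"] src_in_verts)
qed

lemma chosen_edge:
  assumes "\<omega> \<in> space choices"
  shows "\<omega> (Suc n, visited \<omega> n) \<in> mor_of_deg \<Lambda> (unit_deg (colour k (Suc n)))"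
    and "rng \<Lambda> (\<omega> (Suc n, visited \<omega> n)) = visited \<omega> n"
proof -
  have "\<omega> (Suc n, visited \<omega> n) \<in> choice_set (Suc n, visited \<omega> n)"
    using assms unfolding space_choices by blast
  then show "\<omega> (Suc n, visited \<omega> n) \<in> mor_of_deg \<Lambda> (unit_deg (colour k (Suc n)))"
    "rng \<Lambda> (\<omega> (Suc n, visited \<omega> n)) = visited \<omega> n"
    using visited_in_verts[OF assms, of n] by (auto simp: choice_set_def)
qed

lemma chosen_path_in_bpaths:
  assumes "\<omega> \<in> space choices"
  shows "chosen_path \<omega> \<in> bpaths k \<Lambda>"
proof -
  have edge: "chosen_path \<omega> (Suc n) \<in> bedges k \<Lambda> (Suc n)" for n
    using chosen_edge(1)[OF assms, of n] by (simp add: chosen_path_Suc bedges_def)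
  have comp: "bsrc \<Lambda> (chosen_path \<omega> (Suc n)) = brng \<Lambda> (chosen_path \<omega> (Suc (Suc n)))" for n
    using chosen_edge(2)[OF assms, of "Suc n"] by (simp add: chosen_path_Suc bsrc_def brng_def)
  have "chosen_path \<omega> n \<in> bedges k \<Lambda> n" "bsrc \<Lambda> (chosen_path \<omega> n) = brng \<Lambda> (chosen_path \<omega> (Suc n))"
    if "1 \<le> n" for n
    using that edge[of "n - 1"] comp[of "n - 1"] by simp_all
  then show ?thesis
    by (auto simp: bpaths_def PiE_iff chosen_path_def)
qed

definition path_vertex :: "'a fpath \<Rightarrow> nat \<Rightarrow> 'a" where
  "path_vertex \<eta> j = (case j of 0 \<Rightarrow> snd (fst \<eta>) | Suc i \<Rightarrow> src \<Lambda> (snd (snd \<eta> ! i)))"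

definition path_index :: "'a fpath \<Rightarrow> nat \<Rightarrow> nat \<times> 'a" where
  "path_index \<eta> j = (case j of 0 \<Rightarrow> (0, undefined) | Suc i \<Rightarrow> (Suc i, path_vertex \<eta> i))"

definition path_choice :: "'a fpath \<Rightarrow> nat \<Rightarrow> 'a" where
  "path_choice \<eta> j = (case j of 0 \<Rightarrow> snd (fst \<eta>) | Suc i \<Rightarrow> snd (snd \<eta> ! i))"

lemma path_vertex_flen: "\<eta> \<in> fpaths k \<Lambda> \<Longrightarrow> path_vertex \<eta> (flen \<eta>) = snd (fsrc \<Lambda> \<eta>)"
  by (cases \<eta>; cases "snd \<eta>" rule: rev_cases) (auto simp: path_vertex_def bsrc_def flen_def)

lemma fpaths_edge:
  assumes "\<eta> \<in> fpaths k \<Lambda>" "j < flen \<eta>"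
  shows "snd \<eta> ! j = (Suc j, snd (snd \<eta> ! j))"
    and "snd (snd \<eta> ! j) \<in> mor_of_deg \<Lambda> (unit_deg (colour k (Suc j)))"
    and "rng \<Lambda> (snd (snd \<eta> ! j)) = path_vertex \<eta> j"
    and "path_vertex \<eta> j \<in> verts \<Lambda>"
proof -
  have *: "snd \<eta> ! i \<in> bedges k \<Lambda> (Suc i)" if "i < flen \<eta>" for i
    using assms(1) that by (auto simp: fpaths_def flen_def)
  show "snd \<eta> ! j = (Suc j, snd (snd \<eta> ! j))" and m: "snd (snd \<eta> ! j) \<in> mor_of_deg \<Lambda> (unit_deg (colour k (Suc j)))"
    using *[OF assms(2)] by (auto simp: bedges_def)
  show r: "rng \<Lambda> (snd (snd \<eta> ! j)) = path_vertex \<eta> j"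
  proof (cases j)
    case 0
    have "brng \<Lambda> (snd \<eta> ! 0) = fst \<eta>"
      using assms 0 by (cases \<eta>) (auto simp: fpaths_def flen_def)
    then show ?thesis
      using 0 by (simp add: path_vertex_def brng_def prod_eq_iff)
  next
    case (Suc i)
    have "bsrc \<Lambda> (snd \<eta> ! i) = brng \<Lambda> (snd \<eta> ! j)"
      using assms Suc by (cases \<eta>) (auto simp: fpaths_def flen_def)
    then show ?thesis
      using Suc by (simp add: path_vertex_def brng_def bsrc_def)
  qed
  show "path_vertex \<eta> j \<in> verts \<Lambda>"
    using m r rng_in_verts[of "snd (snd \<eta> ! j)"] by (auto simp: mor_of_deg_def[of _ "unit_deg _"])
qed

lemma init_seg_chosen_path_iff:
  assumes \<omega>: "\<omega> \<in> space choices" and \<eta>: "\<eta> \<in> fpaths k \<Lambda>"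
  shows "init_seg \<Lambda> (chosen_path \<omega>) (flen \<eta>) = \<eta> \<longleftrightarrow> (\<forall>j\<le>flen \<eta>. \<omega> (path_index \<eta> j) = path_choice \<eta> j)"
proof -
  let ?n = "flen \<eta>"
  have "fst (fst \<eta>) = 0"
    using \<eta> by (auto simp: fpaths_def bverts_def)
  moreover have "brng \<Lambda> (chosen_path \<omega> 1) = (0, visited \<omega> 0)"
    using chosen_edge(2)[OF \<omega>, of 0] chosen_path_Suc[of \<omega> 0] by (simp add: brng_def)
  ultimately have "init_seg \<Lambda> (chosen_path \<omega>) ?n = \<eta>
      \<longleftrightarrow> visited \<omega> 0 = snd (fst \<eta>) \<and> map (chosen_path \<omega>) [1..<Suc ?n] = snd \<eta>"
    by (auto simp: init_seg_def prod_eq_iff)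
  also have "map (chosen_path \<omega>) [1..<Suc ?n] = snd \<eta> \<longleftrightarrow> (\<forall>j<?n. chosen_path \<omega> (Suc j) = snd \<eta> ! j)"
    unfolding flen_def by (rule map_upt_1_eq_iff)
  also have "\<dots> \<longleftrightarrow> (\<forall>j<?n. \<omega> (Suc j, visited \<omega> j) = snd (snd \<eta> ! j))"
    using fpaths_edge(1)[OF \<eta>] by (metis chosen_path_Suc prod.inject)
  also have "visited \<omega> 0 = snd (fst \<eta>) \<and> (\<forall>j<?n. \<omega> (Suc j, visited \<omega> j) = snd (snd \<eta> ! j))
      \<longleftrightarrow> (\<forall>j\<le>?n. \<omega> (path_index \<eta> j) = path_choice \<eta> j)" (is "?L \<longleftrightarrow> ?R")
  proof
    assume L: ?L
    have "visited \<omega> j = path_vertex \<eta> j" if "j \<le> ?n" for j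
      using L that by (cases j) (auto simp: path_vertex_def)
    then show ?R
      using L by (auto simp: path_index_def path_choice_def split: nat.split)
  next
    assume R: ?R
    have R0: "\<omega> (0, undefined) = snd (fst \<eta>)"
      using R by (auto simp: path_index_def path_choice_def)
    have RS: "\<omega> (Suc j, path_vertex \<eta> j) = snd (snd \<eta> ! j)" if "j < ?n" for j
      using R[rule_format, of "Suc j"] that by (simp add: path_index_def path_choice_def)
    have "visited \<omega> j = path_vertex \<eta> j" if "j \<le> ?n" for j
      using that
    proof (induction j)
      case (Suc j)
      then show ?case
        using RS[of j] by (simp add: path_vertex_def)
    qed (use R0 in \<open>simp add: path_vertex_def\<close>)
    then show ?L
      using R0 RS by simp
  qed
  finally show ?thesis .
qed

lemma path_choice_in_choice_set:
  assumes "\<eta> \<in> fpaths k \<Lambda>" "j \<le> flen \<eta>"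
  shows "path_choice \<eta> j \<in> choice_set (path_index \<eta> j)"
proof (cases j)
  case 0
  then show ?thesis
    using assms by (auto simp: path_choice_def path_index_def choice_set_def fpaths_def bverts_def)
next
  case (Suc i)
  then show ?thesis
    using assms fpaths_edge[of \<eta> i] by (simp add: path_choice_def path_index_def choice_set_def)
qed

lemma prod_choice_prob:
  assumes \<eta>: "\<eta> \<in> fpaths k \<Lambda>" and "n \<le> flen \<eta>"
  shows "(\<Prod>j\<le>n. choice_prob (path_index \<eta> j) (path_choice \<eta> j)) = perron (path_vertex \<eta> n) / level_rho n"
  using assms(2)
proof (induction n)
  case 0
  then show ?case
    by (simp add: choice_prob_def path_index_def path_choice_def path_vertex_def)
next
  case (Suc n)
  have "choice_prob (path_index \<eta> (Suc n)) (path_choice \<eta> (Suc n))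
      = perron (path_vertex \<eta> (Suc n)) / (rho \<Lambda> (colour k (Suc n)) * perron (path_vertex \<eta> n))"
    using fpaths_edge(4)[OF \<eta>, of n] Suc.prems
    by (simp add: choice_prob_def path_index_def path_choice_def path_vertex_def[of _ "Suc n"])
  moreover have "perron (path_vertex \<eta> n) \<noteq> 0"
    using perron_pos[OF fpaths_edge(4)[OF \<eta>, of n]] Suc.prems by simp
  ultimately show ?case
    using Suc by (simp add: level_rho_Suc)
qed

lemma emeasure_choices_init_seg:
  assumes \<eta>: "\<eta> \<in> fpaths k \<Lambda>"
  defines "A \<equiv> {\<omega> \<in> space choices. init_seg \<Lambda> (chosen_path \<omega>) (flen \<eta>) = \<eta>}"
  shows "A \<in> sets choices"
    and "emeasure choices A = ennreal (perron (snd (fsrc \<Lambda> \<eta>)) / level_rho (flen \<eta>))"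
proof -
  let ?n = "flen \<eta>"
  define J where "J = path_index \<eta> ` {..?n}"
  have inj: "inj_on (path_index \<eta>) {..?n}"
    by (auto simp: inj_on_def path_index_def split: nat.splits)
  define X where "X i = {path_choice \<eta> (fst i)}" for i :: "nat \<times> 'a"
  have X: "X (path_index \<eta> j) = {path_choice \<eta> j}" for j
    by (simp add: X_def path_index_def split: nat.split)
  have XS: "X i \<in> sets (choice_space i)" if "i \<in> J" for i
    using that path_choice_in_choice_set[OF \<eta>] by (auto simp: J_def X sets_choice_space)
  have A: "A = prod_emb UNIV choice_space J (Pi\<^sub>E J X)"
  proof -
    have "A = {\<omega> \<in> space choices. \<forall>j\<le>?n. \<omega> (path_index \<eta> j) \<in> X (path_index \<eta> j)}"
      using init_seg_chosen_path_iff[OF _ \<eta>] by (auto simp: A_def X)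
    also have "\<dots> = prod_emb UNIV choice_space J (Pi\<^sub>E J X)"
      by (auto simp: prod_emb_def choices_def space_PiM J_def PiE_iff)
    finally show ?thesis .
  qed
  have J: "finite J"
    by (simp add: J_def)
  show "A \<in> sets choices"
    unfolding A choices_def using J XS by (intro sets_PiM_I) auto
  have "emeasure choices A = (\<Prod>i\<in>J. emeasure (choice_space i) (X i))"
    unfolding A choices_def using J XS prob_space_choice_space
    by (intro emeasure_PiM_emb) auto
  also have "\<dots> = (\<Prod>j\<le>?n. emeasure (choice_space (path_index \<eta> j)) (X (path_index \<eta> j)))"
    unfolding J_def by (simp add: prod.reindex[OF inj])
  also have "\<dots> = (\<Prod>j\<le>?n. ennreal (choice_prob (path_index \<eta> j) (path_choice \<eta> j)))"
    using path_choice_in_choice_set[OF \<eta>] by (intro prod.cong refl) (simp add: X emeasure_choice_space)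
  also have "\<dots> = ennreal (\<Prod>j\<le>?n. choice_prob (path_index \<eta> j) (path_choice \<eta> j))"
    using path_choice_in_choice_set[OF \<eta>] choice_prob_nonneg by (intro prod_ennreal) auto
  finally show "emeasure choices A = ennreal (perron (snd (fsrc \<Lambda> \<eta>)) / level_rho ?n)"
    using prod_choice_prob[OF \<eta>] path_vertex_flen[OF \<eta>] by simp
qed

lemma chosen_path_measurable: "chosen_path \<in> measurable choices (bpath_borel k \<Lambda>)"
proof (rule measurable_sigma_sets[OF sets_bpath_borel])
  fix B assume "B \<in> bcyl k \<Lambda> ` fpaths k \<Lambda>"
  then obtain \<eta> where \<eta>: "\<eta> \<in> fpaths k \<Lambda>" "B = bcyl k \<Lambda> \<eta>"
    by auto
  have "chosen_path -` B \<inter> space choices = {\<omega> \<in> space choices. init_seg \<Lambda> (chosen_path \<omega>) (flen \<eta>) = \<eta>}"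
    using chosen_path_in_bpaths by (auto simp: \<eta>(2) bcyl_def)
  then show "chosen_path -` B \<inter> space choices \<in> sets choices"
    using emeasure_choices_init_seg(1)[OF \<eta>(1)] by simp
qed (use chosen_path_in_bpaths in \<open>auto simp: bcyl_def\<close>)

definition path_measure :: "(nat \<Rightarrow> nat \<times> 'a) measure" where
  "path_measure = distr choices (bpath_borel k \<Lambda>) chosen_path"

lemma sets_path_measure: "sets path_measure = sets (bpath_borel k \<Lambda>)"
  by (simp add: path_measure_def)

lemma prob_space_path_measure: "prob_space path_measure"
proof -
  interpret prob_space choices
    unfolding choices_def using prob_space_choice_space by (intro prob_space_PiM)
  show ?thesis
    unfolding path_measure_def by (intro prob_space_distr chosen_path_measurable)
qed

lemma measure_path_measure_bcyl:
  assumes \<eta>: "\<eta> \<in> fpaths k \<Lambda>"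
  shows "measure path_measure (bcyl k \<Lambda> \<eta>) = perron (snd (fsrc \<Lambda> \<eta>)) / level_rho (flen \<eta>)"
proof -
  have "emeasure path_measure (bcyl k \<Lambda> \<eta>)
      = emeasure choices {\<omega> \<in> space choices. init_seg \<Lambda> (chosen_path \<omega>) (flen \<eta>) = \<eta>}"
    unfolding path_measure_def
    using chosen_path_in_bpaths bcyl_in_sets[OF \<eta>] chosen_path_measurable
    by (subst emeasure_distr) (auto simp: bcyl_def intro!: arg_cong[of _ _ "emeasure choices"])
  also have "\<dots> = ennreal (perron (snd (fsrc \<Lambda> \<eta>)) / level_rho (flen \<eta>))"
    using emeasure_choices_init_seg(2)[OF \<eta>] .
  finally show ?thesis
    using perron_pos[OF fsrc_in_verts[OF \<eta>]] level_rho_pos[of "flen \<eta>"] by (simp add: measure_def)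
qed

lemma bcyl_nonempty: "\<eta> \<in> fpaths k \<Lambda> \<Longrightarrow> bcyl k \<Lambda> \<eta> \<noteq> {}"
  using measure_path_measure_bcyl[of \<eta>] perron_pos[OF fsrc_in_verts[of \<eta>]] level_rho_pos[of "flen \<eta>"]
  by (metis divide_pos_pos less_irrefl measure_empty)

end

section \<open>Infinite paths of the graph\<close>

lemma len_deg_0 [simp]: "len_deg k 0 = (\<lambda>_. 0)"
  by (simp add: len_deg_def)

lemma len_deg_Suc: "len_deg k (Suc n) = (\<lambda>i. len_deg k n i + unit_deg (colour k (Suc n)) i)"
proof
  fix i
  have "{j \<in> {1..Suc n}. colour k j = i}
      = {j \<in> {1..n}. colour k j = i} \<union> (if colour k (Suc n) = i then {Suc n} else {})"
    by (auto simp: le_Suc_eq)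
  then show "len_deg k (Suc n) i = len_deg k n i + unit_deg (colour k (Suc n)) i"
    by (auto simp: len_deg_def unit_deg_def)
qed

lemma len_deg_mono: "m \<le> n \<Longrightarrow> len_deg k m \<le> len_deg k n"
  by (induction rule: dec_induct) (auto simp: len_deg_Suc le_fun_def intro: trans_le_add1)

lemma len_deg_in_degs: "1 \<le> k \<Longrightarrow> len_deg k n \<in> degs k"
  using colour_in by (auto simp: degs_def len_deg_def)

lemma len_deg_add_period:
  assumes "i \<in> {1..k}"
  shows "len_deg k (n + k) i = Suc (len_deg k n i)"
proof (induction n)
  case 0
  have "{j \<in> {1..k}. colour k j = i} = {i}"
    using assms by (auto simp: colour_def)
  then show ?case
    by (simp add: len_deg_def)
qed (simp add: len_deg_Suc colour_Suc_add)

lemma len_deg_cofinal: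
  assumes "n \<in> degs k"
  shows "n \<le> len_deg k (k * (\<Sum>i=1..k. n i))"
proof (rule le_funI)
  fix i
  have len: "len_deg k (k * q) i = q" if "i \<in> {1..k}" for q
    using len_deg_add_period[OF that] by (induction q) (simp_all add: add.commute[of k])
  show "n i \<le> len_deg k (k * (\<Sum>i=1..k. n i)) i"
  proof (cases "i \<in> {1..k}")
    case True
    then show ?thesis
      by (simp only: len) (intro member_le_sum, auto)
  qed (use assms in \<open>simp add: degs_def\<close>)
qed

context k_graph
begin

lemma final_part_0:
  assumes "f \<in> mor \<Lambda>"
  shows "final_part f (\<lambda>_. 0) = f"
  using parts_cmp(2)[of "rng \<Lambda> f" f] assms by (simp add: rng_in src_rng cmp_rng deg_identity)

lemma initial_part_cmp:
  assumes "f \<in> mor \<Lambda>" "g \<in> mor \<Lambda>" "src \<Lambda> f = rng \<Lambda> g" "m \<in> degs k" "m \<le> deg \<Lambda> f"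
  shows "initial_part (cmp \<Lambda> f g) m = initial_part f m"
proof -
  note p = parts[OF assms(1,4,5)]
  have s: "src \<Lambda> (final_part f m) = rng \<Lambda> g"
    using src_cmp[OF p(1-3)] p(6) assms(3) by simp
  have "cmp \<Lambda> f g = cmp \<Lambda> (initial_part f m) (cmp \<Lambda> (final_part f m) g)"
    using cmp_assoc[OF p(1,2) assms(2) p(3) s] p(6) by simp
  then show ?thesis
    using parts_cmp(1)[OF p(1) cmp_in[OF p(2) assms(2) s]] p s assms(2) by (simp add: rng_cmp)
qed

lemma initial_part_initial_part:
  assumes "f \<in> mor \<Lambda>" "m \<in> degs k" "n \<in> degs k" "m \<le> n" "n \<le> deg \<Lambda> f"
  shows "initial_part (initial_part f n) m = initial_part f m"
  using initial_part_cmp[of "initial_part f n" "final_part f n" m] parts[OF assms(1,3,5)] assms by simp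

definition segment :: "'m \<Rightarrow> (nat \<Rightarrow> nat) \<Rightarrow> (nat \<Rightarrow> nat) \<Rightarrow> 'm" where
  "segment f m n = final_part (initial_part f n) m"

lemma segment:
  assumes f: "f \<in> mor \<Lambda>" and m: "m \<in> degs k" and n: "n \<in> degs k" and mn: "m \<le> n" "n \<le> deg \<Lambda> f"
  shows "segment f m n \<in> mor \<Lambda>" "deg \<Lambda> (segment f m n) = (\<lambda>i. n i - m i)"
    "rng \<Lambda> (segment f m n) = src \<Lambda> (initial_part f m)"
    "src \<Lambda> (segment f m n) = src \<Lambda> (initial_part f n)"
    "cmp \<Lambda> (initial_part f m) (segment f m n) = initial_part f n"
proof -
  note n' = parts[OF f n mn(2)]
  have "m \<le> deg \<Lambda> (initial_part f n)"
    using n' mn by simp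
  note p = parts[OF n'(1) m this, unfolded initial_part_initial_part[OF f m n mn], folded segment_def]
  then show "segment f m n \<in> mor \<Lambda>" "deg \<Lambda> (segment f m n) = (\<lambda>i. n i - m i)"
    "rng \<Lambda> (segment f m n) = src \<Lambda> (initial_part f m)"
    "cmp \<Lambda> (initial_part f m) (segment f m n) = initial_part f n"
    using n'(4) by simp_all
  then show "src \<Lambda> (segment f m n) = src \<Lambda> (initial_part f n)"
    using src_cmp[OF p(1-3)] by simp
qed

lemma segment_self:
  assumes "f \<in> mor \<Lambda>" "m \<in> degs k" "m \<le> deg \<Lambda> f"
  shows "segment f m m = src \<Lambda> (initial_part f m)"
  using parts(1,4)[OF assms] parts_cmp(2)[of "initial_part f m" "src \<Lambda> (initial_part f m)"]
  by (simp add: segment_def src_in rng_src cmp_src)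

lemma segment_cmp:
  assumes f: "f \<in> mor \<Lambda>" and m: "m \<in> degs k" and n: "n \<in> degs k" and p: "p \<in> degs k"
    and le: "m \<le> n" "n \<le> p" "p \<le> deg \<Lambda> f"
  shows "segment f m p = cmp \<Lambda> (segment f m n) (segment f n p)"
proof -
  have le': "n \<le> deg \<Lambda> f" "m \<le> deg \<Lambda> f"
    using le by auto
  note a = parts[OF f m le'(2)] and mn = segment[OF f m n le(1) le'(1)] and np = segment[OF f n p le(2,3)]
  have "initial_part f p = cmp \<Lambda> (initial_part f m) (cmp \<Lambda> (segment f m n) (segment f n p))"
    using cmp_assoc[OF a(1) mn(1) np(1)] mn np by simp
  then show ?thesis
    using parts_cmp(2)[OF a(1) cmp_in[OF mn(1) np(1)]] a mn np by (simp add: segment_def[of f m p] rng_cmp)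
qed

lemma segment_eqI:
  assumes "a \<in> mor \<Lambda>" "g \<in> mor \<Lambda>" "b \<in> mor \<Lambda>" "src \<Lambda> a = rng \<Lambda> g" "src \<Lambda> g = rng \<Lambda> b"
  shows "segment (cmp \<Lambda> (cmp \<Lambda> a g) b) (deg \<Lambda> a) (\<lambda>i. deg \<Lambda> a i + deg \<Lambda> g i) = g"
  using parts_cmp(1)[of "cmp \<Lambda> a g" b] parts_cmp(2)[of a g] assms
  by (simp add: segment_def cmp_in src_cmp deg_cmp)

lemma gpath:
  assumes z: "z \<in> gpaths k \<Lambda>" and m: "m \<in> degs k" and n: "n \<in> degs k" and mn: "m \<le> n"
  shows "z (m, n) \<in> mor \<Lambda>" "rng \<Lambda> (z (m, n)) = z (m, m)" "src \<Lambda> (z (m, n)) = z (n, n)"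
    "deg \<Lambda> (z (m, n)) = (\<lambda>i. n i - m i)"
proof -
  let ?\<Omega> = "Omega_graph k"
  have "(m, n) \<in> mor ?\<Omega>"
    using m n mn by (simp add: Omega_graph_def)
  then have "z (m, n) \<in> mor \<Lambda> \<and> rng \<Lambda> (z (m, n)) = z (rng ?\<Omega> (m, n))
      \<and> src \<Lambda> (z (m, n)) = z (src ?\<Omega> (m, n)) \<and> deg \<Lambda> (z (m, n)) = deg ?\<Omega> (m, n)"
    using z unfolding gpaths_def graph_morphisms_def by blast
  then show "z (m, n) \<in> mor \<Lambda>" "rng \<Lambda> (z (m, n)) = z (m, m)" "src \<Lambda> (z (m, n)) = z (n, n)"
    "deg \<Lambda> (z (m, n)) = (\<lambda>i. n i - m i)"
    by (simp_all add: Omega_graph_def)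
qed

lemma gpath_cmp:
  assumes z: "z \<in> gpaths k \<Lambda>" and mnp: "m \<in> degs k" "n \<in> degs k" "p \<in> degs k" "m \<le> n" "n \<le> p"
  shows "z (m, p) = cmp \<Lambda> (z (m, n)) (z (n, p))"
proof -
  let ?\<Omega> = "Omega_graph k"
  have "(m, n) \<in> mor ?\<Omega>" "(n, p) \<in> mor ?\<Omega>" "src ?\<Omega> (m, n) = rng ?\<Omega> (n, p)"
    using mnp by (simp_all add: Omega_graph_def)
  then have "z (cmp ?\<Omega> (m, n) (n, p)) = cmp \<Lambda> (z (m, n)) (z (n, p))"
    using z unfolding gpaths_def graph_morphisms_def by blast
  then show ?thesis
    by (simp add: Omega_graph_def)
qed

definition path_mor :: "'m fpath \<Rightarrow> 'm" where
  "path_mor \<eta> = foldl (cmp \<Lambda>) (snd (fst \<eta>)) (map snd (snd \<eta>))"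

lemma path_mor_Nil [simp]: "path_mor (v, []) = snd v"
  and path_mor_snoc [simp]: "path_mor (v, es @ [e]) = cmp \<Lambda> (path_mor (v, es)) (snd e)"
  by (simp_all add: path_mor_def)

end

context finite_k_graph
begin

lemma path_mor:
  assumes "\<eta> \<in> fpaths k \<Lambda>"
  shows "path_mor \<eta> \<in> mor \<Lambda>" "deg \<Lambda> (path_mor \<eta>) = len_deg k (flen \<eta>)"
    "src \<Lambda> (path_mor \<eta>) = snd (fsrc \<Lambda> \<eta>)"
proof -
  have "path_mor (v, es) \<in> mor \<Lambda> \<and> deg \<Lambda> (path_mor (v, es)) = len_deg k (length es)
    \<and> src \<Lambda> (path_mor (v, es)) = snd (fsrc \<Lambda> (v, es))" if "(v, es) \<in> fpaths k \<Lambda>" for v es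
    using that
  proof (induction es rule: rev_induct)
    case Nil
    then have "snd v \<in> verts \<Lambda>"
      by (auto simp: fpaths_Nil bverts_def)
    then show ?case
      by (auto simp: src_vert) (auto simp: mor_of_deg_def)
  next
    case (snoc e es)
    then have *: "(v, es) \<in> fpaths k \<Lambda>" "e \<in> bedges k \<Lambda> (Suc (length es))" "rng \<Lambda> (snd e) = snd (fsrc \<Lambda> (v, es))"
      by (auto simp: fpaths_snoc brng_def dest: arg_cong[of _ _ snd])
    then show ?case
      using snoc.IH by (auto simp: bedges_def mor_of_deg_def cmp_in deg_cmp src_cmp len_deg_Suc bsrc_def)
  qed
  from this[of "fst \<eta>" "snd \<eta>"] show "path_mor \<eta> \<in> mor \<Lambda>" "deg \<Lambda> (path_mor \<eta>) = len_deg k (flen \<eta>)"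
    "src \<Lambda> (path_mor \<eta>) = snd (fsrc \<Lambda> \<eta>)"
    using assms by (auto simp: flen_def)
qed

lemma path_mor_inj:
  assumes "\<eta> \<in> fpaths k \<Lambda>" "\<theta> \<in> fpaths k \<Lambda>" "flen \<eta> = flen \<theta>" "path_mor \<eta> = path_mor \<theta>"
  shows "\<eta> = \<theta>"
proof -
  have "v = w \<and> es = fs" if "(v, es) \<in> fpaths k \<Lambda>" "(w, fs) \<in> fpaths k \<Lambda>" "length es = length fs"
    "path_mor (v, es) = path_mor (w, fs)" for v w es fs
    using that
  proof (induction es arbitrary: fs rule: rev_induct)
    case Nil
    then show ?case
      by (auto simp: fpaths_Nil bverts_def)
  next
    case (snoc e es)
    then obtain fs' f where fs: "fs = fs' @ [f]"
      by (cases fs rule: rev_cases) auto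
    have e: "(v, es) \<in> fpaths k \<Lambda>" "e \<in> bedges k \<Lambda> (Suc (length es))" "rng \<Lambda> (snd e) = snd (fsrc \<Lambda> (v, es))"
      using snoc.prems(1) by (auto simp: fpaths_snoc brng_def dest: arg_cong[of _ _ snd])
    have f: "(w, fs') \<in> fpaths k \<Lambda>" "f \<in> bedges k \<Lambda> (Suc (length fs'))" "rng \<Lambda> (snd f) = snd (fsrc \<Lambda> (w, fs'))"
      using snoc.prems(2) by (auto simp: fs fpaths_snoc brng_def dest: arg_cong[of _ _ snd])
    have len: "length es = length fs'"
      using snoc.prems(3) by (simp add: fs)
    have "path_mor (v, es) = path_mor (w, fs') \<and> snd e = snd f"
      using cmp_cancel[of "path_mor (v, es)" "snd e" "path_mor (w, fs')" "snd f"]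
        path_mor[OF e(1)] path_mor[OF f(1)] e f len snoc.prems(4)
      by (simp add: fs flen_def bedges_def mor_of_deg_def mem_Times_iff)
    moreover have "fst e = fst f"
      using e f len by (simp add: bedges_def mem_Times_iff)
    ultimately show ?case
      using snoc.IH[OF e(1) f(1) len] by (simp add: fs prod_eq_iff)
  qed
  from this[of "fst \<eta>" "snd \<eta>" "fst \<theta>" "snd \<theta>"] show ?thesis
    using assms by (simp add: flen_def prod_eq_iff)
qed

lemma path_mor_surj:
  assumes "f \<in> mor \<Lambda>" "deg \<Lambda> f = len_deg k n"
  obtains \<eta> where "\<eta> \<in> fpaths k \<Lambda>" "flen \<eta> = n" "path_mor \<eta> = f"
proof -
  have "\<exists>\<eta>\<in>fpaths k \<Lambda>. flen \<eta> = n \<and> path_mor \<eta> = f"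
    using assms
  proof (induction n arbitrary: f)
    case 0
    then have "f \<in> verts \<Lambda>"
      by (simp add: mor_of_deg_def)
    then show ?case
      using vertex_path_in_fpaths by (intro bexI[of _ "((0, f), [])"]) auto
  next
    case (Suc n)
    have "len_deg k n \<le> deg \<Lambda> f"
      unfolding Suc.prems by (rule len_deg_mono) simp
    note p = parts[OF Suc.prems(1) len_deg_in_degs[OF k_pos] this]
    obtain \<eta> where \<eta>: "\<eta> \<in> fpaths k \<Lambda>" "flen \<eta> = n" "path_mor \<eta> = initial_part f (len_deg k n)"
      using Suc.IH[OF p(1,4)] by blast
    let ?e = "(Suc n, final_part f (len_deg k n))"
    have "?e \<in> bedges k \<Lambda> (Suc n)"
      using p(2,5) Suc.prems(2) by (simp add: bedges_def mor_of_deg_def len_deg_Suc)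
    moreover have "brng \<Lambda> ?e = fsrc \<Lambda> \<eta>"
      using p(3) path_mor(3)[OF \<eta>(1)] fst_fsrc[OF \<eta>(1)] \<eta>(2,3) by (simp add: brng_def prod_eq_iff)
    ultimately have "(fst \<eta>, snd \<eta> @ [?e]) \<in> fpaths k \<Lambda>"
      using \<eta> by (simp add: fpaths_snoc flen_def)
    then show ?case
      using \<eta> p(6) by (intro bexI[of _ "(fst \<eta>, snd \<eta> @ [?e])"]) (auto simp: flen_def)
  qed
  then show ?thesis
    using that by blast
qed

abbreviation path_upto :: "(nat \<Rightarrow> nat \<times> 'a) \<Rightarrow> nat \<Rightarrow> 'a" where
  "path_upto x n \<equiv> path_mor (init_seg \<Lambda> x n)"

lemma path_upto:
  assumes "x \<in> bpaths k \<Lambda>"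
  shows "path_upto x n \<in> mor \<Lambda>" "deg \<Lambda> (path_upto x n) = len_deg k n"
    "path_upto x (Suc n) = cmp \<Lambda> (path_upto x n) (snd (x (Suc n)))"
    "snd (x (Suc n)) \<in> mor \<Lambda>" "src \<Lambda> (path_upto x n) = rng \<Lambda> (snd (x (Suc n)))"
proof -
  show "path_upto x n \<in> mor \<Lambda>" "deg \<Lambda> (path_upto x n) = len_deg k n"
    using path_mor[OF init_seg_in_fpaths[OF assms, of n]] by simp_all
  show "path_upto x (Suc n) = cmp \<Lambda> (path_upto x n) (snd (x (Suc n)))"
    by (simp add: init_seg_Suc)
  show "snd (x (Suc n)) \<in> mor \<Lambda>"
    using bpaths_edge[OF assms, of n] by (auto simp: bedges_def mor_of_deg_def)
  have "brng \<Lambda> (x (Suc n)) = fsrc \<Lambda> (init_seg \<Lambda> x n)"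
    using init_seg_in_fpaths[OF assms, of "Suc n"] by (simp add: init_seg_Suc fpaths_snoc)
  then show "src \<Lambda> (path_upto x n) = rng \<Lambda> (snd (x (Suc n)))"
    using path_mor(3)[OF init_seg_in_fpaths[OF assms, of n]] by (simp add: brng_def prod_eq_iff)
qed

lemma initial_part_path_upto:
  assumes x: "x \<in> bpaths k \<Lambda>" and d: "d \<in> degs k" "d \<le> len_deg k N" and "N \<le> N'"
  shows "initial_part (path_upto x N') d = initial_part (path_upto x N) d"
  using assms(4)
proof (induction rule: dec_induct)
  case (step n)
  have "d \<le> len_deg k n"
    using d(2) len_deg_mono[OF step(1)] by (rule order_trans)
  then show ?case
    using step path_upto[OF x, of n] initial_part_cmp[of "path_upto x n" "snd (x (Suc n))" d] d(1) by simp
qed simp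

definition graph_path :: "(nat \<Rightarrow> nat \<times> 'a) \<Rightarrow> 'a gpath" where
  "graph_path x = (\<lambda>(m, n)\<in>mor (Omega_graph k). segment (path_upto x (k * (\<Sum>i=1..k. n i))) m n)"

lemma graph_path_eq:
  assumes x: "x \<in> bpaths k \<Lambda>" and m: "m \<in> degs k" and n: "n \<in> degs k" "m \<le> n" "n \<le> len_deg k N"
  shows "graph_path x (m, n) = segment (path_upto x N) m n"
proof -
  let ?M = "k * (\<Sum>i=1..k. n i)"
  have "initial_part (path_upto x ?M) n = initial_part (path_upto x N) n"
    using initial_part_path_upto[OF x n(1,3), of "max ?M N"]
      initial_part_path_upto[OF x n(1) len_deg_cofinal[OF n(1)], of "max ?M N"] by simp
  then show ?thesis
    using m n by (simp add: graph_path_def Omega_graph_def segment_def)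
qed

lemma graph_path_in_gpaths:
  assumes x: "x \<in> bpaths k \<Lambda>"
  shows "graph_path x \<in> gpaths k \<Lambda>"
proof -
  have *: "graph_path x (m, n) = segment (path_upto x (k * (\<Sum>i=1..k. p i))) m n"
    "m \<le> deg \<Lambda> (path_upto x (k * (\<Sum>i=1..k. p i)))" "n \<le> deg \<Lambda> (path_upto x (k * (\<Sum>i=1..k. p i)))"
    "p \<le> deg \<Lambda> (path_upto x (k * (\<Sum>i=1..k. p i)))"
    if "m \<in> degs k" "n \<in> degs k" "p \<in> degs k" "m \<le> n" "n \<le> p" for m n p
    using that len_deg_cofinal[OF that(3)] path_upto(2)[OF x] graph_path_eq[OF x that(1,2,4)] by auto
  have mor: "graph_path x (m, n) \<in> mor \<Lambda>" "deg \<Lambda> (graph_path x (m, n)) = (\<lambda>i. n i - m i)"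
    "rng \<Lambda> (graph_path x (m, n)) = graph_path x (m, m)" "src \<Lambda> (graph_path x (m, n)) = graph_path x (n, n)"
    if "m \<in> degs k" "n \<in> degs k" "m \<le> n" for m n
    using *[of m n n] *[of m m n] *[of n n n] that path_upto(1)[OF x] by (simp_all add: segment segment_self)
  have comp: "graph_path x (m, p) = cmp \<Lambda> (graph_path x (m, n)) (graph_path x (n, p))"
    if "m \<in> degs k" "n \<in> degs k" "p \<in> degs k" "m \<le> n" "n \<le> p" for m n p
  proof -
    have "m \<le> p"
      using that by (rule_tac order_trans)
    then show ?thesis
      using segment_cmp[OF path_upto(1)[OF x] that *(4)[OF that]] that
      by (simp only: *(1)[of m n p] *(1)[of m p p] *(1)[of n p p] order_refl)
  qed
  have "graph_path x \<in> mor (Omega_graph k) \<rightarrow>\<^sub>E mor \<Lambda>"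
    using mor(1) unfolding PiE_iff by (auto simp: Omega_graph_def) (simp add: graph_path_def Omega_graph_def)
  moreover have "rng \<Lambda> (graph_path x f) = graph_path x (rng (Omega_graph k) f)
      \<and> src \<Lambda> (graph_path x f) = graph_path x (src (Omega_graph k) f)
      \<and> deg \<Lambda> (graph_path x f) = deg (Omega_graph k) f" if "f \<in> mor (Omega_graph k)" for f
    using that mor(2-4) by (cases f) (simp add: Omega_graph_def)
  moreover have "graph_path x (cmp (Omega_graph k) f g) = cmp \<Lambda> (graph_path x f) (graph_path x g)"
    if "f \<in> mor (Omega_graph k)" "g \<in> mor (Omega_graph k)" "src (Omega_graph k) f = rng (Omega_graph k) g" for f g
  proof -
    define m n p where "m = fst f" and "n = snd f" and "p = snd g"
    then have "f = (m, n)" "g = (n, p)" and le: "m \<in> degs k" "n \<in> degs k" "p \<in> degs k" "m \<le> n" "n \<le> p"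
      using that by (auto simp: Omega_graph_def split: prod.splits)
    then show ?thesis
      using comp[OF le] by (simp add: Omega_graph_def)
  qed
  ultimately show ?thesis
    unfolding gpaths_def graph_morphisms_def by blast
qed

lemma to_bpath_Suc: "to_bpath k z (Suc n) = (Suc n, z (len_deg k n, len_deg k (Suc n)))"
  by (simp add: to_bpath_def)

lemma to_bpath_in_bpaths:
  assumes z: "z \<in> gpaths k \<Lambda>"
  shows "to_bpath k z \<in> bpaths k \<Lambda>"
proof -
  note d = len_deg_in_degs[OF k_pos]
  have "(\<lambda>i. len_deg k (Suc n) i - len_deg k n i) = unit_deg (colour k (Suc n))" for n
    by (simp add: len_deg_Suc)
  then have edge: "to_bpath k z (Suc n) \<in> bedges k \<Lambda> (Suc n)" for n
    using gpath(1)[OF z d d] gpath(4)[OF z d d] len_deg_mono[of n "Suc n" k]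
    by (simp add: to_bpath_Suc bedges_def mor_of_deg_def)
  have comp: "bsrc \<Lambda> (to_bpath k z (Suc n)) = brng \<Lambda> (to_bpath k z (Suc (Suc n)))" for n
    using gpath(3)[OF z d d, of n "Suc n"] gpath(2)[OF z d d, of "Suc n" "Suc (Suc n)"]
      len_deg_mono[of n "Suc n" k] len_deg_mono[of "Suc n" "Suc (Suc n)" k]
    by (simp add: to_bpath_Suc bsrc_def brng_def)
  have "to_bpath k z n \<in> bedges k \<Lambda> n" "bsrc \<Lambda> (to_bpath k z n) = brng \<Lambda> (to_bpath k z (Suc n))"
    if "1 \<le> n" for n
    using that edge[of "n - 1"] comp[of "n - 1"] by simp_all
  then show ?thesis
    by (auto simp: bpaths_def PiE_iff to_bpath_def)
qed

lemma path_upto_to_bpath: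
  assumes z: "z \<in> gpaths k \<Lambda>"
  shows "path_upto (to_bpath k z) n = z (\<lambda>_. 0, len_deg k n)"
proof -
  note d = len_deg_in_degs[OF k_pos]
  show ?thesis
  proof (induction n)
    case 0
    show ?case
      using gpath(2)[OF z d d, of 0 1] len_deg_mono[of 0 1 k] to_bpath_Suc[of z 0]
      by (simp add: init_seg_def brng_def)
  next
    case (Suc n)
    then show ?case
      using gpath_cmp[OF z d d d, of 0 n "Suc n"] len_deg_mono[of 0 n k] len_deg_mono[of n "Suc n" k]
      by (simp add: init_seg_Suc to_bpath_Suc)
  qed
qed

lemma graph_path_to_bpath:
  assumes z: "z \<in> gpaths k \<Lambda>"
  shows "graph_path (to_bpath k z) = z"
proof (rule extensionalityI[where A = "mor (Omega_graph k)"])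
  fix p assume "p \<in> mor (Omega_graph k)"
  then obtain m n where p: "p = (m, n)" and m: "m \<in> degs k" and n: "n \<in> degs k" and mn: "m \<le> n"
    by (auto simp: Omega_graph_def)
  define L where "L = len_deg k (k * (\<Sum>i=1..k. n i))"
  have L: "L \<in> degs k" "n \<le> L"
    using len_deg_in_degs[OF k_pos] len_deg_cofinal[OF n] by (auto simp: L_def)
  have o: "(\<lambda>_. 0) \<in> degs k" "(\<lambda>_. 0) \<le> m" "(\<lambda>_. 0) \<le> n" "\<And>m. (\<lambda>_. 0::nat) \<le> m"
    by (auto simp: degs_def le_fun_def)
  have "graph_path (to_bpath k z) (m, n) = segment (z (\<lambda>_. 0, L)) m n"
    using graph_path_eq[OF to_bpath_in_bpaths[OF z] m n mn] L(2) by (simp add: L_def path_upto_to_bpath[OF z])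
  also have "z (\<lambda>_. 0, L) = cmp \<Lambda> (cmp \<Lambda> (z (\<lambda>_. 0, m)) (z (m, n))) (z (n, L))"
    using gpath_cmp[OF z o(1) m n o(2) mn] gpath_cmp[OF z o(1) n L(1) o(3) L(2)] by simp
  also have "segment \<dots> m n = z (m, n)"
  proof -
    have "m i + (n i - m i) = n i" for i
      using mn by (simp add: le_fun_def)
    then show ?thesis
      using segment_eqI[of "z (\<lambda>_. 0, m)" "z (m, n)" "z (n, L)"] z m n mn L o
      by (simp add: gpath)
  qed
  finally show "graph_path (to_bpath k z) p = z p"
    by (simp add: p)
qed (use z in \<open>auto simp: graph_path_def gpaths_def graph_morphisms_def PiE_iff\<close>)

lemma to_bpath_in_bcyl_iff:
  assumes z: "z \<in> gpaths k \<Lambda>" and \<eta>: "\<eta> \<in> fpaths k \<Lambda>"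
  shows "to_bpath k z \<in> bcyl k \<Lambda> \<eta> \<longleftrightarrow> z \<in> gcyl k \<Lambda> (path_mor \<eta>)"
proof -
  have "z \<in> gcyl k \<Lambda> (path_mor \<eta>) \<longleftrightarrow> path_upto (to_bpath k z) (flen \<eta>) = path_mor \<eta>"
    using z path_mor(2)[OF \<eta>] by (simp add: gcyl_def path_upto_to_bpath)
  also have "\<dots> \<longleftrightarrow> init_seg \<Lambda> (to_bpath k z) (flen \<eta>) = \<eta>"
    using path_mor_inj[OF init_seg_in_fpaths[OF to_bpath_in_bpaths[OF z]] \<eta>] by auto
  finally show ?thesis
    using to_bpath_in_bpaths[OF z] by (simp add: bcyl_def)
qed

lemma graph_path_in_gcyl_iff:
  assumes x: "x \<in> bpaths k \<Lambda>" and f: "f \<in> mor \<Lambda>" and N: "deg \<Lambda> f \<le> len_deg k N"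
  shows "graph_path x \<in> gcyl k \<Lambda> f \<longleftrightarrow> initial_part (path_upto x N) (deg \<Lambda> f) = f"
proof -
  have o: "(\<lambda>_. 0) \<in> degs k" "\<And>m. (\<lambda>_. 0::nat) \<le> m"
    by (auto simp: degs_def le_fun_def)
  have "deg \<Lambda> f \<le> deg \<Lambda> (path_upto x N)"
    using N path_upto(2)[OF x] by simp
  then have "initial_part (path_upto x N) (deg \<Lambda> f) \<in> mor \<Lambda>"
    by (intro parts path_upto(1)[OF x] deg_in[OF f])
  then have "graph_path x (\<lambda>_. 0, deg \<Lambda> f) = initial_part (path_upto x N) (deg \<Lambda> f)"
    using graph_path_eq[OF x o(1) deg_in[OF f] o(2) N] by (simp add: segment_def final_part_0)
  then show ?thesis
    using graph_path_in_gpaths[OF x] by (simp add: gcyl_def)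
qed

lemma sets_gpath_borel: "sets (gpath_borel k \<Lambda>) = sigma_sets (gpaths k \<Lambda>) (gcyl k \<Lambda> ` mor \<Lambda>)"
  unfolding gpath_borel_def using countable_mor
  by (intro sets_sigma_topology_generated_by) (auto simp: gcyl_def)

lemma space_gpath_borel: "space (gpath_borel k \<Lambda>) = gpaths k \<Lambda>"
proof -
  have "\<Union>(gcyl k \<Lambda> ` mor \<Lambda>) \<subseteq> gpaths k \<Lambda>"
    by (auto simp: gcyl_def)
  then have "{U. openin (topology_generated_by (gcyl k \<Lambda> ` mor \<Lambda>)) U} \<subseteq> Pow (gpaths k \<Lambda>)"
    using openin_subset[of "topology_generated_by (gcyl k \<Lambda> ` mor \<Lambda>)"] by fastforce
  then show ?thesis
    by (simp add: gpath_borel_def)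
qed

lemma gcyl_in_sets: "f \<in> mor \<Lambda> \<Longrightarrow> gcyl k \<Lambda> f \<in> sets (gpath_borel k \<Lambda>)"
  by (auto simp: sets_gpath_borel)

lemma to_bpath_measurable: "to_bpath k \<in> measurable (gpath_borel k \<Lambda>) (bpath_borel k \<Lambda>)"
proof (rule measurable_sigma_sets[OF sets_bpath_borel])
  fix B assume "B \<in> bcyl k \<Lambda> ` fpaths k \<Lambda>"
  then obtain \<eta> where \<eta>: "\<eta> \<in> fpaths k \<Lambda>" "B = bcyl k \<Lambda> \<eta>"
    by auto
  have "to_bpath k -` B \<inter> space (gpath_borel k \<Lambda>) = gcyl k \<Lambda> (path_mor \<eta>)"
    using to_bpath_in_bcyl_iff[OF _ \<eta>(1)] by (auto simp: \<eta>(2) space_gpath_borel) (auto simp: gcyl_def)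
  then show "to_bpath k -` B \<inter> space (gpath_borel k \<Lambda>) \<in> sets (gpath_borel k \<Lambda>)"
    using gcyl_in_sets path_mor(1)[OF \<eta>(1)] by simp
qed (auto simp: bcyl_def space_gpath_borel to_bpath_in_bpaths)

lemma finite_fpaths_of_len: "finite {\<eta> \<in> fpaths k \<Lambda>. flen \<eta> = n}"
proof -
  have "{\<eta> \<in> fpaths k \<Lambda>. flen \<eta> = n} \<subseteq> (\<Union>v\<in>verts \<Lambda>. fpaths_ext_by k \<Lambda> ((0, v), []) n)"
    by (auto simp: fpaths_eq_UN fpaths_ext_by_def)
  then show ?thesis
    using finite_verts finite_fpaths_ext_by vertex_path_in_fpaths
    by (rule_tac finite_subset) (auto intro!: finite_UN_I)
qed

lemma graph_path_vimage_gcyl: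
  assumes f: "f \<in> mor \<Lambda>" and N: "deg \<Lambda> f \<le> len_deg k N"
  shows "graph_path -` gcyl k \<Lambda> f \<inter> bpaths k \<Lambda>
    = (\<Union>\<eta>\<in>{\<eta> \<in> fpaths k \<Lambda>. flen \<eta> = N \<and> initial_part (path_mor \<eta>) (deg \<Lambda> f) = f}. bcyl k \<Lambda> \<eta>)"
  using graph_path_in_gcyl_iff[OF _ f N] init_seg_in_fpaths mem_bcyl_init_seg
  by (auto simp: bcyl_def)

lemma graph_path_measurable: "graph_path \<in> measurable (bpath_borel k \<Lambda>) (gpath_borel k \<Lambda>)"
proof (rule measurable_sigma_sets[OF sets_gpath_borel])
  fix B assume "B \<in> gcyl k \<Lambda> ` mor \<Lambda>"
  then obtain f where f: "f \<in> mor \<Lambda>" "B = gcyl k \<Lambda> f"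
    by auto
  show "graph_path -` B \<inter> space (bpath_borel k \<Lambda>) \<in> sets (bpath_borel k \<Lambda>)"
    unfolding f(2) space_bpath_borel graph_path_vimage_gcyl[OF f(1) len_deg_cofinal[OF deg_in[OF f(1)]]]
    by (intro sets.finite_UN bcyl_in_sets finite_subset[OF _ finite_fpaths_of_len]) auto
qed (auto simp: gcyl_def space_bpath_borel graph_path_in_gpaths)

end

section \<open>The canonical measure\<close>

context irreducible_k_graph
begin

lemma sum_perron_mor_of_deg:
  assumes "n \<in> degs k" "v \<in> verts \<Lambda>"
  shows "(\<Sum>g\<in>{g \<in> mor_of_deg \<Lambda> n. rng \<Lambda> g = v}. perron (src \<Lambda> g)) = (\<Prod>i=1..k. rho \<Lambda> i ^ n i) * perron v"
  using assms
proof (induction "\<Sum>i=1..k. n i" arbitrary: n v)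
  case 0
  have "n i = 0" for i
    using 0 by (cases "i \<in> {1..k}") (auto simp: degs_def)
  then have "n = (\<lambda>_. 0)"
    by auto
  moreover have "{g \<in> verts \<Lambda>. rng \<Lambda> g = v} = {v}"
    using 0 by (auto simp: rng_vert)
  ultimately show ?case
    using 0 by (simp add: src_vert)
next
  case (Suc s)
  have "\<exists>i\<in>{1..k}. n i \<noteq> 0"
    using Suc.hyps(2) by (metis nat.simps(3) sum.neutral)
  then obtain i where i: "i \<in> {1..k}" "n i \<noteq> 0"
    by blast
  define m where "m = (\<lambda>j. n j - unit_deg i j)"
  have n: "n = (\<lambda>j. m j + unit_deg i j)"
    using i by (auto simp: m_def unit_deg_def)
  have m: "m \<in> degs k"
    using Suc.prems by (auto simp: m_def degs_def)
  have "(\<Sum>j=1..k. unit_deg i j) = 1"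
    using i by (simp add: unit_deg_def)
  then have s: "s = (\<Sum>j=1..k. m j)"
    using Suc.hyps(2) unfolding n by (simp add: sum.distrib)
  have "(\<Prod>j=1..k. rho \<Lambda> j ^ unit_deg i j) = rho \<Lambda> i"
    using i by (simp add: unit_deg_def if_distrib[of "power _"] cong: if_cong)
  then have prod: "(\<Prod>j=1..k. rho \<Lambda> j ^ n j) = (\<Prod>j=1..k. rho \<Lambda> j ^ m j) * rho \<Lambda> i"
    unfolding n by (simp add: power_add prod.distrib)
  have "(\<Sum>g\<in>{g \<in> mor_of_deg \<Lambda> n. rng \<Lambda> g = v}. perron (src \<Lambda> g))
      = (\<Sum>g\<in>{g \<in> mor_of_deg \<Lambda> m. rng \<Lambda> g = v}. edge_op \<Lambda> i perron (src \<Lambda> g))"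
    unfolding n edge_op_def using m i by (intro sum_mor_of_deg_add unit_deg_in_degs)
  also have "\<dots> = (\<Sum>g\<in>{g \<in> mor_of_deg \<Lambda> m. rng \<Lambda> g = v}. rho \<Lambda> i * perron (src \<Lambda> g))"
    using i by (intro sum.cong edge_op_perron src_in_verts) (auto simp: mor_of_deg_def[of _ m])
  also have "\<dots> = (\<Prod>j=1..k. rho \<Lambda> j ^ n j) * perron v"
    unfolding prod using Suc.hyps(1)[OF s m Suc.prems(2)] by (simp flip: sum_distrib_left)
  finally show ?case .
qed

lemma prod_rho_len_deg: "(\<Prod>i=1..k. rho \<Lambda> i ^ len_deg k n i) = level_rho n"
proof (induction n)
  case (Suc n)
  have "(\<Prod>j=1..k. rho \<Lambda> j ^ unit_deg (colour k (Suc n)) j) = rho \<Lambda> (colour k (Suc n))"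
    using colour_in[OF k_pos, of "Suc n"]
    by (simp add: unit_deg_def if_distrib[of "power _"] cong: if_cong)
  then show ?case
    using Suc by (simp add: len_deg_Suc level_rho_Suc power_add prod.distrib)
qed simp

definition graph_path_measure :: "'a gpath measure" where
  "graph_path_measure = distr path_measure (gpath_borel k \<Lambda>) graph_path"

lemma prob_space_graph_path_measure: "prob_space graph_path_measure"
proof -
  interpret prob_space path_measure
    by (rule prob_space_path_measure)
  show ?thesis
    unfolding graph_path_measure_def
    by (intro prob_space_distr) (simp add: graph_path_measurable measurable_cong_sets[OF sets_path_measure refl])
qed

lemma bij_betw_cmp_initial_part:
  assumes f: "f \<in> mor \<Lambda>" and d: "d \<in> degs k" "deg \<Lambda> f \<le> d"
  shows "bij_betw (cmp \<Lambda> f) {g \<in> mor_of_deg \<Lambda> (\<lambda>i. d i - deg \<Lambda> f i). rng \<Lambda> g = src \<Lambda> f}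
    {h \<in> mor_of_deg \<Lambda> d. initial_part h (deg \<Lambda> f) = f}" (is "bij_betw _ ?A ?B")
proof (rule bij_betwI')
  fix g g' assume "g \<in> ?A" "g' \<in> ?A"
  then have g: "g \<in> mor \<Lambda>" "src \<Lambda> f = rng \<Lambda> g" and g': "g' \<in> mor \<Lambda>" "src \<Lambda> f = rng \<Lambda> g'"
    by (simp_all add: mor_of_deg_def)
  show "(cmp \<Lambda> f g = cmp \<Lambda> f g') = (g = g')"
    using cmp_cancel(2)[OF f g f g' refl] by blast
next
  fix g assume "g \<in> ?A"
  moreover have "deg \<Lambda> f i + (d i - deg \<Lambda> f i) = d i" for i
    using d(2) by (simp add: le_fun_def)
  ultimately show "cmp \<Lambda> f g \<in> ?B"
    using f by (auto simp: mor_of_deg_def cmp_in deg_cmp parts_cmp)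
next
  fix h assume h: "h \<in> ?B"
  then have h': "h \<in> mor \<Lambda>" "deg \<Lambda> h = d" "initial_part h (deg \<Lambda> f) = f"
    by (auto simp: mor_of_deg_def)
  have "deg \<Lambda> f \<le> deg \<Lambda> h"
    using d(2) h'(2) by simp
  note p = parts[OF h'(1) deg_in[OF f] this, unfolded h'(2,3)]
  show "\<exists>g\<in>?A. h = cmp \<Lambda> f g"
  proof
    show "h = cmp \<Lambda> f (final_part h (deg \<Lambda> f))"
      by (rule p(6)[symmetric])
    show "final_part h (deg \<Lambda> f) \<in> ?A"
      by (simp add: mor_of_deg_def p(2,5) p(3)[symmetric])
  qed
qed

lemma measure_graph_path_measure_gcyl:
  assumes f: "f \<in> mor \<Lambda>"
  shows "measure graph_path_measure (gcyl k \<Lambda> f) = (\<Prod>i=1..k. rho \<Lambda> i powi (- int (deg \<Lambda> f i))) * perron (src \<Lambda> f)"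
proof -
  define N where "N = k * (\<Sum>i=1..k. deg \<Lambda> f i)"
  have N: "deg \<Lambda> f \<le> len_deg k N"
    unfolding N_def by (rule len_deg_cofinal[OF deg_in[OF f]])
  define d where "d = (\<lambda>i. len_deg k N i - deg \<Lambda> f i)"
  have d: "d \<in> degs k"
    using len_deg_in_degs[OF k_pos, of N] by (simp add: d_def degs_def)
  define S where "S = {\<eta> \<in> fpaths k \<Lambda>. flen \<eta> = N \<and> initial_part (path_mor \<eta>) (deg \<Lambda> f) = f}"
  have S: "finite S"
    unfolding S_def by (rule finite_subset[OF _ finite_fpaths_of_len[of N]]) auto
  interpret prob_space path_measure
    by (rule prob_space_path_measure)
  have bij: "bij_betw path_mor S {h \<in> mor_of_deg \<Lambda> (len_deg k N). initial_part h (deg \<Lambda> f) = f}"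
  proof (rule bij_betwI')
    fix h assume h: "h \<in> {h \<in> mor_of_deg \<Lambda> (len_deg k N). initial_part h (deg \<Lambda> f) = f}"
    then obtain \<eta> where "\<eta> \<in> fpaths k \<Lambda>" "flen \<eta> = N" "path_mor \<eta> = h"
      using path_mor_surj[of h N] by (auto simp: mor_of_deg_def)
    then show "\<exists>\<eta>\<in>S. h = path_mor \<eta>"
      using h by (intro bexI[of _ \<eta>]) (auto simp: S_def)
  qed (use path_mor_inj path_mor in \<open>auto simp: S_def mor_of_deg_def\<close>)
  have "measure graph_path_measure (gcyl k \<Lambda> f) = measure path_measure (\<Union>\<eta>\<in>S. bcyl k \<Lambda> \<eta>)"
    using measure_distr[OF _ gcyl_in_sets[OF f], of graph_path path_measure] graph_path_measurable
      graph_path_vimage_gcyl[OF f N] sets_eq_imp_space_eq[OF sets_path_measure]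
    by (simp add: graph_path_measure_def measurable_cong_sets[OF sets_path_measure refl] space_bpath_borel S_def)
  also have "\<dots> = (\<Sum>\<eta>\<in>S. measure path_measure (bcyl k \<Lambda> \<eta>))"
    using bcyl_in_sets
    by (intro measure_finite_Union S)
      (auto simp: S_def sets_path_measure emeasure_eq_measure disjoint_family_on_def bcyl_def)
  also have "\<dots> = (\<Sum>\<eta>\<in>S. perron (src \<Lambda> (path_mor \<eta>)) / level_rho N)"
    using path_mor(3) by (intro sum.cong) (auto simp: S_def measure_path_measure_bcyl)
  also have "\<dots> = (\<Sum>h\<in>{h \<in> mor_of_deg \<Lambda> (len_deg k N). initial_part h (deg \<Lambda> f) = f}. perron (src \<Lambda> h) / level_rho N)"
    by (rule sum.reindex_bij_betw[OF bij])
  also have "\<dots> = (\<Sum>g\<in>{g \<in> mor_of_deg \<Lambda> d. rng \<Lambda> g = src \<Lambda> f}. perron (src \<Lambda> (cmp \<Lambda> f g)) / level_rho N)"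
    unfolding d_def
    by (rule sum.reindex_bij_betw[OF bij_betw_cmp_initial_part[OF f len_deg_in_degs[OF k_pos] N], symmetric])
  also have "\<dots> = (\<Sum>g\<in>{g \<in> mor_of_deg \<Lambda> d. rng \<Lambda> g = src \<Lambda> f}. perron (src \<Lambda> g)) / level_rho N"
    using f unfolding sum_divide_distrib by (intro sum.cong) (auto simp: mor_of_deg_def src_cmp)
  also have "\<dots> = (\<Prod>i=1..k. rho \<Lambda> i ^ d i) / level_rho N * perron (src \<Lambda> f)"
    using sum_perron_mor_of_deg[OF d src_in_verts[OF f]] by simp
  also have "(\<Prod>i=1..k. rho \<Lambda> i ^ d i) / level_rho N = (\<Prod>i=1..k. rho \<Lambda> i ^ d i / rho \<Lambda> i ^ len_deg k N i)"
    by (simp add: prod_rho_len_deg[symmetric] prod_dividef)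
  also have "\<dots> = (\<Prod>i=1..k. rho \<Lambda> i powi (- int (deg \<Lambda> f i)))"
  proof (intro prod.cong refl)
    fix i assume "i \<in> {1..k}"
    then have "rho \<Lambda> i \<noteq> 0"
      using rho_pos by fastforce
    moreover have "len_deg k N i = d i + deg \<Lambda> f i"
      using N by (simp add: d_def le_fun_def)
    ultimately show "rho \<Lambda> i ^ d i / rho \<Lambda> i ^ len_deg k N i = rho \<Lambda> i powi (- int (deg \<Lambda> f i))"
      by (simp add: power_add power_int_minus field_simps)
  qed
  finally show ?thesis .
qed

lemma distr_to_bpath_eq_path_measure:
  assumes M: "sets M = sets (gpath_borel k \<Lambda>)" "prob_space M"
    and gcyl: "\<And>f. f \<in> mor \<Lambda> \<Longrightarrow> measure M (gcyl k \<Lambda> f)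
      = (\<Prod>i=1..k. rho \<Lambda> i powi (- int (deg \<Lambda> f i))) * perron (src \<Lambda> f)"
  shows "distr M (bpath_borel k \<Lambda>) (to_bpath k) = path_measure"
proof (rule measure_eqI_bcyl)
  interpret prob_space M
    by fact
  have meas: "to_bpath k \<in> measurable M (bpath_borel k \<Lambda>)"
    by (simp add: to_bpath_measurable measurable_cong_sets[OF M(1) refl])
  show "finite_measure (distr M (bpath_borel k \<Lambda>) (to_bpath k))"
    by (rule finite_measure_distr[OF meas])
  show "finite_measure path_measure"
    using prob_space_path_measure by (simp add: prob_space_def)
  fix \<eta> assume \<eta>: "\<eta> \<in> fpaths k \<Lambda>"
  have "to_bpath k -` bcyl k \<Lambda> \<eta> \<inter> space M = gcyl k \<Lambda> (path_mor \<eta>)"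
    using to_bpath_in_bcyl_iff[OF _ \<eta>] sets_eq_imp_space_eq[OF M(1)]
    by (auto simp: space_gpath_borel) (auto simp: gcyl_def)
  then have "measure (distr M (bpath_borel k \<Lambda>) (to_bpath k)) (bcyl k \<Lambda> \<eta>) = measure M (gcyl k \<Lambda> (path_mor \<eta>))"
    using measure_distr[OF meas bcyl_in_sets[OF \<eta>]] by simp
  also have "\<dots> = (\<Prod>i=1..k. inverse (rho \<Lambda> i ^ len_deg k (flen \<eta>) i)) * perron (snd (fsrc \<Lambda> \<eta>))"
    using path_mor[OF \<eta>] by (simp add: gcyl power_int_minus)
  also have "\<dots> = perron (snd (fsrc \<Lambda> \<eta>)) / level_rho (flen \<eta>)"
    unfolding prod_inversef[unfolded o_def] prod_rho_len_deg by (simp add: field_simps)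
  also have "\<dots> = measure path_measure (bcyl k \<Lambda> \<eta>)"
    using \<eta> by (simp add: measure_path_measure_bcyl)
  finally show "measure (distr M (bpath_borel k \<Lambda>) (to_bpath k)) (bcyl k \<Lambda> \<eta>) = measure path_measure (bcyl k \<Lambda> \<eta>)" .
qed (simp_all add: sets_path_measure)

lemma perron_measure_eq: "perron_measure k \<Lambda> = graph_path_measure"
  unfolding perron_measure_def
proof (rule the_equality)
  show "sets graph_path_measure = sets (gpath_borel k \<Lambda>) \<and> prob_space graph_path_measure
     \<and> (\<forall>f\<in>mor \<Lambda>. measure graph_path_measure (gcyl k \<Lambda> f)
          = (\<Prod>i=1..k. rho \<Lambda> i powi (- int (deg \<Lambda> f i))) * perron (src \<Lambda> f))"
    using prob_space_graph_path_measure measure_graph_path_measure_gcyl by (simp add: graph_path_measure_def)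
next
  fix M assume M: "sets M = sets (gpath_borel k \<Lambda>) \<and> prob_space M
     \<and> (\<forall>f\<in>mor \<Lambda>. measure M (gcyl k \<Lambda> f)
          = (\<Prod>i=1..k. rho \<Lambda> i powi (- int (deg \<Lambda> f i))) * perron (src \<Lambda> f))"
  then have sets: "sets M = sets (gpath_borel k \<Lambda>)"
    by blast
  have meas: "to_bpath k \<in> measurable M (bpath_borel k \<Lambda>)"
    by (simp add: to_bpath_measurable measurable_cong_sets[OF sets refl])
  have "graph_path_measure = distr (distr M (bpath_borel k \<Lambda>) (to_bpath k)) (gpath_borel k \<Lambda>) graph_path"
    using distr_to_bpath_eq_path_measure[of M] M by (simp add: graph_path_measure_def)
  also have "\<dots> = distr M (gpath_borel k \<Lambda>) (graph_path \<circ> to_bpath k)"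
    by (rule distr_distr[OF graph_path_measurable meas])
  also have "\<dots> = distr M M (\<lambda>z. z)"
    using graph_path_to_bpath sets sets_eq_imp_space_eq[OF sets]
    by (intro distr_cong) (auto simp: space_gpath_borel)
  also have "\<dots> = M"
    by simp
  finally show "M = graph_path_measure"
    by simp
qed

lemma perron_measure_on_bpaths_eq: "perron_measure_on_bpaths k \<Lambda> = path_measure"
  unfolding perron_measure_on_bpaths_def perron_measure_eq
  using prob_space_graph_path_measure measure_graph_path_measure_gcyl
  by (intro distr_to_bpath_eq_path_measure) (auto simp: graph_path_measure_def)

end

section \<open>Residues of the zeta function\<close>

lemma tendsto_family_if_limit_unique:
  fixes f :: "nat \<Rightarrow> 'a \<Rightarrow> real"
  assumes V: "finite V" and bnd: "\<And>n v. v \<in> V \<Longrightarrow> f n v \<in> {a..b}"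
    and uniq: "\<And>r l. strict_mono (r :: nat \<Rightarrow> nat) \<Longrightarrow> (\<And>v. v \<in> V \<Longrightarrow> (\<lambda>n. f (r n) v) \<longlonglongrightarrow> l v)
      \<Longrightarrow> (\<And>v. v \<in> V \<Longrightarrow> l v = L v)"
    and v: "v \<in> V"
  shows "(\<lambda>n. f n v) \<longlonglongrightarrow> L v"
proof (rule ccontr)
  assume "\<not> ?thesis"
  then obtain e where e: "0 < e" "\<not> eventually (\<lambda>n. dist (f n v) (L v) < e) sequentially"
    unfolding tendsto_iff by auto
  then have "infinite {n. e \<le> dist (f n v) (L v)}"
    by (simp add: not_eventually not_less frequently_cofinite flip: cofinite_eq_sequentially)
  then obtain r where r: "strict_mono (r :: nat \<Rightarrow> nat)" "\<And>n. e \<le> dist (f (r n) v) (L v)"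
    using infinite_enumerate by blast
  obtain r' l where r': "strict_mono (r' :: nat \<Rightarrow> nat)" "\<And>v. v \<in> V \<Longrightarrow> (\<lambda>n. f (r (r' n)) v) \<longlonglongrightarrow> l v"
    using bounded_family_convergent_subseq[OF V, of "\<lambda>n. f (r n)" a b] bnd by blast
  have "l v = L v"
    using uniq[of "r \<circ> r'" l v] r(1) r' v by (simp add: strict_mono_o)
  then have "eventually (\<lambda>n. dist (f (r (r' n)) v) (L v) < e) sequentially"
    using r'(2)[OF v] e(1) unfolding tendsto_iff by simp
  then have "eventually (\<lambda>n. False) sequentially"
    by (rule eventually_mono) (use r(2) in \<open>meson not_less\<close>)
  then show False
    by simp
qed

lemma has_sum_UN_nonneg:
  fixes f :: "'b \<Rightarrow> real"
  assumes f: "\<And>x. x \<in> A \<Longrightarrow> (f has_sum g x) (B x)" and g: "(g has_sum S) A"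
    and nonneg: "\<And>x y. x \<in> A \<Longrightarrow> y \<in> B x \<Longrightarrow> 0 \<le> f y" and disj: "disjoint_family_on B A"
  shows "(f has_sum S) (\<Union>x\<in>A. B x)"
proof -
  have "(\<lambda>p. f (snd p)) summable_on Sigma A B"
    using assms has_sum_imp_summable[OF g] by (intro summable_on_SigmaI[where g = g]) auto
  then have sum: "((\<lambda>p. f (snd p)) has_sum S) (Sigma A B)"
    using f g by (intro has_sum_SigmaI[where g = g]) auto
  have "inj_on snd (Sigma A B)"
  proof (rule inj_onI)
    fix p p' assume "p \<in> Sigma A B" "p' \<in> Sigma A B" "snd p = snd p'"
    then show "p = p'"
      using disjoint_family_onD[OF disj, of "fst p" "fst p'"]
      by (cases "fst p = fst p'") (auto simp: prod_eq_iff)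
  qed
  moreover have "snd ` Sigma A B = (\<Union>x\<in>A. B x)"
    by force
  ultimately have "bij_betw snd (Sigma A B) (\<Union>x\<in>A. B x)"
    by (simp add: bij_betw_def)
  from has_sum_reindex_bij_betw[OF this, of f] sum show ?thesis
    by simp
qed

lemma powr_mult_self:
  fixes x s \<delta> :: real
  assumes "0 < x"
  shows "x powr (- s / \<delta>) * x = x powr (1 - s / \<delta>)"
proof -
  have "1 - s / \<delta> = - s / \<delta> + 1"
    by simp
  then show ?thesis
    using assms by (simp only: powr_add powr_one_gt_zero_iff powr_one)
qed

context irreducible_k_graph
begin

text \<open>
  If \<open>perron v\<close> is minimal and two infinite paths start at \<open>v\<close>, two paths of some length \<open>j * k\<close> start
  there, so that \<open>total_rho ^ j * perron v \<ge> 2 * perron v\<close>.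
\<close>

lemma total_rho_gt_1:
  assumes \<delta>: "\<forall>\<eta>\<in>fpaths k \<Lambda>. weight k \<Lambda> \<delta> \<eta> = bdiam k \<Lambda> \<delta> \<eta>"
  shows "1 < total_rho"
proof -
  define v where "v = arg_min_on perron (verts \<Lambda>)"
  have v: "v \<in> verts \<Lambda>" and min: "perron v \<le> perron w" if "w \<in> verts \<Lambda>" for w
    unfolding v_def using finite_verts verts_ne that by (auto intro: arg_min_if_finite arg_min_least)
  then have v: "v \<in> verts \<Lambda>"
    using verts_ne by blast
  define \<eta> where "\<eta> = (((0, v), []) :: 'a fpath)"
  have \<eta>: "\<eta> \<in> fpaths k \<Lambda>" "flen \<eta> = 0" "snd (fsrc \<Lambda> \<eta>) = v"
    using vertex_path_in_fpaths[OF v] by (simp_all add: \<eta>_def)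
  have "\<exists>x\<in>bcyl k \<Lambda> \<eta>. \<exists>y\<in>bcyl k \<Lambda> \<eta>. x \<noteq> y"
  proof (rule ccontr)
    assume neg: "\<not> ?thesis"
    have d0: "bdist k \<Lambda> \<delta> x y = 0" if "x \<in> bcyl k \<Lambda> \<eta>" "y \<in> bcyl k \<Lambda> \<eta>" for x y
    proof -
      have "x = y"
        using neg that by blast
      then show ?thesis
        by (simp only: bdist_def if_True simp_thms)
    qed
    obtain x where x: "x \<in> bcyl k \<Lambda> \<eta>"
      using bcyl_nonempty[OF \<eta>(1)] by blast
    have "{bdist k \<Lambda> \<delta> x y |x y. x \<in> bcyl k \<Lambda> \<eta> \<and> y \<in> bcyl k \<Lambda> \<eta>} = {0}"
    proof (intro equalityI subsetI)
      fix d assume "d \<in> {0 :: real}"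
      then have "d = bdist k \<Lambda> \<delta> x x"
        using d0[OF x x] by simp
      then show "d \<in> {bdist k \<Lambda> \<delta> x y |x y. x \<in> bcyl k \<Lambda> \<eta> \<and> y \<in> bcyl k \<Lambda> \<eta>}"
        using x by blast
    qed (use d0 in blast)
    then have "weight k \<Lambda> \<delta> \<eta> = 0"
      using \<delta> \<eta>(1) by (simp add: bdiam_def)
    then show False
      using perron_pos[OF v] \<eta> by (simp add: weight_eq)
  qed
  then obtain x y where xy: "x \<in> bcyl k \<Lambda> \<eta>" "y \<in> bcyl k \<Lambda> \<eta>" "x \<noteq> y"
    by blast
  have xb: "x \<in> bpaths k \<Lambda>" and yb: "y \<in> bpaths k \<Lambda>"
    using xy by (auto simp: bcyl_def)
  obtain j where j: "1 \<le> j" "x j \<noteq> y j"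
  proof (rule ccontr)
    assume "\<not> thesis"
    then have "x j = y j" if "j \<in> {1..}" for j
      using that \<open>\<And>j. 1 \<le> j \<Longrightarrow> x j \<noteq> y j \<Longrightarrow> thesis\<close> by auto
    then have "x = y"
      using xb yb by (intro extensionalityI[of x "{1..}" y]) (auto simp: bpaths_def PiE_iff)
    then show False
      using xy(3) by simp
  qed
  define N where "N = j * k"
  have "j \<le> N"
    using k_pos by (simp add: N_def)
  have ne: "init_seg \<Lambda> x N \<noteq> init_seg \<Lambda> y N"
    using j \<open>j \<le> N\<close> by (auto simp: init_seg_def simp del: upt_Suc)
  have ext: "init_seg \<Lambda> z N \<in> fpaths_ext_by k \<Lambda> \<eta> N" if z: "z \<in> bcyl k \<Lambda> \<eta>" for z
  proof -
    have zb: "z \<in> bpaths k \<Lambda>" and "init_seg \<Lambda> z (flen \<eta>) = \<eta>"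
      using z by (simp_all add: bcyl_def)
    moreover have "fst (init_seg \<Lambda> z N) = fst (init_seg \<Lambda> z (flen \<eta>))"
      by (simp add: init_seg_def)
    ultimately have "fst (init_seg \<Lambda> z N) = fst \<eta>"
      by simp
    then show ?thesis
      using init_seg_in_fpaths[OF zb] \<eta>(2)
      by (simp add: fpaths_ext_by_def fpaths_ext_def) (simp add: \<eta>_def)
  qed
  have "2 * perron v \<le> (\<Sum>\<theta>\<in>{init_seg \<Lambda> x N, init_seg \<Lambda> y N}. perron (snd (fsrc \<Lambda> \<theta>)))"
    using ne min[OF fsrc_in_verts[OF init_seg_in_fpaths[OF xb, of N]]]
      min[OF fsrc_in_verts[OF init_seg_in_fpaths[OF yb, of N]]] by simp
  also have "\<dots> \<le> (\<Sum>\<theta>\<in>fpaths_ext_by k \<Lambda> \<eta> N. perron (snd (fsrc \<Lambda> \<theta>)))"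
    using ext xy(1,2) perron_pos finite_fpaths_ext_by[OF \<eta>(1)]
    by (intro sum_mono2) (auto simp: fpaths_ext_by_def fpaths_ext_def fsrc_in_verts less_imp_le)
  also have "\<dots> = total_rho ^ j * perron v"
    using sum_fpaths_ext_by[OF \<eta>(1), of perron N] \<eta>(2,3) level_op_perron[OF v, of 0 N]
    by (simp add: N_def level_rho_period)
  finally have "2 \<le> total_rho ^ j"
    using perron_pos[OF v] by simp
  then show ?thesis
    using power_le_one[of total_rho j] total_rho_pos by fastforce
qed

lemma level_op_nonneg:
  assumes "\<And>w. w \<in> verts \<Lambda> \<Longrightarrow> 0 \<le> y w" "v \<in> verts \<Lambda>"
  shows "0 \<le> level_op n m y v"
  using level_op_mono[of "\<lambda>w. 0 * y w" y v n m] assms unfolding level_op_scale by simp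

definition level_term :: "real \<Rightarrow> real \<Rightarrow> nat \<Rightarrow> 'a \<Rightarrow> nat \<Rightarrow> real" where
  "level_term \<delta> s n v m = level_rho (n + m) powr (- s / \<delta>) * level_op n m (\<lambda>w. perron w powr s) v"

text \<open>
  The sum of \<open>w\<^sub>\<delta>(\<eta>)\<^sup>s\<close> over the extensions \<open>\<eta>\<close> of a path of length \<open>n\<close> with source \<open>v\<close>,
  sorted by their lengths \<open>n + m\<close>.
\<close>

definition ext_sum :: "real \<Rightarrow> real \<Rightarrow> nat \<Rightarrow> 'a \<Rightarrow> real" where
  "ext_sum \<delta> s n v = (\<Sum>m. level_term \<delta> s n v m)"

lemma level_term_nonneg: "v \<in> verts \<Lambda> \<Longrightarrow> 0 \<le> level_term \<delta> s n v m"
  unfolding level_term_def by (intro mult_nonneg_nonneg level_op_nonneg) auto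

lemma sum_weight_powr:
  assumes \<gamma>: "\<gamma> \<in> fpaths k \<Lambda>"
  shows "(\<Sum>\<eta>\<in>fpaths_ext_by k \<Lambda> \<gamma> m. weight k \<Lambda> \<delta> \<eta> powr s) = level_term \<delta> s (flen \<gamma>) (snd (fsrc \<Lambda> \<gamma>)) m"
proof -
  have "weight k \<Lambda> \<delta> \<eta> powr s = level_rho (flen \<gamma> + m) powr (- s / \<delta>) * perron (snd (fsrc \<Lambda> \<eta>)) powr s"
    if "\<eta> \<in> fpaths_ext_by k \<Lambda> \<gamma> m" for \<eta>
    using that level_rho_pos perron_pos[OF fsrc_in_verts, of \<eta>]
    by (auto simp: weight_eq fpaths_ext_by_def fpaths_ext_def powr_mult powr_powr)
  then show ?thesis
    using sum_fpaths_ext_by[OF \<gamma>, of "\<lambda>w. perron w powr s" m]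
    by (simp add: level_term_def flip: sum_distrib_left)
qed

context
  fixes \<delta> :: real
  assumes \<delta>: "0 < \<delta>" and R: "1 < total_rho"
begin

lemma level_term_le:
  assumes "0 < s" "v \<in> verts \<Lambda>"
  shows "level_term \<delta> s n v m
    \<le> level_rho (n + m) powr (1 - s / \<delta>) * (perron v / (level_rho n * Min (perron ` verts \<Lambda>)))"
proof -
  define c where "c = Min (perron ` verts \<Lambda>)"
  have c: "0 < c" "\<And>w. w \<in> verts \<Lambda> \<Longrightarrow> c \<le> perron w"
    unfolding c_def using finite_verts verts_ne perron_pos by auto
  have "perron w powr s \<le> 1 / c * perron w" if "w \<in> verts \<Lambda>" for w
  proof -
    have "perron w powr s \<le> 1"
      using perron_pos[OF that] perron_le_1[OF that] assms(1) by (intro powr_le1) auto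
    also have "\<dots> \<le> 1 / c * perron w"
      using c(1) c(2)[OF that] by (simp add: field_simps)
    finally show ?thesis .
  qed
  then have "level_op n m (\<lambda>w. perron w powr s) v \<le> level_op n m (\<lambda>w. 1 / c * perron w) v"
    using assms(2) by (rule level_op_mono)
  also have "\<dots> = level_rho (n + m) * (perron v / (level_rho n * c))"
    unfolding level_op_scale level_op_perron[OF assms(2)] by simp
  finally have "level_term \<delta> s n v m \<le> level_rho (n + m) powr (- s / \<delta>) * (level_rho (n + m) * (perron v / (level_rho n * c)))"
    unfolding level_term_def by (intro mult_left_mono) auto
  also have "\<dots> = level_rho (n + m) powr (1 - s / \<delta>) * (perron v / (level_rho n * c))"
    by (simp only: mult.assoc[symmetric] powr_mult_self[OF level_rho_pos])
  finally show ?thesis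
    unfolding c_def .
qed

lemma summable_level_term:
  assumes "\<delta> < s" "v \<in> verts \<Lambda>"
  shows "summable (level_term \<delta> s n v)"
proof (rule summable_comparison_test')
  have "summable (\<lambda>m. level_rho (n + m) powr (1 - s / \<delta>))"
  proof (rule summable_quasi_geometric)
    show "level_rho (n + (m + k)) powr (1 - s / \<delta>) = total_rho powr (1 - s / \<delta>) * level_rho (n + m) powr (1 - s / \<delta>)" for m
      using level_rho_add_period[of "n + m"] total_rho_pos level_rho_pos[of "n + m"]
      by (simp add: add.assoc powr_mult)
    show "total_rho powr (1 - s / \<delta>) < 1"
      using R \<delta> assms(1) by (intro powr_less_one) (auto simp: field_simps)
  qed simp
  then show "summable (\<lambda>m. level_rho (n + m) powr (1 - s / \<delta>) * (perron v / (level_rho n * Min (perron ` verts \<Lambda>))))"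
    by (rule summable_mult2)
  show "norm (level_term \<delta> s n v m)
      \<le> level_rho (n + m) powr (1 - s / \<delta>) * (perron v / (level_rho n * Min (perron ` verts \<Lambda>)))" for m
    using level_term_le[of s v n m] level_term_nonneg[of v \<delta> s n m] assms \<delta> by simp
qed

lemma ext_sum_sums: "\<delta> < s \<Longrightarrow> v \<in> verts \<Lambda> \<Longrightarrow> level_term \<delta> s n v sums ext_sum \<delta> s n v"
  unfolding ext_sum_def by (intro summable_sums summable_level_term)

lemma ext_sum_nonneg: "\<delta> < s \<Longrightarrow> v \<in> verts \<Lambda> \<Longrightarrow> 0 \<le> ext_sum \<delta> s n v"
  unfolding ext_sum_def by (intro suminf_nonneg summable_level_term level_term_nonneg)

lemma has_sum_weight_powr:
  assumes \<gamma>: "\<gamma> \<in> fpaths k \<Lambda>" and s: "\<delta> < s"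
  shows "((\<lambda>\<eta>. weight k \<Lambda> \<delta> \<eta> powr s) has_sum ext_sum \<delta> s (flen \<gamma>) (snd (fsrc \<Lambda> \<gamma>))) (fpaths_ext k \<Lambda> \<gamma>)"
  unfolding fpaths_ext_eq_UN
proof (rule has_sum_UN_nonneg)
  show "((\<lambda>\<eta>. weight k \<Lambda> \<delta> \<eta> powr s) has_sum level_term \<delta> s (flen \<gamma>) (snd (fsrc \<Lambda> \<gamma>)) m)
      (fpaths_ext_by k \<Lambda> \<gamma> m)" for m
    by (rule has_sum_finiteI[OF finite_fpaths_ext_by[OF \<gamma>] sum_weight_powr[OF \<gamma>, symmetric]])
  show "(level_term \<delta> s (flen \<gamma>) (snd (fsrc \<Lambda> \<gamma>)) has_sum ext_sum \<delta> s (flen \<gamma>) (snd (fsrc \<Lambda> \<gamma>))) UNIV"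
    using ext_sum_sums[OF s fsrc_in_verts[OF \<gamma>]] level_term_nonneg[OF fsrc_in_verts[OF \<gamma>]]
    by (rule sums_nonneg_imp_has_sum)
qed (auto simp: disjoint_family_on_def fpaths_ext_by_def)

lemma zeta_eq:
  assumes s: "\<delta> < s"
  shows "zeta k \<Lambda> \<delta> s = (\<Sum>v\<in>verts \<Lambda>. ext_sum \<delta> s 0 v)"
  unfolding zeta_def
proof (rule infsumI)
  show "((\<lambda>\<eta>. weight k \<Lambda> \<delta> \<eta> powr s) has_sum (\<Sum>v\<in>verts \<Lambda>. ext_sum \<delta> s 0 v)) (fpaths k \<Lambda>)"
    unfolding fpaths_eq_UN
  proof (rule has_sum_UN_nonneg)
    fix v assume "v \<in> verts \<Lambda>"
    then show "((\<lambda>\<eta>. weight k \<Lambda> \<delta> \<eta> powr s) has_sum ext_sum \<delta> s 0 v) (fpaths_ext k \<Lambda> ((0, v), []))"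
      using has_sum_weight_powr[OF vertex_path_in_fpaths s] by simp
  qed (auto simp: finite_verts disjoint_family_on_def fpaths_ext_def)
qed

lemma ext_sum_step:
  assumes s: "\<delta> < s" and v: "v \<in> verts \<Lambda>"
  shows "ext_sum \<delta> s n v
    = level_rho n powr (- s / \<delta>) * perron v powr s + edge_op \<Lambda> (colour k (Suc n)) (ext_sum \<delta> s (Suc n)) v"
proof -
  let ?E = "{f \<in> mor_of_deg \<Lambda> (unit_deg (colour k (Suc n))). rng \<Lambda> f = v}"
  have "(\<lambda>m. \<Sum>f\<in>?E. level_term \<delta> s (Suc n) (src \<Lambda> f) m) sums (\<Sum>f\<in>?E. ext_sum \<delta> s (Suc n) (src \<Lambda> f))"
    using s by (intro sums_sum ext_sum_sums src_in_verts) (auto simp: mor_of_deg_def)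
  then have "(\<lambda>m. level_term \<delta> s n v (Suc m)) sums edge_op \<Lambda> (colour k (Suc n)) (ext_sum \<delta> s (Suc n)) v"
    by (simp add: level_term_def level_op_Suc edge_op_def sum_distrib_left)
  then have "level_term \<delta> s n v sums (edge_op \<Lambda> (colour k (Suc n)) (ext_sum \<delta> s (Suc n)) v + level_term \<delta> s n v 0)"
    by (rule sums_Suc)
  then show ?thesis
    using ext_sum_sums[OF s v, of n] by (simp add: level_term_def sums_iff)
qed

lemma ext_sum_add_period:
  assumes s: "\<delta> < s" and v: "v \<in> verts \<Lambda>"
  shows "ext_sum \<delta> s (n + k) v = total_rho powr (- s / \<delta>) * ext_sum \<delta> s n v"
proof -
  have "level_term \<delta> s (n + k) v m = total_rho powr (- s / \<delta>) * level_term \<delta> s n v m" for m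
    using level_rho_add_period[of "n + m"] total_rho_pos level_rho_pos[of "n + m"]
    by (simp add: level_term_def level_op_add_period add.assoc add.commute[of k] powr_mult)
  then show ?thesis
    using suminf_mult[OF summable_level_term[OF s v]] by (simp add: ext_sum_def)
qed

lemma filterlim_zeta_at_top:
  assumes "\<delta> < 1"
  shows "filterlim (zeta k \<Lambda> \<delta>) at_top (at_right \<delta>)"
  unfolding filterlim_at_top
proof
  fix Z :: real
  define M where "M = nat \<lceil>Z\<rceil> + 1"
  have "((\<lambda>s. \<Sum>m<M. level_rho m powr (1 - s / \<delta>)) \<longlongrightarrow> (\<Sum>m<M. level_rho m powr (1 - \<delta> / \<delta>))) (at_right \<delta>)"
    using level_rho_pos \<delta> by (intro tendsto_intros) (auto simp: less_imp_neq[symmetric])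
  moreover have "Z < (\<Sum>m<M. level_rho m powr (1 - \<delta> / \<delta>))"
    using level_rho_pos \<delta> by (simp add: M_def less_imp_neq[symmetric]) linarith
  ultimately have "eventually (\<lambda>s. Z < (\<Sum>m<M. level_rho m powr (1 - s / \<delta>))) (at_right \<delta>)"
    by (rule order_tendstoD)
  moreover have "eventually (\<lambda>s. s < 1) (at_right \<delta>)"
    using assms by (auto simp: eventually_at_right)
  moreover have "eventually (\<lambda>s. \<delta> < s) (at_right \<delta>)"
    by (rule eventually_at_right_less)
  ultimately show "eventually (\<lambda>s. Z \<le> zeta k \<Lambda> \<delta> s) (at_right \<delta>)"
  proof eventually_elim
    case (elim s)
    have "(\<Sum>m<M. level_rho m powr (1 - s / \<delta>)) = (\<Sum>v\<in>verts \<Lambda>. perron v) * (\<Sum>m<M. level_rho m powr (1 - s / \<delta>))"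
      by (simp add: sum_perron)
    also have "\<dots> = (\<Sum>v\<in>verts \<Lambda>. \<Sum>m<M. level_rho m powr (- s / \<delta>) * (level_rho m * perron v))"
      unfolding sum_product mult.assoc[symmetric] powr_mult_self[OF level_rho_pos]
      by (simp only: mult.commute)
    also have "\<dots> \<le> (\<Sum>v\<in>verts \<Lambda>. \<Sum>m<M. level_term \<delta> s 0 v m)"
      unfolding level_term_def add_0
    proof (intro sum_mono mult_left_mono)
      fix v m assume v: "v \<in> verts \<Lambda>"
      have "perron w \<le> perron w powr s" if "w \<in> verts \<Lambda>" for w
        using powr_mono'[of s 1 "perron w"] perron_pos[OF that] perron_le_1[OF that] elim by simp
      then have "level_op 0 m perron v \<le> level_op 0 m (\<lambda>w. perron w powr s) v"
        using v by (rule level_op_mono)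
      then show "level_rho m * perron v \<le> level_op 0 m (\<lambda>w. perron w powr s) v"
        using level_op_perron[OF v, of 0 m] by simp
    qed auto
    also have "\<dots> \<le> (\<Sum>v\<in>verts \<Lambda>. ext_sum \<delta> s 0 v)"
      unfolding ext_sum_def using elim level_term_nonneg
      by (intro sum_mono sum_le_suminf summable_level_term) auto
    finally show ?case
      using elim zeta_eq[of s] by simp
  qed
qed

lemma ext_sum_ratio_descend:
  assumes \<delta>1: "\<delta> < 1" and G: "G \<le> at_right \<delta>"
    and F: "\<And>w. w \<in> verts \<Lambda> \<Longrightarrow> ((\<lambda>s. ext_sum \<delta> s (n + m) w / zeta k \<Lambda> \<delta> s) \<longlongrightarrow> F w) G"
    and v: "v \<in> verts \<Lambda>"
  shows "((\<lambda>s. ext_sum \<delta> s n v / zeta k \<Lambda> \<delta> s) \<longlongrightarrow> level_op n m F v) G"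
  using F v
proof (induction m arbitrary: n v)
  case 0
  then show ?case
    by simp
next
  case (Suc m)
  let ?c = "colour k (Suc n)"
  have IH: "((\<lambda>s. ext_sum \<delta> s (Suc n) w / zeta k \<Lambda> \<delta> s) \<longlongrightarrow> level_op (Suc n) m F w) G" if "w \<in> verts \<Lambda>" for w
    using Suc.IH[of "Suc n" w] Suc.prems(1) that by simp
  have "((\<lambda>s. level_rho n powr (- s / \<delta>) * perron v powr s / zeta k \<Lambda> \<delta> s) \<longlongrightarrow> 0) (at_right \<delta>)"
  proof (rule tendsto_divide_0)
    show "((\<lambda>s. level_rho n powr (- s / \<delta>) * perron v powr s) \<longlongrightarrow> level_rho n powr (- \<delta> / \<delta>) * perron v powr \<delta>) (at_right \<delta>)"
      using level_rho_pos[of n] perron_pos[OF Suc.prems(2)] \<delta> by (intro tendsto_intros) auto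
    show "filterlim (zeta k \<Lambda> \<delta>) at_infinity (at_right \<delta>)"
      using filterlim_zeta_at_top[OF \<delta>1] by (rule filterlim_at_top_imp_at_infinity)
  qed
  then have "((\<lambda>s. level_rho n powr (- s / \<delta>) * perron v powr s / zeta k \<Lambda> \<delta> s) \<longlongrightarrow> 0) G"
    by (rule tendsto_mono[OF G])
  moreover have "((\<lambda>s. edge_op \<Lambda> ?c (\<lambda>w. ext_sum \<delta> s (Suc n) w / zeta k \<Lambda> \<delta> s) v)
      \<longlongrightarrow> edge_op \<Lambda> ?c (level_op (Suc n) m F) v) G"
    unfolding edge_op_def
    by (intro tendsto_sum IH src_in_verts) (auto simp: mor_of_deg_def)
  ultimately have "((\<lambda>s. level_rho n powr (- s / \<delta>) * perron v powr s / zeta k \<Lambda> \<delta> s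
      + edge_op \<Lambda> ?c (\<lambda>w. ext_sum \<delta> s (Suc n) w / zeta k \<Lambda> \<delta> s) v) \<longlongrightarrow> 0 + level_op n (Suc m) F v) G"
    unfolding level_op_Suc by (rule tendsto_add)
  moreover have "eventually (\<lambda>s. ext_sum \<delta> s n v / zeta k \<Lambda> \<delta> s
      = level_rho n powr (- s / \<delta>) * perron v powr s / zeta k \<Lambda> \<delta> s
      + edge_op \<Lambda> ?c (\<lambda>w. ext_sum \<delta> s (Suc n) w / zeta k \<Lambda> \<delta> s) v) G"
    using filter_leD[OF G eventually_at_right_less]
  proof eventually_elim
    case (elim s)
    show ?case
      using ext_sum_step[OF elim Suc.prems(2), of n]
      by (simp add: edge_op_def add_divide_distrib sum_divide_distrib)
  qed
  ultimately show ?case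
    by (simp add: tendsto_cong)
qed

lemma ext_sum_ratio_tendsto_vertex:
  assumes \<delta>1: "\<delta> < 1" and v: "v \<in> verts \<Lambda>"
  shows "((\<lambda>s. ext_sum \<delta> s 0 v / zeta k \<Lambda> \<delta> s) \<longlongrightarrow> perron v) (at_right \<delta>)"
proof -
  have "eventually (\<lambda>s. 1 \<le> zeta k \<Lambda> \<delta> s) (at_right \<delta>)"
    using filterlim_zeta_at_top[OF \<delta>1] by (simp add: filterlim_at_top)
  then obtain b where b: "\<delta> < b" "\<And>s. \<delta> < s \<Longrightarrow> s < b \<Longrightarrow> 1 \<le> zeta k \<Lambda> \<delta> s"
    unfolding eventually_at_right_field by blast
  show ?thesis
  proof (rule tendsto_at_right_sequentially[OF b(1)])
    fix S :: "nat \<Rightarrow> real"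
    assume S: "\<And>n. \<delta> < S n" "\<And>n. S n < b" "S \<longlonglongrightarrow> \<delta>"
    define u where "u n v = ext_sum \<delta> (S n) 0 v / zeta k \<Lambda> \<delta> (S n)" for n v
    have Z: "1 \<le> zeta k \<Lambda> \<delta> (S n)" for n
      using b(2) S by blast
    have u_sum: "(\<Sum>v\<in>verts \<Lambda>. u n v) = 1" for n
      using Z[of n] zeta_eq[OF S(1)] by (simp add: u_def flip: sum_divide_distrib)
    have u_nonneg: "0 \<le> u n v" if "v \<in> verts \<Lambda>" for n v
      using Z[of n] ext_sum_nonneg[OF S(1) that, of n 0] by (simp add: u_def)
    have "u n v \<in> {0..1}" if "v \<in> verts \<Lambda>" for n v
      using u_nonneg member_le_sum[of v "verts \<Lambda>" "u n"] finite_verts u_sum that by auto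
    moreover have "y v = perron v" if r: "strict_mono (r :: nat \<Rightarrow> nat)"
      and y: "\<And>v. v \<in> verts \<Lambda> \<Longrightarrow> (\<lambda>n. u (r n) v) \<longlonglongrightarrow> y v" and v: "v \<in> verts \<Lambda>" for r y v
    proof (rule perron_unique[OF _ _ _ v])
      show "0 \<le> y v" if "v \<in> verts \<Lambda>" for v
        using y[OF that] u_nonneg[OF that] by (intro LIMSEQ_le_const) auto
      show "(\<Sum>v\<in>verts \<Lambda>. y v) = 1"
        using tendsto_sum[of "verts \<Lambda>" "\<lambda>v n. u (r n) v" y sequentially] y u_sum by (simp add: LIMSEQ_const_iff)
      define G where "G = filtermap (S \<circ> r) sequentially"
      have "filterlim S (at_right \<delta>) sequentially"
        using S by (intro tendsto_imp_filterlim_at_right) auto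
      then have "filterlim (S \<circ> r) (at_right \<delta>) sequentially"
        unfolding o_def by (rule filterlim_compose[OF _ filterlim_subseq[OF r]])
      then have G: "G \<le> at_right \<delta>"
        by (simp add: G_def filterlim_def)
      have yG: "((\<lambda>s. ext_sum \<delta> s 0 w / zeta k \<Lambda> \<delta> s) \<longlongrightarrow> y w) G" if "w \<in> verts \<Lambda>" for w
        using y[OF that] by (simp add: G_def filterlim_filtermap u_def)
      have "((\<lambda>s. ext_sum \<delta> s (0 + k) w / zeta k \<Lambda> \<delta> s) \<longlongrightarrow> 1 / total_rho * y w) G" if w: "w \<in> verts \<Lambda>" for w
      proof -
        have "((\<lambda>s. total_rho powr (- s / \<delta>)) \<longlongrightarrow> total_rho powr (- \<delta> / \<delta>)) (at_right \<delta>)"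
          using total_rho_pos \<delta> by (intro tendsto_intros) auto
        then have "((\<lambda>s. total_rho powr (- s / \<delta>)) \<longlongrightarrow> 1 / total_rho) G"
          using total_rho_pos \<delta> by (intro tendsto_mono[OF G]) (simp add: powr_minus divide_simps)
        then have "((\<lambda>s. total_rho powr (- s / \<delta>) * (ext_sum \<delta> s 0 w / zeta k \<Lambda> \<delta> s)) \<longlongrightarrow> 1 / total_rho * y w) G"
          using yG[OF w] by (rule tendsto_mult)
        moreover have "eventually (\<lambda>s. total_rho powr (- s / \<delta>) * (ext_sum \<delta> s 0 w / zeta k \<Lambda> \<delta> s)
            = ext_sum \<delta> s (0 + k) w / zeta k \<Lambda> \<delta> s) G"
          using filter_leD[OF G eventually_at_right_less] 
          by eventually_elim (simp only: ext_sum_add_period[OF _ w] times_divide_eq_right)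
        ultimately show ?thesis
          by (rule Lim_transform_eventually)
      qed
      from ext_sum_ratio_descend[OF \<delta>1 G this]
      have "((\<lambda>s. ext_sum \<delta> s 0 v / zeta k \<Lambda> \<delta> s) \<longlongrightarrow> 1 / total_rho * level_op 0 k y v) G" if "v \<in> verts \<Lambda>" for v
        using that unfolding level_op_scale by blast
      moreover have "G \<noteq> bot"
        by (simp add: G_def filtermap_bot_iff)
      ultimately have "y v = 1 / total_rho * level_op 0 k y v" if "v \<in> verts \<Lambda>" for v
        using that yG tendsto_unique by blast
      moreover have "map (colour k) [1..<Suc k] = [1..<Suc k]"
        by (rule map_idI) (auto simp: colour_def)
      ultimately have "y v = 1 / total_rho * edge_ops [1..<Suc k] y v" if "v \<in> verts \<Lambda>" for v
        using that by (simp only: level_op_def add_0 One_nat_def)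
      moreover have "total_rho * (1 / total_rho * a) = a" for a
        using total_rho_pos by simp
      ultimately have "edge_ops [1..<Suc k] y v = total_rho * y v" if "v \<in> verts \<Lambda>" for v
        using that by metis
      then show "edge_ops [1..<Suc k] y v = (\<Prod>i=1..k. rho \<Lambda> i) * y v" if "v \<in> verts \<Lambda>" for v
        using that unfolding total_rho_def by blast
    qed
    ultimately have "(\<lambda>n. u n v) \<longlonglongrightarrow> perron v"
      by (rule tendsto_family_if_limit_unique[OF finite_verts _ _ v])
    then show "(\<lambda>n. ext_sum \<delta> (S n) 0 v / zeta k \<Lambda> \<delta> (S n)) \<longlonglongrightarrow> perron v"
      by (simp add: u_def)
  qed
qed

lemma ext_sum_ratio_tendsto:
  assumes \<delta>1: "\<delta> < 1" and v: "v \<in> verts \<Lambda>"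
  shows "((\<lambda>s. ext_sum \<delta> s n v / zeta k \<Lambda> \<delta> s) \<longlongrightarrow> perron v / level_rho n) (at_right \<delta>)"
proof -
  have period: "((\<lambda>s. ext_sum \<delta> s (q * k) w / zeta k \<Lambda> \<delta> s) \<longlongrightarrow> 1 / total_rho ^ q * perron w) (at_right \<delta>)"
    if w: "w \<in> verts \<Lambda>" for q w
  proof (induction q)
    case 0
    then show ?case
      using ext_sum_ratio_tendsto_vertex[OF \<delta>1 w] by simp
  next
    case (Suc q)
    have "((\<lambda>s. total_rho powr (- s / \<delta>)) \<longlongrightarrow> total_rho powr (- \<delta> / \<delta>)) (at_right \<delta>)"
      using total_rho_pos \<delta> by (intro tendsto_intros) auto
    then have "((\<lambda>s. total_rho powr (- s / \<delta>) * (ext_sum \<delta> s (q * k) w / zeta k \<Lambda> \<delta> s))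
        \<longlongrightarrow> total_rho powr (- \<delta> / \<delta>) * (1 / total_rho ^ q * perron w)) (at_right \<delta>)"
      using Suc by (rule tendsto_mult)
    then have "((\<lambda>s. ext_sum \<delta> s (Suc q * k) w / zeta k \<Lambda> \<delta> s)
        \<longlongrightarrow> total_rho powr (- \<delta> / \<delta>) * (1 / total_rho ^ q * perron w)) (at_right \<delta>)"
    proof (rule Lim_transform_eventually)
      show "eventually (\<lambda>s. total_rho powr (- s / \<delta>) * (ext_sum \<delta> s (q * k) w / zeta k \<Lambda> \<delta> s)
          = ext_sum \<delta> s (Suc q * k) w / zeta k \<Lambda> \<delta> s) (at_right \<delta>)"
        using eventually_at_right_less[of \<delta>]
      proof eventually_elim
        case (elim s)
        show ?case
          using ext_sum_add_period[OF elim w, of "q * k"] by (simp add: add.commute)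
      qed
    qed
    moreover have "total_rho powr (- \<delta> / \<delta>) * (1 / total_rho ^ q * perron w) = 1 / total_rho ^ Suc q * perron w"
      using total_rho_pos \<delta> by (simp add: powr_minus divide_simps)
    ultimately show ?case
      by simp
  qed
  have "n \<le> n * k"
    using k_pos by simp
  then have "((\<lambda>s. ext_sum \<delta> s n v / zeta k \<Lambda> \<delta> s)
      \<longlongrightarrow> level_op n (n * k - n) (\<lambda>w. 1 / total_rho ^ n * perron w) v) (at_right \<delta>)"
    using period by (intro ext_sum_ratio_descend[OF \<delta>1 order_refl _ v]) simp
  also have "level_op n (n * k - n) (\<lambda>w. 1 / total_rho ^ n * perron w) v = perron v / level_rho n"
    unfolding level_op_scale level_op_perron[OF v] le_add_diff_inverse[OF \<open>n \<le> n * k\<close>] level_rho_period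
    using total_rho_pos by simp
  finally show ?thesis .
qed

lemma dixmier_measure_eq:
  assumes \<delta>1: "\<delta> < 1"
  shows "dixmier_measure k \<Lambda> \<delta> = path_measure"
  unfolding dixmier_measure_def
proof (rule the_equality)
  have lim: "((\<lambda>s. (\<Sum>\<^sub>\<infinity>\<eta>\<in>fpaths_ext k \<Lambda> \<gamma>. weight k \<Lambda> \<delta> \<eta> powr s) / zeta k \<Lambda> \<delta> s)
      \<longlongrightarrow> measure path_measure (bcyl k \<Lambda> \<gamma>)) (at_right \<delta>)" if \<gamma>: "\<gamma> \<in> fpaths k \<Lambda>" for \<gamma>
  proof -
    have "eventually (\<lambda>s. (\<Sum>\<^sub>\<infinity>\<eta>\<in>fpaths_ext k \<Lambda> \<gamma>. weight k \<Lambda> \<delta> \<eta> powr s) / zeta k \<Lambda> \<delta> s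
        = ext_sum \<delta> s (flen \<gamma>) (snd (fsrc \<Lambda> \<gamma>)) / zeta k \<Lambda> \<delta> s) (at_right \<delta>)"
      using eventually_at_right_less[of \<delta>]
      by eventually_elim (simp add: infsumI[OF has_sum_weight_powr[OF \<gamma>]])
    from tendsto_cong[OF this] show ?thesis
      using ext_sum_ratio_tendsto[OF \<delta>1 fsrc_in_verts[OF \<gamma>], of "flen \<gamma>"]
      by (simp only: measure_path_measure_bcyl[OF \<gamma>])
  qed
  have fin: "finite_measure path_measure"
    using prob_space_path_measure by (simp add: prob_space_def)
  show "sets path_measure = sets (bpath_borel k \<Lambda>) \<and> finite_measure path_measure
     \<and> (\<forall>\<gamma>\<in>fpaths k \<Lambda>.
          ((\<lambda>s. (\<Sum>\<^sub>\<infinity>\<eta>\<in>fpaths_ext k \<Lambda> \<gamma>. weight k \<Lambda> \<delta> \<eta> powr s) / zeta k \<Lambda> \<delta> s)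
             \<longlongrightarrow> measure path_measure (bcyl k \<Lambda> \<gamma>)) (at_right \<delta>))"
    using lim fin sets_path_measure by blast
  fix \<mu> assume \<mu>: "sets \<mu> = sets (bpath_borel k \<Lambda>) \<and> finite_measure \<mu>
     \<and> (\<forall>\<gamma>\<in>fpaths k \<Lambda>.
          ((\<lambda>s. (\<Sum>\<^sub>\<infinity>\<eta>\<in>fpaths_ext k \<Lambda> \<gamma>. weight k \<Lambda> \<delta> \<eta> powr s) / zeta k \<Lambda> \<delta> s)
             \<longlongrightarrow> measure \<mu> (bcyl k \<Lambda> \<gamma>)) (at_right \<delta>))"
  show "\<mu> = path_measure"
  proof (rule measure_eqI_bcyl)
    fix \<gamma> assume "\<gamma> \<in> fpaths k \<Lambda>"
    then show "measure \<mu> (bcyl k \<Lambda> \<gamma>) = measure path_measure (bcyl k \<Lambda> \<gamma>)"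
      using \<mu> lim tendsto_unique[OF trivial_limit_at_right_real] by blast
  qed (use \<mu> fin sets_path_measure in auto)
qed

end

end

theorem corollary3p10:
  fixes k :: nat and \<Lambda> :: "'m graded_category" and \<delta> :: real
  assumes "k \<ge> 1"
    and "k_graph k \<Lambda>"
    and "verts \<Lambda> \<noteq> {}"
    and "finite_graph k \<Lambda>"
    and "strongly_connected_graph \<Lambda>"
    and "irreducible_mat (adj_mat_prod k \<Lambda>)"
    and "0 < \<delta>" and "\<delta> < 1"
    and "\<forall>\<eta>\<in>fpaths k \<Lambda>. weight k \<Lambda> \<delta> \<eta> = bdiam k \<Lambda> \<delta> \<eta>"
  shows "dixmier_measure k \<Lambda> \<delta> = perron_measure_on_bpaths k \<Lambda>
    \<and> (\<forall>\<eta>\<in>fpaths k \<Lambda>. \<forall>q t. flen \<eta> = q * k + t \<and> t \<le> k - 1 \<longrightarrow>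
         measure (dixmier_measure k \<Lambda> \<delta>) (bcyl k \<Lambda> \<eta>)
           = (\<Prod>i=1..t. rho \<Lambda> i) powi (- (int q + 1)) * (\<Prod>i=t+1..k. rho \<Lambda> i) powi (- int q)
               * perron_vec k \<Lambda> (snd (fsrc \<Lambda> \<eta>))
         \<and> (\<Prod>i=1..t. rho \<Lambda> i) powi (- (int q + 1)) * (\<Prod>i=t+1..k. rho \<Lambda> i) powi (- int q)
               * perron_vec k \<Lambda> (snd (fsrc \<Lambda> \<eta>))
           = measure (perron_measure_on_bpaths k \<Lambda>) (bcyl k \<Lambda> \<eta>))
    \<and> prob_space (dixmier_measure k \<Lambda> \<delta>)
    \<and> (\<forall>\<delta>'. 0 < \<delta>' \<and> \<delta>' < 1 \<and> (\<forall>\<eta>\<in>fpaths k \<Lambda>. weight k \<Lambda> \<delta>' \<eta> = bdiam k \<Lambda> \<delta>' \<eta>)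
         \<longrightarrow> dixmier_measure k \<Lambda> \<delta>' = dixmier_measure k \<Lambda> \<delta>)"
proof -
  interpret irreducible_k_graph k \<Lambda>
    using assms by (intro irreducible_k_graph.intro finite_k_graph.intro
        finite_k_graph_axioms.intro irreducible_k_graph_axioms.intro) auto
  have dixmier: "dixmier_measure k \<Lambda> \<delta>' = path_measure"
    if "0 < \<delta>'" "\<delta>' < 1" "\<forall>\<eta>\<in>fpaths k \<Lambda>. weight k \<Lambda> \<delta>' \<eta> = bdiam k \<Lambda> \<delta>' \<eta>" for \<delta>'
    using dixmier_measure_eq[OF that(1) total_rho_gt_1[OF that(3)] that(2)] .
  have "measure path_measure (bcyl k \<Lambda> \<eta>)
      = (\<Prod>i=1..t. rho \<Lambda> i) powi (- (int q + 1)) * (\<Prod>i=t+1..k. rho \<Lambda> i) powi (- int q)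
          * perron (snd (fsrc \<Lambda> \<eta>))"
    if \<eta>: "\<eta> \<in> fpaths k \<Lambda>" and len: "flen \<eta> = q * k + t" "t \<le> k - 1" for \<eta> q t
  proof -
    have "t < k"
      using len(2) assms(1) by simp
    then have "level_rho (flen \<eta>) = (\<Prod>i=1..t. rho \<Lambda> i) ^ (q + 1) * (\<Prod>i=t+1..k. rho \<Lambda> i) ^ q"
      unfolding level_rho_eq[OF len(1) \<open>t < k\<close>] by (simp only: prod_power_distrib)
    moreover have "(\<Prod>i=1..t. rho \<Lambda> i) powi (- (int q + 1)) = inverse ((\<Prod>i=1..t. rho \<Lambda> i) ^ (q + 1))"
      using power_int_of_nat[of "\<Prod>i=1..t. rho \<Lambda> i" "q + 1"] by (simp only: power_int_minus of_nat_add of_nat_1)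
    ultimately show ?thesis
      unfolding measure_path_measure_bcyl[OF \<eta>] by (simp add: power_int_minus divide_simps)
  qed
  then show ?thesis
    using dixmier assms(7-9) prob_space_path_measure by (simp add: perron_measure_on_bpaths_eq)
qed

end
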